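(* Let $U := (\mathbb{R}^3\setminus B_1)\times\mathbb{R}$, where $B_1$ is the closed unit ball of $\mathbb{R}^3$. There exist infinitely many spacetime metrics $\overline{g}$ on $U$ such that $(U,\overline{g})$ is not spherically symmetric, is not static, and admits an inverse mean curvature vector flow coordinate chart $(t,r,\theta,\phi)$. Moreover, given such a spacetime $(U,\overline{g})$ with inverse mean curvature vector flow coordinate chart $(t,r,\theta,\phi)$, for each $t$ the coordinate spheres $S_{t,r}$ contained in the corresponding $t=\text{constant}$ slice, when reparametrized by $r^2=e^s$, form a smooth global solution of the inverse mean curvature vector flow equation; that is, for each fixed $t$ the family $F(\theta,\phi,s)=(t,e^{s/2},\theta,\phi)$ satisfies $\frac{\partial F}{\partial s}=\vec I_{\Sigma_s}$ on $\Sigma_s := S_{t,e^{s/2}}$ for all $s$ in the whole parameter range $(0,\infty)$.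
   Context: A spacetime is a connected, smooth, time-oriented 4-manifold with a Lorentzian metric $\overline g$ of signature $(-,+,+,+)$; $\overline\nabla$ is its Levi-Civita connection. Spherically symmetric: the isometry group contains a subgroup $G\cong SO(3)$ such that the $G$-orbit of every point is a two-sphere whose induced metric is a multiple of the standard round metric. Static: there is a hypersurface-orthogonal timelike Killing field. For a closed embedded spacelike surface $\Sigma$ with induced metric $g_\Sigma$, the mean curvature vector is $\vec H_\Sigma := \mathrm{trace}_{g_\Sigma}\vec{\mathrm{II}}$, where $\vec{\mathrm{II}}(X,Y)$ is the component of $\overline\nabla_XY$ normal to $\Sigma$. The inverse mean curvature vector is $\vec I_\Sigma := -\vec H_\Sigma/\langle\vec H_\Sigma,\vec H_\Sigma\rangle_{\overline g}$. A smooth inverse mean curvature vector flow is a smooth family of surfaces $F(\cdot,s)$, $\Sigma_s=F(\Sigma,s)$, with $\frac{\partial}{\partial s}F(x,s)=\vec I_{\Sigma_s}(x,s)$. Inverse mean curvature vector flow coordinate chart on $U$: coordinates $t\in\mathbb R$, $r>1$, $(\theta,\phi)$ spherical coordinates on the two-sphere ($0<\theta<\pi$, $0<\phi<2\pi$), whose coordinate spheres $S_{t,r}$ ($t,r$ constant) are closed embedded spheres, and in which $$\overline g=\begin{pmatrix}-v^2&d&e&f\\ d&u^2&0&0\\ e&0&a&c\\ f&0&c&b\end{pmatrix}$$ in the order $(t,r,\theta,\phi)$ with smooth functions $u,v,a,b,c,d,e,f$, such that: (1) $\langle\partial_r,\partial_\theta\rangle=0$; (2) $\langle\partial_r,\partial_\phi\rangle=0$;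 (3) the area form of $S_{t,r}$ is $dA_{t,r}=r^2\sin\theta\,d\theta\,d\phi$ (i.e. $ab-c^2=r^4\sin^2\theta$); (4) the mean curvature vector $\vec H_{t,r}$ of $S_{t,r}$ is tangential to the (spacelike) hypersurface $t=\text{constant}$. *)

theory Defs
  imports "HOL-Analysis.Analysis" "HOL-Algebra.Bij"
begin

section \<open>Smooth maps and submanifolds of Euclidean spaces\<close>

text \<open>Derivatives are taken in the ambient space, so the following two predicates are meant for
  open sets only.\<close>

primrec Ck_on ::
  "nat \<Rightarrow> ('a::real_normed_vector \<Rightarrow> 'b::real_normed_vector) \<Rightarrow> 'a set \<Rightarrow> bool" where
  "Ck_on 0 f S \<longleftrightarrow> continuous_on S f"
| "Ck_on (Suc k) f S \<longleftrightarrow>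
     (\<forall>x\<in>S. f differentiable (at x)) \<and> (\<forall>v. Ck_on k (\<lambda>x. frechet_derivative f (at x) v) S)"

definition smooth_on :: "'a::real_normed_vector set \<Rightarrow> ('a \<Rightarrow> 'b::real_normed_vector) \<Rightarrow> bool" where
  "smooth_on S f \<longleftrightarrow> (\<forall>k. Ck_on k f S)"

definition diffeo_on ::
  "'a::real_normed_vector set \<Rightarrow> 'b::real_normed_vector set \<Rightarrow> ('a \<Rightarrow> 'b) \<Rightarrow> bool" where
  "diffeo_on M N f \<longleftrightarrow> bij_betw f M N \<and> smooth_on M f \<and> smooth_on N (inv_into M f)"

definition tangent_space :: "'a::real_normed_vector set \<Rightarrow> 'a \<Rightarrow> 'a set" where
  "tangent_space S p =
     {v. \<exists>\<gamma> \<epsilon>. 0 < \<epsilon> \<and> smooth_on {-\<epsilon><..<\<epsilon>} \<gamma> \<and> \<gamma> ` {-\<epsilon><..<\<epsilon>} \<subseteq> S \<and> \<gamma> 0 = p \<and>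
           (\<gamma> has_vector_derivative v) (at (0::real))}"

text \<open>Smoothness on the sphere is expressed by a smooth extension to a neighbourhood; the values of
  the derivative on vectors tangent to the sphere do not depend on the extension. By compactness of
  the sphere an injective immersion is an embedding.\<close>

definition sphere_embedding :: "'a::real_normed_vector set \<Rightarrow> (real^3 \<Rightarrow> 'a) \<Rightarrow> bool" where
  "sphere_embedding M \<iota> \<longleftrightarrow>
     (\<exists>N. open N \<and> sphere 0 1 \<subseteq> N \<and> smooth_on N \<iota>) \<and>
     \<iota> ` sphere 0 1 \<subseteq> M \<and> inj_on \<iota> (sphere 0 1) \<and>
     (\<forall>x\<in>sphere 0 1. \<forall>v. v \<bullet> x = 0 \<and> v \<noteq> 0 \<longrightarrow> frechet_derivative \<iota> (at x) v \<noteq> 0)"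


section \<open>Lorentzian geometry on open subsets of a four-dimensional vector space\<close>

type_synonym event = "(real^3) \<times> real"

text \<open>The number \<open>g p v w\<close> is the value of the metric at the point \<open>p\<close> on the vectors \<open>v\<close>, \<open>w\<close>.\<close>

type_synonym tensor2 = "event \<Rightarrow> event \<Rightarrow> event \<Rightarrow> real"

definition lorentz_metric :: "event set \<Rightarrow> tensor2 \<Rightarrow> bool" where
  "lorentz_metric M g \<longleftrightarrow>
     (\<forall>p\<in>M. bilinear (g p) \<and> (\<forall>v w. g p v w = g p w v) \<and>
        (\<exists>e :: nat \<Rightarrow> event. \<forall>i<4. \<forall>j<4.
            g p (e i) (e j) = (if i \<noteq> j then 0 else if i = 0 then - 1 else 1))) \<and>
     (\<forall>v w. smooth_on M (\<lambda>p. g p v w))"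

definition timelike_field :: "event set \<Rightarrow> tensor2 \<Rightarrow> (event \<Rightarrow> event) \<Rightarrow> bool" where
  "timelike_field M g X \<longleftrightarrow> smooth_on M X \<and> (\<forall>p\<in>M. g p (X p) (X p) < 0)"

text \<open>The last clause is time-orientability.\<close>

definition spacetime :: "event set \<Rightarrow> tensor2 \<Rightarrow> bool" where
  "spacetime M g \<longleftrightarrow> open M \<and> connected M \<and> lorentz_metric M g \<and> (\<exists>T. timelike_field M g T)"

text \<open>A connection on an open subset of a vector space is the directional derivative plus a bilinear
  field \<open>\<Gamma>\<close>. The Levi-Civita connection is the one which is torsion-free (\<open>\<Gamma>\<close> symmetric) and metric;
  both conditions are tensorial, hence are stated for constant vector fields.\<close>

definition christoffel :: "tensor2 \<Rightarrow> event \<Rightarrow> event \<Rightarrow> event \<Rightarrow> event" where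
  "christoffel g p = (THE \<Gamma>. bilinear \<Gamma> \<and> (\<forall>x y. \<Gamma> x y = \<Gamma> y x) \<and>
     (\<forall>x y z. frechet_derivative (\<lambda>q. g q y z) (at p) x = g p (\<Gamma> x y) z + g p y (\<Gamma> x z)))"

definition covariant_derivative ::
  "tensor2 \<Rightarrow> event \<Rightarrow> event \<Rightarrow> (event \<Rightarrow> event) \<Rightarrow> event" where
  "covariant_derivative g p x Y = frechet_derivative Y (at p) x + christoffel g p x (Y p)"

text \<open>Lie derivative of \<open>g\<close> along \<open>X\<close>, evaluated on constant fields \<open>v\<close>, \<open>w\<close>; note that the bracket
  of \<open>X\<close> with a constant field \<open>v\<close> is minus the derivative of \<open>X\<close> in direction \<open>v\<close>.\<close>

definition lie_derivative_metric ::
  "tensor2 \<Rightarrow> (event \<Rightarrow> event) \<Rightarrow> event \<Rightarrow> event \<Rightarrow> event \<Rightarrow> real" where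
  "lie_derivative_metric g X p v w =
     frechet_derivative (\<lambda>q. g q v w) (at p) (X p) +
     g p (frechet_derivative X (at p) v) w + g p v (frechet_derivative X (at p) w)"

definition killing_field :: "event set \<Rightarrow> tensor2 \<Rightarrow> (event \<Rightarrow> event) \<Rightarrow> bool" where
  "killing_field M g X \<longleftrightarrow>
     smooth_on M X \<and> (\<forall>p\<in>M. \<forall>v w. lie_derivative_metric g X p v w = 0)"

text \<open>Locally, the level hypersurfaces of \<open>f\<close> are orthogonal to \<open>X\<close>.\<close>

definition hypersurface_orthogonal :: "event set \<Rightarrow> tensor2 \<Rightarrow> (event \<Rightarrow> event) \<Rightarrow> bool" where
  "hypersurface_orthogonal M g X \<longleftrightarrow>
     (\<forall>p\<in>M. \<exists>V (f :: event \<Rightarrow> real). open V \<and> p \<in> V \<and> V \<subseteq> M \<and> smooth_on V f \<and>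
        (\<forall>q\<in>V. (\<exists>w. frechet_derivative f (at q) w \<noteq> 0) \<and>
           {w. frechet_derivative f (at q) w = 0} = {w. g q (X q) w = 0}))"

definition static :: "event set \<Rightarrow> tensor2 \<Rightarrow> bool" where
  "static M g \<longleftrightarrow>
     (\<exists>X. killing_field M g X \<and> timelike_field M g X \<and> hypersurface_orthogonal M g X)"

definition isometries :: "event set \<Rightarrow> tensor2 \<Rightarrow> (event \<Rightarrow> event) set" where
  "isometries M g = {h \<in> Bij M. diffeo_on M M h \<and>
     (\<forall>p\<in>M. \<forall>v w. g (h p) (frechet_derivative h (at p) v) (frechet_derivative h (at p) w) = g p v w)}"

definition isometry_group :: "event set \<Rightarrow> tensor2 \<Rightarrow> (event \<Rightarrow> event) monoid" where
  "isometry_group M g = (BijGroup M)\<lparr>carrier := isometries M g\<rparr>"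

definition SO3 :: "(real^3^3) monoid" where
  "SO3 = \<lparr>carrier = {A. rotation_matrix A}, mult = (**), one = mat 1\<rparr>"

definition round_sphere :: "event set \<Rightarrow> tensor2 \<Rightarrow> event set \<Rightarrow> bool" where
  "round_sphere M g S \<longleftrightarrow>
     (\<exists>\<iota>. sphere_embedding M \<iota> \<and> S = \<iota> ` sphere 0 1 \<and>
        (\<exists>k>0. \<forall>x\<in>sphere 0 1. \<forall>v w. v \<bullet> x = 0 \<and> w \<bullet> x = 0 \<longrightarrow>
            g (\<iota> x) (frechet_derivative \<iota> (at x) v) (frechet_derivative \<iota> (at x) w) = k * (v \<bullet> w)))"

text \<open>The isomorphism is one of Lie groups: \<open>\<rho>\<close> is continuous for the compact-open topology on
  isometries, that is, the action is jointly continuous. Continuity of the inverse of \<open>\<rho>\<close> then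
  follows from compactness of the rotation group.\<close>

definition spherically_symmetric :: "event set \<Rightarrow> tensor2 \<Rightarrow> bool" where
  "spherically_symmetric M g \<longleftrightarrow>
     (\<exists>G \<rho>. subgroup G (isometry_group M g) \<and>
        \<rho> \<in> iso SO3 ((isometry_group M g)\<lparr>carrier := G\<rparr>) \<and>
        continuous_on (carrier SO3 \<times> M) (\<lambda>(A, p). \<rho> A p) \<and>
        (\<forall>p\<in>M. round_sphere M g ((\<lambda>h. h p) ` G)))"


section \<open>Mean curvature vector and inverse mean curvature vector flow\<close>

definition spacelike :: "tensor2 \<Rightarrow> event set \<Rightarrow> bool" where
  "spacelike g S \<longleftrightarrow> (\<forall>p\<in>S. \<forall>v\<in>tangent_space S p. v \<noteq> 0 \<longrightarrow> 0 < g p v v)"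

definition normal_part :: "tensor2 \<Rightarrow> event set \<Rightarrow> event \<Rightarrow> event \<Rightarrow> event" where
  "normal_part g S p w =
     (THE n. (\<forall>x\<in>tangent_space S p. g p n x = 0) \<and> w - n \<in> tangent_space S p)"

text \<open>The vector \<open>y\<close> is extended to a smooth field \<open>Y\<close> near \<open>p\<close> which is tangent to \<open>S\<close> along \<open>S\<close>; the
  result does not depend on the extension.\<close>

definition second_fundamental_form ::
  "tensor2 \<Rightarrow> event set \<Rightarrow> event \<Rightarrow> event \<Rightarrow> event \<Rightarrow> event" where
  "second_fundamental_form g S p x y =
     (THE n. \<exists>V Y. open V \<and> p \<in> V \<and> smooth_on V Y \<and> (\<forall>q\<in>S \<inter> V. Y q \<in> tangent_space S q) \<and>
        Y p = y \<and> n = normal_part g S p (covariant_derivative g p x Y))"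

text \<open>For a spacelike two-dimensional \<open>S\<close>: the trace is the sum over any orthonormal basis
  \<open>x\<close>, \<open>y\<close> of the tangent plane.\<close>

definition mean_curvature_vector :: "tensor2 \<Rightarrow> event set \<Rightarrow> event \<Rightarrow> event" where
  "mean_curvature_vector g S p =
     (THE H. \<exists>x\<in>tangent_space S p. \<exists>y\<in>tangent_space S p.
        g p x x = 1 \<and> g p y y = 1 \<and> g p x y = 0 \<and>
        H = second_fundamental_form g S p x x + second_fundamental_form g S p y y)"

definition inverse_mean_curvature_vector :: "tensor2 \<Rightarrow> event set \<Rightarrow> event \<Rightarrow> event" where
  "inverse_mean_curvature_vector g S p =
     (let H = mean_curvature_vector g S p in - (1 / g p H H) *\<^sub>R H)"

text \<open>The flow of two-spheres, for parameters in \<open>J\<close>. The condition \<open>g p H H \<noteq> 0\<close> makes the inverse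
  mean curvature vector well-defined.\<close>

definition smooth_imcv_flow ::
  "event set \<Rightarrow> tensor2 \<Rightarrow> real set \<Rightarrow> (real^3 \<Rightarrow> real \<Rightarrow> event) \<Rightarrow> bool" where
  "smooth_imcv_flow M g J F \<longleftrightarrow>
     (\<exists>N. open N \<and> sphere 0 1 \<times> J \<subseteq> N \<and> smooth_on N (\<lambda>(x, s). F x s)) \<and>
     (\<forall>s\<in>J. let S = (\<lambda>x. F x s) ` sphere 0 1 in
        sphere_embedding M (\<lambda>x. F x s) \<and> spacelike g S \<and>
        (\<forall>p\<in>S. let H = mean_curvature_vector g S p in g p H H \<noteq> 0) \<and>
        (\<forall>x\<in>sphere 0 1.
           ((\<lambda>\<sigma>. F x \<sigma>) has_vector_derivative inverse_mean_curvature_vector g S (F x s)) (at s)))"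


section \<open>Inverse mean curvature vector flow coordinates\<close>

definition exterior :: "event set" where
  "exterior = (- cball 0 1) \<times> UNIV"

text \<open>A chart is encoded by a diffeomorphism \<open>\<Phi>\<close> of the exterior region: the point with coordinates
  \<open>t\<close>, \<open>r\<close> and position \<open>x\<close> on the unit sphere is \<open>\<Phi> (r x, t)\<close>. Thus \<open>\<Phi>\<close> also accounts for the points
  of the coordinate spheres which are not covered by spherical coordinates.\<close>

definition chart_point :: "(event \<Rightarrow> event) \<Rightarrow> real \<Rightarrow> real \<Rightarrow> real^3 \<Rightarrow> event" where
  "chart_point \<Phi> t r x = \<Phi> (r *\<^sub>R x, t)"

definition coordinate_sphere :: "(event \<Rightarrow> event) \<Rightarrow> real \<Rightarrow> real \<Rightarrow> event set" where
  "coordinate_sphere \<Phi> t r = chart_point \<Phi> t r ` sphere 0 1"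

definition time_slice :: "(event \<Rightarrow> event) \<Rightarrow> real \<Rightarrow> event set" where
  "time_slice \<Phi> t = (\<Union>r\<in>{1<..}. coordinate_sphere \<Phi> t r)"

definition spherical :: "real \<Rightarrow> real \<Rightarrow> real^3" where
  "spherical \<theta> \<phi> = vector [sin \<theta> * cos \<phi>, sin \<theta> * sin \<phi>, cos \<theta>]"

type_synonym coords = "real \<times> real \<times> real \<times> real"

definition coord_domain :: "coords set" where
  "coord_domain = UNIV \<times> {1<..} \<times> {0<..<pi} \<times> {0<..<2 * pi}"

definition coord_map :: "(event \<Rightarrow> event) \<Rightarrow> coords \<Rightarrow> event" where
  "coord_map \<Phi> = (\<lambda>(t, r, \<theta>, \<phi>). chart_point \<Phi> t r (spherical \<theta> \<phi>))"

definition metric_coeff :: "tensor2 \<Rightarrow> (event \<Rightarrow> event) \<Rightarrow> coords \<Rightarrow> coords \<Rightarrow> coords \<Rightarrow> real" where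
  "metric_coeff g \<Phi> i j q =
     g (coord_map \<Phi> q) (frechet_derivative (coord_map \<Phi>) (at q) i)
                       (frechet_derivative (coord_map \<Phi>) (at q) j)"

definition imcvf_chart :: "tensor2 \<Rightarrow> (event \<Rightarrow> event) \<Rightarrow> bool" where
  "imcvf_chart g \<Phi> \<longleftrightarrow>
     diffeo_on exterior exterior \<Phi> \<and>
     (\<forall>t. \<forall>r>1. sphere_embedding exterior (chart_point \<Phi> t r)) \<and>
     (\<exists>u v a b c d e f :: coords \<Rightarrow> real.
        (\<forall>h\<in>{u, v, a, b, c, d, e, f}. smooth_on coord_domain h) \<and>
        (\<forall>q\<in>coord_domain.
           let dt = (1, 0, 0, 0); dr = (0, 1, 0, 0); d\<theta> = (0, 0, 1, 0); d\<phi> = (0, 0, 0, 1);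
               G = metric_coeff g \<Phi>
           in G dt dt q = - (v q)\<^sup>2 \<and> G dt dr q = d q      \<and> G dt d\<theta> q = e q \<and> G dt d\<phi> q = f q \<and>
                                     G dr dr q = (u q)\<^sup>2 \<and> G dr d\<theta> q = 0   \<and> G dr d\<phi> q = 0 \<and>
                                                           G d\<theta> d\<theta> q = a q \<and> G d\<theta> d\<phi> q = c q \<and>
                                                                            G d\<phi> d\<phi> q = b q) \<and>
        (\<forall>(t, r, \<theta>, \<phi>)\<in>coord_domain.
           sqrt (a (t, r, \<theta>, \<phi>) * b (t, r, \<theta>, \<phi>) - (c (t, r, \<theta>, \<phi>))\<^sup>2) = r\<^sup>2 * sin \<theta>)) \<and>
     (\<forall>t. spacelike g (time_slice \<Phi> t)) \<and>
     (\<forall>t. \<forall>r>1. \<forall>p\<in>coordinate_sphere \<Phi> t r.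
        mean_curvature_vector g (coordinate_sphere \<Phi> t r) p \<in> tangent_space (time_slice \<Phi> t) p)"

end

theory Submission
  imports Defs
begin

text \<open>
Why the flow statement holds. Pull the metric back along the chart to a metric \<open>h\<close> on the exterior
region, and let \<open>y\<close> be the position vector, so that \<open>y\<close> is normal to the round spheres and generates
the dilations. Off the half-plane that spherical coordinates miss, the conditions on the coefficients
say that \<open>y\<close> is \<open>h\<close>-orthogonal to the spheres about the origin and that \<open>h\<close> induces on them the
Euclidean area element; both are identities between continuous functions, so they hold everywhere
(lemmas \<open>radial_orthogonal\<close> and \<open>area_element\<close>). For \<open>v\<close> tangent to a sphere, the Koszul formula gives
\<open>\<langle>II(v,v), y\<rangle> = - h(v,v) - (\<partial>\<^sub>y h)(v,v) / 2\<close>. Summed over an orthonormal pair, the last term is the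
logarithmic derivative of the area density relative to the Euclidean one, which vanishes; hence
\<open>\<langle>H, y\<rangle> = - 2\<close>. Since \<open>H\<close> is normal to the sphere and tangent to the time slice it is a multiple of
\<open>y\<close>, and therefore \<open>- H / \<langle>H, H\<rangle> = y / 2\<close>. This is the velocity of \<open>s \<mapsto> exp (s / 2) x\<close>
(theorem \<open>coordinate_spheres_flow\<close>).

Why there are many examples. Every metric \<open>- V\<^sup>2 dt\<^sup>2 + |dy|\<^sup>2\<close> with a positive function \<open>V\<close> of \<open>y\<close> and
\<open>t\<close> has the identity as a chart of the required kind: the spheres are round, and the time slices are
totally geodesic and flat, so \<open>H\<close> is tangent to them. Take
\<open>V = k + |y - c|\<^sup>4 + t\<^sup>2 |y - c|\<^sup>2\<close> with a point \<open>c\<close> of the exterior and \<open>k > 0\<close>.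

The curvature of such a metric is governed by the spatial Hessian of \<open>V\<close>, and for this \<open>V\<close> the
curvature tensor vanishes at the single point \<open>(c, 0)\<close>. Isometries preserve the curvature tensor, hence
all of them fix \<open>(c, 0)\<close>. Under spherical symmetry the orbit of this point would be a
two-sphere, a contradiction (\<open>not_spherically_symmetric\<close>).

Let \<open>X\<close> be a Killing field and restrict the Killing equations to a line \<open>c + s e\<close> with a unit vector
\<open>e\<close>. Its \<open>e\<close>-component does not depend on \<open>s\<close>; since \<open>V\<close> is even in \<open>s\<close>, the time component \<open>T\<close> then
satisfies \<open>T(s,t) + T(-s,t) = 2 T(0,t)\<close>. Adding the remaining Killing equation at \<open>s\<close> and \<open>-s\<close> leaves
\<open>t s\<^sup>2 T(0,t) = 0\<close>, so that \<open>X\<close> is not timelike at \<open>(c, 1)\<close> (\<open>not_static\<close>). Different constants \<open>k\<close>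
give different metrics.
\<close>

section \<open>Smooth maps\<close>

lemma frechet_derivative_eqI:
  "(f has_derivative f') (at x) \<Longrightarrow> frechet_derivative f (at x) = f'"
  using frechet_derivative_at by metis

lemma Ck_on_cong:
  assumes "open S" "\<forall>x\<in>S. f x = g x" "Ck_on k f S"
  shows "Ck_on k g S"
  using assms(2,3)
proof (induction k arbitrary: f g)
  case 0
  then show ?case using continuous_on_cong[of S S f g] by simp
next
  case (Suc k)
  have d: "(g has_derivative frechet_derivative f (at x)) (at x)" if "x \<in> S" for x
  proof (rule has_derivative_transform_within_open[OF _ assms(1) that])
    show "(f has_derivative frechet_derivative f (at x)) (at x)"
      using Suc.prems(2) that by (simp add: frechet_derivative_works)
  qed (use Suc.prems(1) in simp)
  have "Ck_on k (\<lambda>x. frechet_derivative g (at x) v) S" for v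
  proof (rule Suc.IH)
    show "\<forall>x\<in>S. frechet_derivative f (at x) v = frechet_derivative g (at x) v"
      by (simp add: frechet_derivative_eqI[OF d])
  qed (use Suc.prems(2) in simp)
  then show ?case using d by (auto simp: differentiable_def)
qed

lemma Ck_on_SucI:
  assumes "open S" "\<And>x. x \<in> S \<Longrightarrow> (f has_derivative f' x) (at x)"
    and "\<And>v. Ck_on k (\<lambda>x. f' x v) S"
  shows "Ck_on (Suc k) f S"
proof -
  have "Ck_on k (\<lambda>x. frechet_derivative f (at x) v) S" for v
    by (rule Ck_on_cong[OF assms(1) _ assms(3)[of v]]) (simp add: frechet_derivative_eqI[OF assms(2)])
  then show ?thesis using assms(2) by (auto simp: differentiable_def)
qed

lemma Ck_on_Suc_derivative:
  assumes "Ck_on (Suc k) f S" "x \<in> S"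
  shows "(f has_derivative frechet_derivative f (at x)) (at x)"
  using assms frechet_derivative_works[of f "at x"] by auto

text \<open>For \<open>k = 0\<close> this is continuity of differentiable maps, which is the only step of the induction
that does not merely pass to a derivative.\<close>

lemma Ck_on_lower: "Ck_on (Suc k) f S \<Longrightarrow> Ck_on k f S"
proof (induction k arbitrary: f)
  case 0
  then show ?case
    by (simp add: differentiable_imp_continuous_on differentiable_on_def differentiable_at_withinI)
next
  case (Suc k)
  from Suc.prems show ?case using Suc.IH
    by (subst Ck_on.simps) (subst (asm) Ck_on.simps, blast)
qed

lemma Ck_on_const: "Ck_on k (\<lambda>x. c) S"
  by (induction k arbitrary: c) auto

lemma Ck_on_linear:
  assumes "open S" "bounded_linear L" "Ck_on k f S"
  shows "Ck_on k (\<lambda>x. L (f x)) S"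
  using assms(3)
proof (induction k arbitrary: f)
  case 0
  then show ?case using assms(2) by (auto intro: bounded_linear.continuous_on)
next
  case (Suc k)
  show ?case
    by (rule Ck_on_SucI[OF assms(1) bounded_linear.has_derivative[OF assms(2) Ck_on_Suc_derivative[OF Suc.prems]]])
      (use Suc in auto)
qed

lemma Ck_on_ident: "open S \<Longrightarrow> Ck_on k (\<lambda>x. x) S"
  by (cases k) (auto intro: continuous_on_id Ck_on_const)

lemma Ck_on_add:
  assumes "open S" "Ck_on k f S" "Ck_on k g S"
  shows "Ck_on k (\<lambda>x. f x + g x) S"
  using assms(2,3)
proof (induction k arbitrary: f g)
  case 0
  then show ?case by (auto intro: continuous_on_add)
next
  case (Suc k)
  show ?case
    by (rule Ck_on_SucI[OF assms(1) has_derivative_add[OF Ck_on_Suc_derivative[OF Suc.prems(1)] Ck_on_Suc_derivative[OF Suc.prems(2)]]])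
      (use Suc in auto)
qed

text \<open>The induction goes through because the derivative of a product is a sum of products that involve
the factors themselves, which are of class \<open>C\<^sup>k\<close> as they are of class \<open>C\<^sup>k\<^sup>+\<^sup>1\<close>.\<close>

lemma Ck_on_bilinear:
  assumes "open S" "bounded_bilinear B" "Ck_on k f S" "Ck_on k g S"
  shows "Ck_on k (\<lambda>x. B (f x) (g x)) S"
  using assms(3,4)
proof (induction k arbitrary: f g)
  case 0
  then show ?case using assms(2) by (auto intro: bounded_bilinear.continuous_on)
next
  case (Suc k)
  have "Ck_on k f S" "Ck_on k g S" using Suc.prems Ck_on_lower by blast+
  moreover have "Ck_on k (\<lambda>x. frechet_derivative f (at x) v) S"
    "Ck_on k (\<lambda>x. frechet_derivative g (at x) v) S" for v
    using Suc.prems by auto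
  ultimately show ?case
    by (intro Ck_on_SucI[OF assms(1) bounded_bilinear.FDERIV[OF assms(2) Ck_on_Suc_derivative[OF Suc.prems(1)] Ck_on_Suc_derivative[OF Suc.prems(2)]]]
        Ck_on_add[OF assms(1)] Suc.IH)
qed

lemma Ck_on_sum:
  assumes "open S" "\<And>i. i \<in> I \<Longrightarrow> Ck_on k (f i) S"
  shows "Ck_on k (\<lambda>x. \<Sum>i\<in>I. f i x) S"
  using assms(2)
proof (induction I rule: infinite_finite_induct)
  case (insert i I)
  have "Ck_on k (\<lambda>x. f i x + (\<Sum>i\<in>I. f i x)) S"
    by (rule Ck_on_add[OF assms(1)]) (use insert in auto)
  with insert show ?case by simp
qed (simp_all add: Ck_on_const)

lemma linear_expand_Basis:
  fixes f :: "'a::euclidean_space \<Rightarrow> 'b::real_vector"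
  assumes "linear f"
  shows "f v = (\<Sum>b\<in>Basis. (v \<bullet> b) *\<^sub>R f b)"
proof -
  have "f v = f (\<Sum>b\<in>Basis. (v \<bullet> b) *\<^sub>R b)" by (simp add: euclidean_representation)
  also have "\<dots> = (\<Sum>b\<in>Basis. (v \<bullet> b) *\<^sub>R f b)"
    using assms by (simp add: linear_sum linear_cmul)
  finally show ?thesis .
qed

text \<open>By the chain rule and linearity, the derivative of \<open>f \<circ> g\<close> in direction \<open>v\<close> is the sum over basis
vectors \<open>b\<close> of the \<open>b\<close>-component of the derivative of \<open>g\<close> times \<open>(\<partial>\<^sub>b f) \<circ> g\<close>, to which the induction
hypothesis applies. This expansion is the reason for taking the intermediate space Euclidean.\<close>

lemma Ck_on_compose:
  fixes f :: "'b::euclidean_space \<Rightarrow> 'c::real_normed_vector" and g :: "'a::real_normed_vector \<Rightarrow> 'b"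
  assumes "open S" "Ck_on k f T" "Ck_on k g S" "g ` S \<subseteq> T"
  shows "Ck_on k (\<lambda>x. f (g x)) S"
  using assms(2,3)
proof (induction k arbitrary: f)
  case 0
  then show ?case using assms(4) continuous_on_compose2[of T f S g] by simp
next
  case (Suc k)
  have df: "(f has_derivative frechet_derivative f (at (g x))) (at (g x))" if "x \<in> S" for x
    by (rule Ck_on_Suc_derivative[OF Suc.prems(1)]) (use that assms(4) in blast)
  have lin: "frechet_derivative f (at (g x)) v =
      (\<Sum>b\<in>Basis. (v \<bullet> b) *\<^sub>R frechet_derivative f (at (g x)) b)" if "x \<in> S" for x v
    using linear_expand_Basis[OF has_derivative_linear[OF df[OF that]]] .
  have d: "((\<lambda>x. f (g x)) has_derivative
      (\<lambda>v. (\<Sum>b\<in>Basis. (frechet_derivative g (at x) v \<bullet> b) *\<^sub>R frechet_derivative f (at (g x)) b))) (at x)"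
    if "x \<in> S" for x
    by (rule has_derivative_eq_rhs[OF has_derivative_compose[OF Ck_on_Suc_derivative[OF Suc.prems(2) that] df[OF that]]])
      (rule ext, rule lin[OF that])
  have "Ck_on k (\<lambda>x. frechet_derivative g (at x) v \<bullet> b) S" for v b
    by (rule Ck_on_linear[OF assms(1) bounded_linear_inner_left]) (use Suc.prems(2) in simp)
  moreover have "Ck_on k (\<lambda>x. frechet_derivative f (at (g x)) b) S" for b
    by (rule Suc.IH[OF _ Ck_on_lower[OF Suc.prems(2)]]) (use Suc.prems(1) in simp)
  ultimately have "Ck_on k (\<lambda>x. (frechet_derivative g (at x) v \<bullet> b) *\<^sub>R frechet_derivative f (at (g x)) b) S" for v b
    by (rule Ck_on_bilinear[OF assms(1) bounded_bilinear_scaleR])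
  then have "Ck_on k (\<lambda>x. \<Sum>b\<in>Basis. (frechet_derivative g (at x) v \<bullet> b) *\<^sub>R frechet_derivative f (at (g x)) b) S" for v
    by (rule Ck_on_sum[OF assms(1)])
  with d show ?case
    by (rule Ck_on_SucI[OF assms(1)])
qed

lemma smooth_on_cong: "open S \<Longrightarrow> \<forall>x\<in>S. f x = g x \<Longrightarrow> smooth_on S f \<Longrightarrow> smooth_on S g"
  unfolding smooth_on_def using Ck_on_cong by blast

lemma smooth_on_const: "smooth_on S (\<lambda>x. c)"
  unfolding smooth_on_def using Ck_on_const by blast

lemma smooth_on_ident: "open S \<Longrightarrow> smooth_on S (\<lambda>x. x)"
  unfolding smooth_on_def using Ck_on_ident by blast

lemma smooth_on_linear: "open S \<Longrightarrow> bounded_linear L \<Longrightarrow> smooth_on S f \<Longrightarrow> smooth_on S (\<lambda>x. L (f x))"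
  unfolding smooth_on_def using Ck_on_linear by blast

lemma smooth_on_add: "open S \<Longrightarrow> smooth_on S f \<Longrightarrow> smooth_on S g \<Longrightarrow> smooth_on S (\<lambda>x. f x + g x)"
  unfolding smooth_on_def using Ck_on_add by blast

lemma smooth_on_bilinear:
  "open S \<Longrightarrow> bounded_bilinear B \<Longrightarrow> smooth_on S f \<Longrightarrow> smooth_on S g \<Longrightarrow> smooth_on S (\<lambda>x. B (f x) (g x))"
  unfolding smooth_on_def using Ck_on_bilinear by blast

lemmas smooth_on_mult = smooth_on_bilinear[OF _ bounded_bilinear_mult]
lemmas smooth_on_scaleR = smooth_on_bilinear[OF _ bounded_bilinear_scaleR]
lemmas smooth_on_inner = smooth_on_bilinear[OF _ bounded_bilinear_inner]

lemma smooth_on_diff: "open S \<Longrightarrow> smooth_on S f \<Longrightarrow> smooth_on S g \<Longrightarrow> smooth_on S (\<lambda>x. f x - g x)"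
  using smooth_on_add[of S f "\<lambda>x. - g x"]
    smooth_on_linear[OF _ bounded_linear_minus[OF bounded_linear_ident], of S g] by simp

lemma smooth_on_sum:
  assumes "open S" "\<And>i. i \<in> I \<Longrightarrow> smooth_on S (f i)"
  shows "smooth_on S (\<lambda>x. \<Sum>i\<in>I. f i x)"
  unfolding smooth_on_def
proof
  fix k show "Ck_on k (\<lambda>x. \<Sum>i\<in>I. f i x) S"
    by (rule Ck_on_sum[OF assms(1)]) (use assms(2) in \<open>simp add: smooth_on_def\<close>)
qed

lemma smooth_on_power:
  fixes f :: "'a::real_normed_vector \<Rightarrow> real"
  shows "open S \<Longrightarrow> smooth_on S f \<Longrightarrow> smooth_on S (\<lambda>x. f x ^ n)"
proof (induction n)
  case 0
  then show ?case by (simp add: smooth_on_const)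
next
  case (Suc n)
  then show ?case using smooth_on_mult[of S f "\<lambda>x. f x ^ n"] by simp
qed

lemma smooth_on_Pair:
  fixes f :: "'a::real_normed_vector \<Rightarrow> 'b::real_normed_vector" and g :: "'a \<Rightarrow> 'c::real_normed_vector"
  assumes "open S" "smooth_on S f" "smooth_on S g"
  shows "smooth_on S (\<lambda>x. (f x, g x))"
proof -
  have 1: "bounded_linear (\<lambda>x::'b. (x, 0::'c))"
    by (rule bounded_linear_Pair[OF bounded_linear_ident bounded_linear_zero])
  have 2: "bounded_linear (\<lambda>x::'c. (0::'b, x))"
    by (rule bounded_linear_Pair[OF bounded_linear_zero bounded_linear_ident])
  have "smooth_on S (\<lambda>x. (f x, 0) + (0, g x))"
    by (rule smooth_on_add[OF assms(1) smooth_on_linear[OF assms(1) 1 assms(2)] smooth_on_linear[OF assms(1) 2 assms(3)]])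
  then show ?thesis by simp
qed

lemma smooth_on_compose:
  fixes f :: "'b::euclidean_space \<Rightarrow> 'c::real_normed_vector" and g :: "'a::real_normed_vector \<Rightarrow> 'b"
  assumes "open S" "smooth_on T f" "smooth_on S g" "g ` S \<subseteq> T"
  shows "smooth_on S (\<lambda>x. f (g x))"
  unfolding smooth_on_def
proof
  fix k show "Ck_on k (\<lambda>x. f (g x)) S"
    by (rule Ck_on_compose[OF assms(1) _ _ assms(4)]) (use assms in \<open>simp_all add: smooth_on_def\<close>)
qed

lemma smooth_on_has_derivative:
  "smooth_on S f \<Longrightarrow> x \<in> S \<Longrightarrow> (f has_derivative frechet_derivative f (at x)) (at x)"
  unfolding smooth_on_def using Ck_on_Suc_derivative by blast

lemma smooth_on_continuous: "smooth_on S f \<Longrightarrow> continuous_on S f"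
  unfolding smooth_on_def using Ck_on.simps(1) by blast

lemma smooth_on_derivative: "smooth_on S f \<Longrightarrow> smooth_on S (\<lambda>x. frechet_derivative f (at x) v)"
  unfolding smooth_on_def using Ck_on.simps(2) by blast

text \<open>Stated for linear combinations, since these are closed under differentiation.\<close>

lemma smooth_on_sin_cos:
  fixes a b :: real shows "smooth_on UNIV (\<lambda>x. a * sin x + b * cos x)"
proof -
  have "Ck_on k (\<lambda>x. a * sin x + b * cos x) UNIV" for k
  proof (induction k arbitrary: a b)
    case 0
    show ?case by (auto intro!: continuous_intros)
  next
    case (Suc k)
    have d: "((\<lambda>x. a * sin x + b * cos x) has_derivative (\<lambda>v. (- (b * v)) * sin x + (a * v) * cos x)) (at x)" for x
      by (auto intro!: derivative_eq_intros simp: algebra_simps)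
    show ?case by (rule Ck_on_SucI[OF open_UNIV d Suc])
  qed
  then show ?thesis unfolding smooth_on_def by blast
qed

lemma smooth_on_sin: "open S \<Longrightarrow> smooth_on S f \<Longrightarrow> smooth_on S (\<lambda>x. sin (f x :: real))"
  using smooth_on_compose[OF _ smooth_on_sin_cos[of 1 0], of S f] by simp

lemma smooth_on_cos: "open S \<Longrightarrow> smooth_on S f \<Longrightarrow> smooth_on S (\<lambda>x. cos (f x :: real))"
  using smooth_on_compose[OF _ smooth_on_sin_cos[of 0 1], of S f] by simp

lemma smooth_on_exp:
  assumes "open S" "smooth_on S f" shows "smooth_on S (\<lambda>x. exp (f x :: real))"
proof -
  have "Ck_on k (\<lambda>x. a * exp x) UNIV" for k and a :: real
  proof (induction k arbitrary: a)
    case 0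
    show ?case by (auto intro!: continuous_intros)
  next
    case (Suc k)
    have d: "((\<lambda>x. a * exp x) has_derivative (\<lambda>v. (a * v) * exp x)) (at x)" for x
      by (auto intro!: derivative_eq_intros)
    show ?case by (rule Ck_on_SucI[OF open_UNIV d Suc])
  qed
  have "smooth_on UNIV (\<lambda>x::real. exp x)" unfolding smooth_on_def using \<open>\<And>k a. Ck_on k (\<lambda>x. a * exp x) UNIV\<close>[of _ 1] by simp
  from smooth_on_compose[OF assms(1) this assms(2)] show ?thesis by simp
qed

lemmas smooth_on_intros = smooth_on_const smooth_on_ident smooth_on_add smooth_on_diff smooth_on_mult
  smooth_on_scaleR smooth_on_inner smooth_on_power smooth_on_Pair smooth_on_sin smooth_on_cos smooth_on_exp
  smooth_on_sum

section \<open>Symmetry of second derivatives\<close>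

text \<open>The second difference of \<open>F\<close> over a small square, computed by two applications of the mean value
theorem. A second difference does not change when the two variables are exchanged, which is what
makes mixed derivatives agree.\<close>

lemma second_difference_MVT:
  fixes F :: "real \<Rightarrow> real \<Rightarrow> real"
  assumes d: "0 < d" "0 < h" "h < d"
    and F1: "\<And>a b. \<bar>a\<bar> < d \<Longrightarrow> \<bar>b\<bar> < d \<Longrightarrow> ((\<lambda>x. F x b) has_real_derivative F1 a b) (at a)"
    and F12: "\<And>a b. \<bar>a\<bar> < d \<Longrightarrow> \<bar>b\<bar> < d \<Longrightarrow> ((\<lambda>x. F1 a x) has_real_derivative F12 a b) (at b)"
  shows "\<exists>a b. 0 < a \<and> a < h \<and> 0 < b \<and> b < h \<and> F h h - F h 0 - F 0 h + F 0 0 = h * h * F12 a b"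
proof -
  have "\<exists>a>0. a < h \<and> (F h h - F h 0) - (F 0 h - F 0 0) = (h - 0) * (F1 a h - F1 a 0)"
    by (rule MVT2[of 0 h "\<lambda>x. F x h - F x 0" "\<lambda>x. F1 x h - F1 x 0"])
      (use d in \<open>auto intro!: derivative_intros F1\<close>)
  then obtain a where a: "0 < a" "a < h" "(F h h - F h 0) - (F 0 h - F 0 0) = h * (F1 a h - F1 a 0)" by auto
  have "\<exists>b>0. b < h \<and> F1 a h - F1 a 0 = (h - 0) * F12 a b"
    by (rule MVT2) (use d a in \<open>auto intro!: F12\<close>)
  then obtain b where "0 < b" "b < h" "F1 a h - F1 a 0 = h * F12 a b" by auto
  with a show ?thesis by (intro exI[of _ a] exI[of _ b]) (auto simp: algebra_simps)
qed

lemma second_difference_second_derivative: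
  fixes f :: "'a::real_normed_vector \<Rightarrow> real"
  assumes f: "smooth_on S f" and h: "0 < h" "h < d"
    and inS: "\<And>a b. \<bar>a\<bar> < d \<Longrightarrow> \<bar>b\<bar> < d \<Longrightarrow> p + a *\<^sub>R u + b *\<^sub>R v \<in> S"
  shows "\<exists>a b. 0 < a \<and> a < h \<and> 0 < b \<and> b < h \<and>
    f (p + h *\<^sub>R u + h *\<^sub>R v) - f (p + h *\<^sub>R u) - f (p + h *\<^sub>R v) + f p =
    h * h * frechet_derivative (\<lambda>x. frechet_derivative f (at x) u) (at (p + a *\<^sub>R u + b *\<^sub>R v)) v"
proof -
  let ?P = "\<lambda>a b. p + a *\<^sub>R u + b *\<^sub>R v" and ?D = "\<lambda>x. frechet_derivative f (at x) u"
  have "\<exists>a b. 0 < a \<and> a < h \<and> 0 < b \<and> b < h \<and>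
      f (?P h h) - f (?P h 0) - f (?P 0 h) + f (?P 0 0) = h * h * frechet_derivative ?D (at (?P a b)) v"
  proof (rule second_difference_MVT[OF _ h, of "\<lambda>a b. f (?P a b)" "\<lambda>a b. ?D (?P a b)"])
    fix a b assume ab: "\<bar>a\<bar> < d" "\<bar>b\<bar> < d"
    note df = smooth_on_has_derivative[OF f inS[OF ab]]
    note dD = smooth_on_has_derivative[OF smooth_on_derivative[OF f] inS[OF ab]]
    have "((\<lambda>x. ?P x b) has_derivative (\<lambda>x. x *\<^sub>R u)) (at a)"
      by (auto intro!: derivative_eq_intros)
    from has_derivative_compose[OF this df]
    show "((\<lambda>x. f (?P x b)) has_real_derivative ?D (?P a b)) (at a)"
      unfolding has_field_derivative_def by (simp add: linear_cmul[OF has_derivative_linear[OF df]] mult_commute_abs)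
    have "((\<lambda>x. ?P a x) has_derivative (\<lambda>x. x *\<^sub>R v)) (at b)"
      by (auto intro!: derivative_eq_intros)
    from has_derivative_compose[OF this dD]
    show "((\<lambda>x. ?D (?P a x)) has_real_derivative frechet_derivative ?D (at (?P a b)) v) (at b)"
      unfolding has_field_derivative_def by (simp add: linear_cmul[OF has_derivative_linear[OF dD]] mult_commute_abs)
  qed (use h in simp)
  then show ?thesis by simp
qed

text \<open>Both mixed derivatives, at some points of any small square, equal the normalised second
difference over this square; by continuity they agree at the centre.\<close>

lemma symmetric_second_derivative_real:
  fixes f :: "'a::real_normed_vector \<Rightarrow> real"
  assumes "open S" "p \<in> S" "smooth_on S f"
  shows "frechet_derivative (\<lambda>x. frechet_derivative f (at x) u) (at p) v =
         frechet_derivative (\<lambda>x. frechet_derivative f (at x) v) (at p) u"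
proof -
  define D where "D = (\<lambda>u x. frechet_derivative f (at x) u)"
  define DD where "DD = (\<lambda>u v x. frechet_derivative (D u) (at x) v)"
  have sD: "smooth_on S (D u)" for u unfolding D_def by (rule smooth_on_derivative[OF assms(3)])
  have cDD: "continuous_on S (DD u v)" for u v
    unfolding DD_def by (rule smooth_on_continuous[OF smooth_on_derivative[OF sD]])
  obtain e where e: "0 < e" "ball p e \<subseteq> S" using assms(1,2) open_contains_ball by blast
  \<comment> \<open>the parallelogram spanned by \<open>d u\<close> and \<open>d v\<close> lies in the ball\<close>
  define d where "d = e / (norm u + norm v + 1)"
  have pos: "norm u + norm v + 1 > 0" by (simp add: add_nonneg_pos)
  have d: "0 < d" unfolding d_def using e pos by auto
  have inS: "p + a *\<^sub>R u + b *\<^sub>R v \<in> S" if "\<bar>a\<bar> < d" "\<bar>b\<bar> < d" for a b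
  proof -
    have "norm (a *\<^sub>R u + b *\<^sub>R v) \<le> \<bar>a\<bar> * norm u + \<bar>b\<bar> * norm v"
      by (metis norm_triangle_ineq norm_scaleR)
    also have "\<dots> \<le> d * norm u + d * norm v" using that by (intro add_mono mult_right_mono) auto
    also have "\<dots> < d * (norm u + norm v + 1)" using d by (simp add: algebra_simps)
    also have "\<dots> = e" unfolding d_def using pos by simp
    finally show ?thesis using e(2) by (auto simp: dist_norm subset_iff norm_minus_commute algebra_simps)
  qed
  let ?P = "\<lambda>a b. p + a *\<^sub>R u + b *\<^sub>R v"
  have key: "\<exists>a b a' b'. 0 < a \<and> a < h \<and> 0 < b \<and> b < h \<and> 0 < a' \<and> a' < h \<and> 0 < b' \<and> b' < h \<and>
      DD u v (?P a b) = DD v u (?P a' b')" if h: "0 < h" "h < d" for h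
  proof -
    obtain a b where ab: "0 < a" "a < h" "0 < b" "b < h"
      "f (?P h h) - f (p + h *\<^sub>R u) - f (p + h *\<^sub>R v) + f p = h * h * DD u v (?P a b)"
      using second_difference_second_derivative[OF assms(3) h inS] unfolding DD_def D_def by blast
    have "p + b *\<^sub>R v + a *\<^sub>R u \<in> S" if "\<bar>b\<bar> < d" "\<bar>a\<bar> < d" for a b
      using inS[OF that(2,1)] by (simp add: add_ac)
    from second_difference_second_derivative[OF assms(3) h this]
    obtain a' b' where ab': "0 < a'" "a' < h" "0 < b'" "b' < h"
      "f (?P h h) - f (p + h *\<^sub>R v) - f (p + h *\<^sub>R u) + f p = h * h * DD v u (?P a' b')"
      unfolding DD_def D_def by (auto simp: add_ac)
    from ab ab' h have "DD u v (?P a b) = DD v u (?P a' b')" by (auto simp: algebra_simps)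
    with ab ab' show ?thesis by blast
  qed
  have "DD u v p = DD v u p"
  proof (rule ccontr)
    assume neq: "DD u v p \<noteq> DD v u p"
    define \<epsilon> where "\<epsilon> = \<bar>DD u v p - DD v u p\<bar> / 2"
    have eps: "0 < \<epsilon>" using neq by (simp add: \<epsilon>_def)
    have cont: "\<exists>\<delta>>0. \<forall>a b. \<bar>a\<bar> < \<delta> \<and> \<bar>b\<bar> < \<delta> \<longrightarrow> \<bar>DD u' v' (?P a b) - DD u' v' p\<bar> < \<epsilon>" for u' v'
    proof -
      have "continuous_on ({-d<..<d} \<times> {-d<..<d}) (\<lambda>z. DD u' v' (?P (fst z) (snd z)))"
        by (rule continuous_on_compose2[OF cDD]) (auto intro!: continuous_intros inS)
      then have "isCont (\<lambda>z. DD u' v' (?P (fst z) (snd z))) (0,0)"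
        using d by (subst (asm) continuous_on_eq_continuous_at) (auto intro: open_Times)
      from this[unfolded continuous_at_eps_delta, rule_format, OF eps]
      obtain s where s: "0 < s" and
        s': "\<forall>z. dist z (0,0) < s \<longrightarrow> dist (DD u' v' (?P (fst z) (snd z))) (DD u' v' (?P (fst (0::real,0::real)) (snd (0::real,0::real)))) < \<epsilon>"
        by (elim exE conjE)
      have s2: "\<bar>DD u' v' (?P a b) - DD u' v' p\<bar> < \<epsilon>" if "dist (a, b) (0,0) < s" for a b
        using s'[rule_format, OF that] by (simp add: dist_real_def)
      show ?thesis
      proof (intro exI[of _ "s/2"] conjI allI impI)
        fix a b assume "\<bar>a\<bar> < s / 2 \<and> \<bar>b\<bar> < s / 2"
        moreover have "norm (a, b) \<le> norm a + norm b" by (rule norm_Pair_le)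
        ultimately have "dist (a, b) (0, 0) < s" by (simp add: dist_norm)
        from s2[OF this] show "\<bar>DD u' v' (?P a b) - DD u' v' p\<bar> < \<epsilon>" by simp
      qed (use s in auto)
    qed
    obtain s1 where s1: "0 < s1" "\<And>a b. \<bar>a\<bar> < s1 \<and> \<bar>b\<bar> < s1 \<longrightarrow> \<bar>DD u v (?P a b) - DD u v p\<bar> < \<epsilon>"
      using cont by blast
    obtain s2 where s2: "0 < s2" "\<And>a b. \<bar>a\<bar> < s2 \<and> \<bar>b\<bar> < s2 \<longrightarrow> \<bar>DD v u (?P a b) - DD v u p\<bar> < \<epsilon>"
      using cont by blast
    define h where "h = min (d/2) (min s1 s2)"
    have h: "0 < h" "h < d" "h \<le> s1" "h \<le> s2" unfolding h_def using d s1(1) s2(1) by auto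
    obtain a b a' b' where ab: "0 < a" "a < h" "0 < b" "b < h" "0 < a'" "a' < h" "0 < b'" "b' < h"
      "DD u v (?P a b) = DD v u (?P a' b')" using key[OF h(1,2)] by blast
    have "\<bar>DD u v (?P a b) - DD u v p\<bar> < \<epsilon>" "\<bar>DD v u (?P a' b') - DD v u p\<bar> < \<epsilon>"
      using s1(2)[of a b] s2(2)[of a' b'] ab h by auto
    then have "\<bar>DD u v p - DD v u p\<bar> < 2 * \<epsilon>" using ab(9) by linarith
    then show False unfolding \<epsilon>_def by simp
  qed
  then show ?thesis unfolding DD_def D_def .
qed

lemma symmetric_second_derivative:
  fixes f :: "'a::real_normed_vector \<Rightarrow> 'b::euclidean_space"
  assumes "open S" "p \<in> S" "smooth_on S f"
  shows "frechet_derivative (\<lambda>x. frechet_derivative f (at x) u) (at p) v =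
         frechet_derivative (\<lambda>x. frechet_derivative f (at x) v) (at p) u"
proof (rule euclidean_eqI)
  fix b :: 'b
  have 1: "frechet_derivative (\<lambda>x. f x \<bullet> b) (at x) u = frechet_derivative f (at x) u \<bullet> b" if "x \<in> S" for x u
    using frechet_derivative_eqI[OF has_derivative_inner_left[OF smooth_on_has_derivative[OF assms(3) that], of b]] by simp
  have 2: "frechet_derivative (\<lambda>x. frechet_derivative (\<lambda>x. f x \<bullet> b) (at x) u) (at p) v =
     frechet_derivative (\<lambda>x. frechet_derivative f (at x) u) (at p) v \<bullet> b" for u v
  proof -
    have "((\<lambda>x. frechet_derivative f (at x) u \<bullet> b) has_derivative
       (\<lambda>v. frechet_derivative (\<lambda>x. frechet_derivative f (at x) u) (at p) v \<bullet> b)) (at p)"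
      by (intro has_derivative_inner_left smooth_on_has_derivative[OF smooth_on_derivative[OF assms(3)] assms(2)])
    then have "((\<lambda>x. frechet_derivative (\<lambda>x. f x \<bullet> b) (at x) u) has_derivative
       (\<lambda>v. frechet_derivative (\<lambda>x. frechet_derivative f (at x) u) (at p) v \<bullet> b)) (at p)"
      by (rule has_derivative_transform_within_open[OF _ assms(1,2)]) (simp add: 1)
    from frechet_derivative_eqI[OF this] show ?thesis by simp
  qed
  have "smooth_on S (\<lambda>x. f x \<bullet> b)"
    by (rule smooth_on_linear[OF assms(1) bounded_linear_inner_left assms(3)])
  from symmetric_second_derivative_real[OF assms(1,2) this, of u v]
  show "frechet_derivative (\<lambda>x. frechet_derivative f (at x) u) (at p) v \<bullet> b =
         frechet_derivative (\<lambda>x. frechet_derivative f (at x) v) (at p) u \<bullet> b"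
    unfolding 2 .
qed

section \<open>Lorentzian metrics and the Levi-Civita connection\<close>

text \<open>Events are pairs, but quantification over them should not be resolved into quantification over
components.\<close>

declare split_paired_All [simp del] split_paired_Ex [simp del]

lemma bilinear_expand_Basis:
  fixes B :: "'a::euclidean_space \<Rightarrow> 'b::euclidean_space \<Rightarrow> 'c::real_vector"
  assumes "bilinear B"
  shows "B v w = (\<Sum>b\<in>Basis. \<Sum>c\<in>Basis. ((v \<bullet> b) * (w \<bullet> c)) *\<^sub>R B b c)"
proof -
  have l: "linear (\<lambda>v. B v w)" "linear (B v)" for v w using assms by (auto simp: bilinear_def)
  have "B v w = (\<Sum>b\<in>Basis. (v \<bullet> b) *\<^sub>R B b w)" by (rule linear_expand_Basis[OF l(1)])
  also have "\<dots> = (\<Sum>b\<in>Basis. (v \<bullet> b) *\<^sub>R (\<Sum>c\<in>Basis. (w \<bullet> c) *\<^sub>R B b c))"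
    by (intro sum.cong refl) (simp add: linear_expand_Basis[OF l(2), symmetric])
  finally show ?thesis by (simp add: scaleR_sum_right)
qed

text \<open>Product rule for an expression \<open>B\<^sub>q(V, W)\<close> in which the bilinear form, its base point and both
arguments vary. The form is only known to be differentiable in \<open>q\<close> for constant arguments, so
everything is expanded in coordinates. The lemma serves metrics, pulled-back metrics and
Christoffel symbols.\<close>

lemma bilinear_family_derivative:
  fixes B :: "'q::real_normed_vector \<Rightarrow> 'a::euclidean_space \<Rightarrow> 'b::euclidean_space \<Rightarrow> 'c::real_normed_vector"
  assumes T: "open T" "\<phi> x \<in> T" "\<And>q. q \<in> T \<Longrightarrow> bilinear (B q)"
    and B': "\<And>v w. ((\<lambda>q. B q v w) has_derivative B' v w) (at (\<phi> x))"
    and \<phi>: "(\<phi> has_derivative \<phi>') (at x)"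
    and V: "(V has_derivative V') (at x)" and W: "(W has_derivative W') (at x)"
  shows "((\<lambda>x. B (\<phi> x) (V x) (W x)) has_derivative
    (\<lambda>u. B' (V x) (W x) (\<phi>' u) + B (\<phi> x) (V' u) (W x) + B (\<phi> x) (V x) (W' u))) (at x)"
proof -
  have ev: "\<forall>\<^sub>F y in at x. \<phi> y \<in> T"
    using has_derivative_continuous[OF \<phi>] T(1,2) by (simp add: isCont_def tendsto_def)
  have B'': "B' v w u = (\<Sum>b\<in>Basis. \<Sum>c\<in>Basis. ((v \<bullet> b) * (w \<bullet> c)) *\<^sub>R B' b c u)" for v w u
  proof -
    have "((\<lambda>q. \<Sum>b\<in>Basis. \<Sum>c\<in>Basis. ((v \<bullet> b) * (w \<bullet> c)) *\<^sub>R B q b c) has_derivative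
       (\<lambda>u. \<Sum>b\<in>Basis. \<Sum>c\<in>Basis. ((v \<bullet> b) * (w \<bullet> c)) *\<^sub>R B' b c u)) (at (\<phi> x))"
      by (intro has_derivative_sum has_derivative_scaleR_right B')
    then have "((\<lambda>q. B q v w) has_derivative
       (\<lambda>u. \<Sum>b\<in>Basis. \<Sum>c\<in>Basis. ((v \<bullet> b) * (w \<bullet> c)) *\<^sub>R B' b c u)) (at (\<phi> x))"
      by (rule has_derivative_transform_within_open[OF _ T(1,2)])
        (simp add: bilinear_expand_Basis[OF T(3), symmetric])
    from has_derivative_unique[OF B' this] show ?thesis by (rule fun_cong)
  qed
  have Bf: "((\<lambda>y. B (\<phi> y) b c) has_derivative (\<lambda>u. B' b c (\<phi>' u))) (at x)" for b c
    by (rule has_derivative_compose[OF \<phi> B'])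
  have "((\<lambda>x. \<Sum>b\<in>Basis. \<Sum>c\<in>Basis. ((V x \<bullet> b) * (W x \<bullet> c)) *\<^sub>R B (\<phi> x) b c) has_derivative
     (\<lambda>u. \<Sum>b\<in>Basis. \<Sum>c\<in>Basis. ((V x \<bullet> b) * (W x \<bullet> c)) *\<^sub>R B' b c (\<phi>' u) +
        ((V x \<bullet> b) * (W' u \<bullet> c) + (V' u \<bullet> b) * (W x \<bullet> c)) *\<^sub>R B (\<phi> x) b c)) (at x)"
    by (intro has_derivative_sum has_derivative_scaleR has_derivative_mult has_derivative_inner_left V W Bf)
  moreover have "(\<lambda>u. \<Sum>b\<in>Basis. \<Sum>c\<in>Basis. ((V x \<bullet> b) * (W x \<bullet> c)) *\<^sub>R B' b c (\<phi>' u) +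
        ((V x \<bullet> b) * (W' u \<bullet> c) + (V' u \<bullet> b) * (W x \<bullet> c)) *\<^sub>R B (\<phi> x) b c) =
     (\<lambda>u. B' (V x) (W x) (\<phi>' u) + B (\<phi> x) (V' u) (W x) + B (\<phi> x) (V x) (W' u))"
  proof
    fix u
    show "(\<Sum>b\<in>Basis. \<Sum>c\<in>Basis. ((V x \<bullet> b) * (W x \<bullet> c)) *\<^sub>R B' b c (\<phi>' u) +
        ((V x \<bullet> b) * (W' u \<bullet> c) + (V' u \<bullet> b) * (W x \<bullet> c)) *\<^sub>R B (\<phi> x) b c) =
      B' (V x) (W x) (\<phi>' u) + B (\<phi> x) (V' u) (W x) + B (\<phi> x) (V x) (W' u)"
      unfolding B''[of "V x" "W x" "\<phi>' u"] bilinear_expand_Basis[OF T(3)[OF T(2)], of "V' u" "W x"]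
        bilinear_expand_Basis[OF T(3)[OF T(2)], of "V x" "W' u"]
      by (simp add: sum.distrib scaleR_add_left algebra_simps)
  qed
  ultimately have "((\<lambda>x. \<Sum>b\<in>Basis. \<Sum>c\<in>Basis. ((V x \<bullet> b) * (W x \<bullet> c)) *\<^sub>R B (\<phi> x) b c) has_derivative
     (\<lambda>u. B' (V x) (W x) (\<phi>' u) + B (\<phi> x) (V' u) (W x) + B (\<phi> x) (V x) (W' u))) (at x)"
    by simp
  then show ?thesis
  proof (rule has_derivative_transform_eventually)
    show "\<forall>\<^sub>F y in at x. (\<Sum>b\<in>Basis. \<Sum>c\<in>Basis. ((V y \<bullet> b) * (W y \<bullet> c)) *\<^sub>R B (\<phi> y) b c) = B (\<phi> y) (V y) (W y)"
      using ev by eventually_elim (simp add: bilinear_expand_Basis[OF T(3), symmetric])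
  qed (simp_all add: bilinear_expand_Basis[OF T(3)[OF T(2)], symmetric])
qed

text \<open>The algebra behind uniqueness of the Levi-Civita connection: six alternating uses of the symmetry
and the antisymmetry lead from \<open>c x y z\<close> to its negative.\<close>

lemma braid_lemma:
  fixes c :: "'a \<Rightarrow> 'a \<Rightarrow> 'a \<Rightarrow> real"
  assumes s: "\<And>x y z. c x y z = c y x z" and a: "\<And>x y z. c x y z = - c x z y"
  shows "c x y z = 0"
  using s[of x y z] a[of y x z] s[of y z x] a[of z y x] s[of z x y] a[of x z y] by simp

locale lorentzian_manifold =
  fixes M :: "event set" and g :: tensor2
  assumes open_M: "open M" and lorentz: "lorentz_metric M g"
begin

lemma bilinear_g: "p \<in> M \<Longrightarrow> bilinear (g p)"
  using lorentz unfolding lorentz_metric_def by blast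

lemma sym_g: "p \<in> M \<Longrightarrow> g p v w = g p w v"
  using lorentz unfolding lorentz_metric_def by blast

lemma smooth_g: "smooth_on M (\<lambda>p. g p v w)"
  using lorentz unfolding lorentz_metric_def by blast

lemma linear_g: "p \<in> M \<Longrightarrow> linear (g p v)" "p \<in> M \<Longrightarrow> linear (\<lambda>v. g p v w)"
  using bilinear_g[of p] by (auto simp: bilinear_def)

lemmas g_simps = linear_add[OF linear_g(1)] linear_add[OF linear_g(2)]
  linear_diff[OF linear_g(1)] linear_diff[OF linear_g(2)]
  linear_cmul[OF linear_g(1)] linear_cmul[OF linear_g(2)]
  linear_0[OF linear_g(1)] linear_0[OF linear_g(2)]
  linear_neg[OF linear_g(1)] linear_neg[OF linear_g(2)]

text \<open>An orthonormal system of four vectors is linearly independent, hence a basis of the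
four-dimensional space; the signs \<open>s i\<close> are those of the signature.\<close>

lemma frame_expansion:
  assumes p: "p \<in> M"
  obtains e :: "nat \<Rightarrow> event" and s :: "nat \<Rightarrow> real"
  where "\<And>v. v = (\<Sum>i<4. (s i * g p v (e i)) *\<^sub>R e i)"
proof -
  obtain e :: "nat \<Rightarrow> event" where
    e: "\<forall>i<4. \<forall>j<4. g p (e i) (e j) = (if i \<noteq> j then 0 else if i = 0 then - 1 else 1)"
    using lorentz p unfolding lorentz_metric_def by blast
  define s where "s = (\<lambda>i::nat. if i = 0 then -1 else 1 :: real)"
  have inj: "inj_on e {..<4}"
  proof (rule inj_onI)
    fix i j assume ij: "i \<in> {..<4}" "j \<in> {..<4}" "e i = e j"
    then have "g p (e i) (e j) = g p (e i) (e i)" by simp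
    with ij e[rule_format, of i j] e[rule_format, of i i] show "i = j"
      by (cases "i = j") (auto split: if_splits)
  qed
  have coeff: "g p (\<Sum>i<4. c i *\<^sub>R e i) (e j) = s j * c j" if "j < 4" for c j
  proof -
    have "g p (\<Sum>i<4. c i *\<^sub>R e i) (e j) = (\<Sum>i<4. c i * g p (e i) (e j))"
      by (simp add: linear_sum[OF linear_g(2)[OF p]] g_simps[OF p])
    also have "\<dots> = (\<Sum>i<4. if i = j then s j * c j else 0)"
      by (intro sum.cong refl) (use e that in \<open>auto simp: s_def\<close>)
    finally show ?thesis using that by simp
  qed
  have "independent (e ` {..<4})"
  proof (rule independent_if_scalars_zero)
    fix f x assume f: "(\<Sum>x\<in>e ` {..<4}. f x *\<^sub>R x) = 0" and "x \<in> e ` {..<4}"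
    then obtain j where j: "j < 4" "x = e j" by auto
    have "(\<Sum>i<4. f (e i) *\<^sub>R e i) = 0" using f by (simp add: sum.reindex[OF inj])
    with coeff[OF j(1), of "\<lambda>i. f (e i)"] have "s j * f (e j) = 0" by (simp add: g_simps[OF p])
    then show "f x = 0" by (simp add: j s_def split: if_splits)
  qed simp
  moreover have "card (e ` {..<4}) = DIM(event)" by (simp add: card_image[OF inj])
  ultimately have "UNIV \<subseteq> span (e ` {..<4})"
    by (intro card_ge_dim_independent) auto
  have "v = (\<Sum>i<4. (s i * g p v (e i)) *\<^sub>R e i)" for v
  proof -
    have "v \<in> span (e ` {..<4})" using \<open>UNIV \<subseteq> _\<close> by blast
    then obtain f where "v = (\<Sum>x\<in>e ` {..<4}. f x *\<^sub>R x)" by (auto simp: span_finite)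
    then have v: "v = (\<Sum>i<4. f (e i) *\<^sub>R e i)" by (simp add: sum.reindex[OF inj])
    have "s j * g p v (e j) = f (e j)" if "j < 4" for j
      using coeff[OF that, of "\<lambda>i. f (e i)"] v by (simp add: s_def)
    then show ?thesis by (subst v) (auto intro: sum.cong)
  qed
  then show ?thesis by (rule that)
qed

lemma nondegenerate:
  assumes p: "p \<in> M" and "\<And>w. g p v w = 0"
  shows "v = 0"
proof -
  obtain e :: "nat \<Rightarrow> event" and s where "\<And>v. v = (\<Sum>i<4. (s i * g p v (e i)) *\<^sub>R e i)" using frame_expansion[OF p] by blast
  note this[of v]
  also have "(\<Sum>i<4. (s i * g p v (e i)) *\<^sub>R e i) = 0" by (simp add: assms(2))
  finally show ?thesis .
qed

lemma nondegenerate_eq: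
  assumes p: "p \<in> M" and "\<And>w. g p v w = g p v' w"
  shows "v = v'"
  using nondegenerate[OF p, of "v - v'"] assms by (simp add: g_simps[OF p])

text \<open>Raising an index: linear forms are represented by vectors, as the metric is nondegenerate.\<close>

lemma representing_vector:
  assumes p: "p \<in> M"
  obtains R where "\<And>\<phi> w. linear \<phi> \<Longrightarrow> g p (R \<phi>) w = \<phi> w"
proof -
  obtain e :: "nat \<Rightarrow> event" and s where e: "\<And>v. v = (\<Sum>i<4. (s i * g p v (e i)) *\<^sub>R e i)" using frame_expansion[OF p] by blast
  show ?thesis
  proof (rule that[of "\<lambda>\<phi>. \<Sum>i<4. (s i * \<phi> (e i)) *\<^sub>R e i"])
    fix \<phi> :: "event \<Rightarrow> real" and w assume \<phi>: "linear \<phi>"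
    have "g p (\<Sum>i<4. (s i * \<phi> (e i)) *\<^sub>R e i) w = (\<Sum>i<4. s i * \<phi> (e i) * g p w (e i))"
      by (simp add: linear_sum[OF linear_g(2)[OF p]] g_simps[OF p] sym_g[OF p, of w] mult_ac)
    also have "\<dots> = \<phi> (\<Sum>i<4. (s i * g p w (e i)) *\<^sub>R e i)"
      by (simp add: linear_sum[OF \<phi>] linear_cmul[OF \<phi>] mult_ac)
    also have "\<dots> = \<phi> w" using e[of w] by (rule arg_cong[OF sym])
    finally show "g p (\<Sum>i<4. (s i * \<phi> (e i)) *\<^sub>R e i) w = \<phi> w" .
  qed
qed

abbreviation "dg p x y z \<equiv> frechet_derivative (\<lambda>q. g q y z) (at p) x"

lemma dg: "p \<in> M \<Longrightarrow> ((\<lambda>q. g q y z) has_derivative (\<lambda>x. dg p x y z)) (at p)"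
  using smooth_on_has_derivative[OF smooth_g] by simp

lemma dg_linear:
  assumes p: "p \<in> M"
  shows "linear (\<lambda>x. dg p x y z)" "linear (\<lambda>y. dg p x y z)" "linear (\<lambda>z. dg p x y z)"
    and dg_sym: "dg p x y z = dg p x z y"
proof -
  show "linear (\<lambda>x. dg p x y z)" by (rule has_derivative_linear[OF dg[OF p]])
  have cong: "frechet_derivative f (at p) = frechet_derivative f' (at p)"
    if "(f' has_derivative D) (at p)" "\<And>q. q \<in> M \<Longrightarrow> f q = f' q" for f f' :: "event \<Rightarrow> real" and D
    using frechet_derivative_eqI[OF that(1)]
      frechet_derivative_eqI[OF has_derivative_transform_within_open[OF that(1) open_M p that(2)[symmetric]]] by simp
  have sum: "dg p x (a *\<^sub>R y + b *\<^sub>R y') z = a * dg p x y z + b * dg p x y' z" for a b y y' z x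
  proof -
    have 1: "((\<lambda>q. a * g q y z + b * g q y' z) has_derivative (\<lambda>x. a * dg p x y z + b * dg p x y' z)) (at p)"
      by (intro has_derivative_add has_derivative_mult_right dg p)
    show ?thesis using cong[OF 1, of "\<lambda>q. g q (a *\<^sub>R y + b *\<^sub>R y') z"] frechet_derivative_eqI[OF 1]
      by (simp add: g_simps)
  qed
  show sym: "dg p x y z = dg p x z y" for x y z
    by (rule fun_cong[OF cong[OF dg[OF p]]]) (rule sym_g)
  show 1: "linear (\<lambda>y. dg p x y z)" for z
  proof (rule linearI)
    fix a b c
    show "dg p x (a + b) z = dg p x a z + dg p x b z" using sum[where a = 1 and y = a and b = 1 and y' = b and x = x and z = z] by simp
    show "dg p x (c *\<^sub>R a) z = c *\<^sub>R dg p x a z" using sum[where a = c and y = a and b = 0 and y' = 0 and x = x and z = z] by simp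
  qed
  have "(\<lambda>z. dg p x y z) = (\<lambda>z. dg p x z y)" by (rule ext) (rule sym)
  then show "linear (\<lambda>z. dg p x y z)" using 1[of y] by simp
qed

definition levi_civita_at where
  "levi_civita_at p \<Gamma> \<longleftrightarrow> bilinear \<Gamma> \<and> (\<forall>x y. \<Gamma> x y = \<Gamma> y x) \<and>
     (\<forall>x y z. dg p x y z = g p (\<Gamma> x y) z + g p y (\<Gamma> x z))"

text \<open>The Koszul formula, with the index raised by \<open>representing_vector\<close>.\<close>

lemma levi_civita_exists:
  assumes p: "p \<in> M"
  shows "\<exists>\<Gamma>. levi_civita_at p \<Gamma>"
proof -
  obtain R where R: "\<And>\<phi> w. linear \<phi> \<Longrightarrow> g p (R \<phi>) w = \<phi> w" using representing_vector[OF p] by blast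
  define K where "K = (\<lambda>x y z. (dg p x y z + dg p y x z - dg p z x y) / 2)"
  define \<Gamma> where "\<Gamma> = (\<lambda>x y. R (K x y))"
  note l = dg_linear(1-3)[OF p]
  note lin = l[THEN linear_add] l[THEN linear_cmul]
  have "linear (K x y)" for x y
    unfolding K_def by (rule linearI) (simp_all add: lin field_simps)
  then have \<Gamma>: "g p (\<Gamma> x y) z = K x y z" for x y z unfolding \<Gamma>_def by (rule R)
  have "bilinear \<Gamma>"
    unfolding bilinear_def
    by (intro conjI allI linearI; rule nondegenerate_eq[OF p])
      (simp_all add: g_simps[OF p] \<Gamma> K_def lin field_simps)
  moreover have "\<Gamma> x y = \<Gamma> y x" for x y
    by (rule nondegenerate_eq[OF p]) (simp add: \<Gamma> K_def dg_sym[OF p, where y = x and z = y])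
  moreover have "dg p x y z = g p (\<Gamma> x y) z + g p y (\<Gamma> x z)" for x y z
    unfolding sym_g[OF p, of y] \<Gamma> K_def
    using dg_sym[OF p, where x = x and y = y and z = z] dg_sym[OF p, where x = y and y = x and z = z]
      dg_sym[OF p, where x = z and y = x and z = y] by (simp add: field_simps)
  ultimately show ?thesis unfolding levi_civita_at_def by blast
qed

lemma levi_civita_unique:
  assumes p: "p \<in> M" and "levi_civita_at p \<Gamma>" "levi_civita_at p \<Gamma>'"
  shows "\<Gamma> = \<Gamma>'"
proof (intro ext nondegenerate_eq[OF p])
  fix x y z
  have s: "\<Gamma> x y = \<Gamma> y x" "\<Gamma>' x y = \<Gamma>' y x" for x y using assms(2,3) unfolding levi_civita_at_def by blast+
  have c: "g p (\<Gamma> x y) z + g p y (\<Gamma> x z) = g p (\<Gamma>' x y) z + g p y (\<Gamma>' x z)" for x y z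
    using assms(2,3) unfolding levi_civita_at_def by metis
  have "g p (\<Gamma> x y) z - g p (\<Gamma>' x y) z = 0"
  proof (rule braid_lemma[of "\<lambda>x y z. g p (\<Gamma> x y) z - g p (\<Gamma>' x y) z"])
    fix x y z
    show "g p (\<Gamma> x y) z - g p (\<Gamma>' x y) z = g p (\<Gamma> y x) z - g p (\<Gamma>' y x) z" using s by metis
    show "g p (\<Gamma> x y) z - g p (\<Gamma>' x y) z = - (g p (\<Gamma> x z) y - g p (\<Gamma>' x z) y)"
      using c[of x y z] sym_g[OF p, of y] by simp
  qed
  then show "g p (\<Gamma> x y) z = g p (\<Gamma>' x y) z" by simp
qed

lemma christoffel_eqI: "p \<in> M \<Longrightarrow> levi_civita_at p \<Gamma> \<Longrightarrow> christoffel g p = \<Gamma>"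
  unfolding christoffel_def levi_civita_at_def[symmetric]
  by (rule the_equality) (auto intro: levi_civita_unique)

lemma christoffel_levi_civita: "p \<in> M \<Longrightarrow> levi_civita_at p (christoffel g p)"
  using levi_civita_exists christoffel_eqI by metis

lemma
  assumes "p \<in> M"
  shows christoffel_bilinear: "bilinear (christoffel g p)"
    and christoffel_sym: "christoffel g p x y = christoffel g p y x"
    and christoffel_metric: "dg p x y z = g p (christoffel g p x y) z + g p y (christoffel g p x z)"
  using christoffel_levi_civita[OF assms] unfolding levi_civita_at_def by blast+

end

abbreviation D2 :: "('a::real_normed_vector \<Rightarrow> 'b::real_normed_vector) \<Rightarrow> 'a \<Rightarrow> 'a \<Rightarrow> 'a \<Rightarrow> 'b" where
  "D2 f x u v \<equiv> frechet_derivative (\<lambda>y. frechet_derivative f (at y) v) (at x) u"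

lemma D2_bilinear:
  fixes f :: "'a::real_normed_vector \<Rightarrow> 'b::euclidean_space"
  assumes "open S" "x \<in> S" "smooth_on S f"
  shows "bilinear (D2 f x)"
proof -
  have "linear (\<lambda>u. D2 f x u v)" for v
    by (rule has_derivative_linear[OF smooth_on_has_derivative[OF smooth_on_derivative[OF assms(3)] assms(2)]])
  moreover have "D2 f x u = (\<lambda>v. D2 f x v u)" for u
    by (rule ext) (rule symmetric_second_derivative[OF assms])
  ultimately show ?thesis unfolding bilinear_def by simp
qed

context lorentzian_manifold begin

text \<open>The second covariant derivative of the map \<open>\<phi>\<close>, where its domain carries the flat connection; this
is how the Christoffel symbols transform under \<open>\<phi>\<close>.\<close>

definition hess where
  "hess \<phi> x u v = D2 \<phi> x u v +
     christoffel g (\<phi> x) (frechet_derivative \<phi> (at x) u) (frechet_derivative \<phi> (at x) v)"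

lemma hess_sym:
  assumes "open N" "smooth_on N \<phi>" "x \<in> N" "\<phi> x \<in> M"
  shows "hess \<phi> x u v = hess \<phi> x v u"
  unfolding hess_def symmetric_second_derivative[OF assms(1,3,2), of v u]
  using christoffel_sym[OF assms(4)] by metis

lemma pullback_derivative:
  assumes "open N" "smooth_on N \<phi>" "x \<in> N" "\<phi> x \<in> M"
  shows "((\<lambda>x. g (\<phi> x) (frechet_derivative \<phi> (at x) v) (frechet_derivative \<phi> (at x) w)) has_derivative
    (\<lambda>u. g (\<phi> x) (hess \<phi> x u v) (frechet_derivative \<phi> (at x) w) +
         g (\<phi> x) (frechet_derivative \<phi> (at x) v) (hess \<phi> x u w))) (at x)"
proof -
  note d = smooth_on_has_derivative[OF assms(2,3)]
  note d2 = smooth_on_has_derivative[OF smooth_on_derivative[OF assms(2)] assms(3)]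
  show ?thesis
    by (rule has_derivative_eq_rhs[OF bilinear_family_derivative[where T = M, OF open_M assms(4) bilinear_g dg[OF assms(4)] d d2 d2]])
      (auto simp: hess_def christoffel_metric[OF assms(4)] g_simps[OF assms(4)])
qed

text \<open>Pulling back turns metric compatibility into a Koszul formula for \<open>hess\<close>, which makes it
computable from the pulled-back metric alone.\<close>

lemma koszul_pullback:
  assumes "open N" "smooth_on N \<phi>" "x \<in> N" "\<phi> x \<in> M"
  defines "dh \<equiv> (\<lambda>u v w. frechet_derivative (\<lambda>x. g (\<phi> x) (frechet_derivative \<phi> (at x) v) (frechet_derivative \<phi> (at x) w)) (at x) u)"
  shows "2 * g (\<phi> x) (hess \<phi> x u v) (frechet_derivative \<phi> (at x) w) = dh u v w + dh v u w - dh w u v"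
  unfolding dh_def frechet_derivative_eqI[OF pullback_derivative[OF assms(1-4)]]
  using hess_sym[OF assms(1-4), of u v] hess_sym[OF assms(1-4), of u w] hess_sym[OF assms(1-4), of v w]
    sym_g[OF assms(4)] by simp

end

section \<open>Isometries preserve curvature\<close>

lemma linear_family_derivative:
  fixes L :: "'q::real_normed_vector \<Rightarrow> 'a::euclidean_space \<Rightarrow> 'c::real_normed_vector"
  assumes T: "open T" "\<phi> x \<in> T" "\<And>q. q \<in> T \<Longrightarrow> linear (L q)"
    and L': "\<And>v. ((\<lambda>q. L q v) has_derivative L' v) (at (\<phi> x))"
    and \<phi>: "(\<phi> has_derivative \<phi>') (at x)" and V: "(V has_derivative V') (at x)"
  shows "((\<lambda>x. L (\<phi> x) (V x)) has_derivative (\<lambda>u. L' (V x) (\<phi>' u) + L (\<phi> x) (V' u))) (at x)"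
proof -
  have "bilinear (\<lambda>v (c::real). c *\<^sub>R L q v)" if "q \<in> T" for q
    unfolding bilinear_def
    by (auto intro!: linearI simp: linear_add[OF T(3)[OF that]] linear_cmul[OF T(3)[OF that]] scaleR_add_right scaleR_add_left)
  from bilinear_family_derivative[where B = "\<lambda>q v (c::real). c *\<^sub>R L q v", OF T(1,2) this has_derivative_scaleR_right[OF L'] \<phi> V
      has_derivative_const[of 1 "at x"]]
  show ?thesis by simp
qed

lemma has_derivative_unique_on_open:
  assumes "(f has_derivative f') (at x)" "(g has_derivative g') (at x)" "open S" "x \<in> S"
    "\<And>y. y \<in> S \<Longrightarrow> f y = g y"
  shows "f' = g'"
  by (rule has_derivative_unique[OF has_derivative_transform_within_open[OF assms(1,3,4,5)] assms(2)])

context lorentzian_manifold begin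

definition isometric_embedding :: "(event \<Rightarrow> event) \<Rightarrow> bool" where
  "isometric_embedding h \<longleftrightarrow> smooth_on M h \<and> h ` M \<subseteq> M \<and>
     (\<forall>p\<in>M. \<forall>v w. g (h p) (frechet_derivative h (at p) v) (frechet_derivative h (at p) w) = g p v w)"

lemma isometric_embedding_derivative:
  assumes "isometric_embedding h" "p \<in> M"
  shows "linear (frechet_derivative h (at p))" "surj (frechet_derivative h (at p))"
proof -
  have s: "smooth_on M h" and hp: "h p \<in> M"
    and iso: "g (h p) (frechet_derivative h (at p) v) (frechet_derivative h (at p) w) = g p v w" for v w
    using assms unfolding isometric_embedding_def by blast+
  show lin: "linear (frechet_derivative h (at p))"
    by (rule has_derivative_linear[OF smooth_on_has_derivative[OF s assms(2)]])
  have "inj (frechet_derivative h (at p))"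
  proof (subst linear_injective_0[OF lin], intro allI impI)
    fix v assume "frechet_derivative h (at p) v = 0"
    with iso[of v] show "v = 0"
      by (intro nondegenerate[OF assms(2)]) (simp add: g_simps[OF hp])
  qed
  then show "surj (frechet_derivative h (at p))"
    using linear_injective_imp_surjective[OF lin] by blast
qed

text \<open>Differentiating the isometry condition shows that the difference of both sides, with its index
lowered, is symmetric in the first two arguments and antisymmetric in the last two, so it vanishes by
\<open>braid_lemma\<close>.\<close>

lemma isometry_christoffel:
  assumes "isometric_embedding h" "p \<in> M"
  shows "hess h p u v = frechet_derivative h (at p) (christoffel g p u v)"
proof -
  have s: "smooth_on M h" and hp: "h p \<in> M"
    and iso: "\<And>p v w. p \<in> M \<Longrightarrow> g (h p) (frechet_derivative h (at p) v) (frechet_derivative h (at p) w) = g p v w"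
    using assms unfolding isometric_embedding_def by blast+
  let ?D = "frechet_derivative h (at p)" and ?\<Gamma> = "christoffel g p"
  define c where "c = (\<lambda>u v w. g (h p) (hess h p u v - ?D (?\<Gamma> u v)) (?D w))"
  have "g (h p) (hess h p u v) (?D w) + g (h p) (?D v) (hess h p u w) = dg p u v w" for u v w
    by (rule fun_cong[OF has_derivative_unique_on_open[OF pullback_derivative[OF open_M s assms(2) hp] dg[OF assms(2)] open_M assms(2) iso]])
  note this[symmetric]
  then have der: "g p (?\<Gamma> u v) w + g p v (?\<Gamma> u w) = g (h p) (hess h p u v) (?D w) + g (h p) (?D v) (hess h p u w)" for u v w
    by (simp add: christoffel_metric[OF assms(2)])
  have c: "c u v w = 0" for u v w
  proof (rule braid_lemma[of c])
    fix u v w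
    show "c u v w = c v u w"
      unfolding c_def hess_sym[where u = u and v = v, OF open_M s assms(2) hp]
        christoffel_sym[where x = u and y = v, OF assms(2)] ..
    show "c u v w = - c u w v"
      using der[of u v w] sym_g[OF hp, of "?D v"] sym_g[OF assms(2), of v]
      by (simp add: c_def g_simps[OF hp] iso[OF assms(2)])
  qed
  have "hess h p u v - ?D (?\<Gamma> u v) = 0"
  proof (rule nondegenerate[OF hp])
    fix w
    obtain w' where "w = ?D w'" using isometric_embedding_derivative(2)[OF assms] by (meson surjD)
    with c[of u v w'] show "g (h p) (hess h p u v - ?D (?\<Gamma> u v)) w = 0" by (simp add: c_def)
  qed
  then show ?thesis by simp
qed

text \<open>The curvature operator \<open>R(u,w)v\<close> on constant vector fields.\<close>

definition riemann :: "event \<Rightarrow> event \<Rightarrow> event \<Rightarrow> event \<Rightarrow> event" where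
  "riemann p u w v =
     (frechet_derivative (\<lambda>q. christoffel g q w v) (at p) u + christoffel g p u (christoffel g p w v)) -
     (frechet_derivative (\<lambda>q. christoffel g q u v) (at p) w + christoffel g p w (christoffel g p u v))"

text \<open>Differentiate \<open>isometry_christoffel\<close> once more and antisymmetrise in \<open>u\<close> and \<open>w\<close>. The third derivative
of \<open>h\<close> is symmetric and drops out, and so do the mixed products of both connections once the
second derivatives of \<open>h\<close> are eliminated by \<open>isometry_christoffel\<close> itself.\<close>

lemma isometry_riemann:
  assumes h: "isometric_embedding h" and p: "p \<in> M"
    and diff: "\<And>p v w. p \<in> M \<Longrightarrow> (\<lambda>q. christoffel g q v w) differentiable (at p)"
  shows "riemann (h p) (frechet_derivative h (at p) u) (frechet_derivative h (at p) w) (frechet_derivative h (at p) v) =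
    frechet_derivative h (at p) (riemann p u w v)"
proof -
  have s: "smooth_on M h" and hp: "h p \<in> M"
    using h p unfolding isometric_embedding_def by blast+
  let ?D = "frechet_derivative h (at p)" and ?\<Gamma> = "christoffel g p" and ?\<Gamma>' = "christoffel g (h p)"
  define d\<Gamma> where "d\<Gamma> = (\<lambda>p v w u. frechet_derivative (\<lambda>q. christoffel g q v w) (at p) u)"
  have d\<Gamma>: "((\<lambda>q. christoffel g q v w) has_derivative d\<Gamma> q v w) (at q)" if "q \<in> M" for q v w
    using diff[OF that, of v w] unfolding d\<Gamma>_def by (simp add: frechet_derivative_works[symmetric])
  define D3 where "D3 = (\<lambda>u w v. frechet_derivative (\<lambda>q. D2 h q w v) (at p) u)"
  note d = smooth_on_has_derivative[OF s p]
  note d2 = smooth_on_has_derivative[OF smooth_on_derivative[OF s] p]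
  note d3 = smooth_on_has_derivative[OF smooth_on_derivative[OF smooth_on_derivative[OF s]] p]
  note lin = isometric_embedding_derivative(1)[OF h]
  note l\<Gamma> = christoffel_bilinear[OF hp]
  note simps = bilinear_ladd[OF l\<Gamma>] bilinear_radd[OF l\<Gamma>] bilinear_lsub[OF l\<Gamma>] bilinear_rsub[OF l\<Gamma>]
    linear_add[OF lin[OF p]] linear_diff[OF lin[OF p]]
  have D2: "D2 h p a b = ?D (?\<Gamma> a b) - ?\<Gamma>' (?D a) (?D b)" for a b
    using isometry_christoffel[OF h p, of a b] unfolding hess_def by (simp add: algebra_simps)
  have main: "D3 u w v + (d\<Gamma> (h p) (?D w) (?D v) (?D u) + ?\<Gamma>' (D2 h p u w) (?D v) + ?\<Gamma>' (?D w) (D2 h p u v))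
      = D2 h p u (?\<Gamma> w v) + ?D (d\<Gamma> p w v u)" for u w v
  proof -
    have L: "((\<lambda>q. hess h q w v) has_derivative (\<lambda>u. D3 u w v +
       (d\<Gamma> (h p) (?D w) (?D v) (?D u) + ?\<Gamma>' (D2 h p u w) (?D v) + ?\<Gamma>' (?D w) (D2 h p u v)))) (at p)"
      unfolding hess_def D3_def
      by (intro has_derivative_add d3 bilinear_family_derivative[where T = M, OF open_M hp christoffel_bilinear d\<Gamma>[OF hp] d d2 d2])
    have R: "((\<lambda>q. frechet_derivative h (at q) (christoffel g q w v)) has_derivative
      (\<lambda>u. D2 h p u (?\<Gamma> w v) + ?D (d\<Gamma> p w v u))) (at p)"
      by (rule linear_family_derivative[where T = M and \<phi> = "\<lambda>x. x", OF open_M p lin d2 has_derivative_ident d\<Gamma>[OF p]])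
    from has_derivative_unique_on_open[OF L R open_M p isometry_christoffel[OF h]] show ?thesis by (rule fun_cong)
  qed
  have D3: "D3 u w v = D3 w u v"
    unfolding D3_def by (rule symmetric_second_derivative[OF open_M p smooth_on_derivative[OF s]])
  have Gsym: "?\<Gamma> u w = ?\<Gamma> w u" "?\<Gamma>' a b = ?\<Gamma>' b a" for a b
    by (rule christoffel_sym[OF p], rule christoffel_sym[OF hp])
  \<comment> \<open>the antisymmetrisation as an identity of vectors, proved on components, where linear arithmetic applies\<close>
  have cancel: "(a1 + e2) - (a2 + e1) - ((k1 + f1) - (k2 + f2)) = 0"
    if "D + (a1 + (b - c) + (d1 - e1)) = (f1 - d2) + k1" "D + (a2 + (b - c) + (d2 - e2)) = (f2 - d1) + k2"
    for D a1 a2 b c d1 d2 e1 e2 f1 f2 k1 k2 :: event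
  proof (rule euclidean_eqI)
    fix z :: event
    show "((a1 + e2) - (a2 + e1) - ((k1 + f1) - (k2 + f2))) \<bullet> z = 0 \<bullet> z"
      using arg_cong[OF that(1), of "\<lambda>x. x \<bullet> z"] arg_cong[OF that(2), of "\<lambda>x. x \<bullet> z"]
      by (simp add: inner_add_left inner_diff_left)
  qed
  have "riemann (h p) (?D u) (?D w) (?D v) - ?D (riemann p u w v) =
    (d\<Gamma> (h p) (?D w) (?D v) (?D u) + ?\<Gamma>' (?D u) (?\<Gamma>' (?D w) (?D v))) -
    (d\<Gamma> (h p) (?D u) (?D v) (?D w) + ?\<Gamma>' (?D w) (?\<Gamma>' (?D u) (?D v))) -
    ((?D (d\<Gamma> p w v u) + ?D (?\<Gamma> u (?\<Gamma> w v))) - (?D (d\<Gamma> p u v w) + ?D (?\<Gamma> w (?\<Gamma> u v))))"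
    unfolding riemann_def d\<Gamma>_def by (simp add: simps)
  also have "\<dots> = 0"
    by (rule cancel[OF main[of u w v, unfolded D2 simps] main[of w u v, unfolded D2 simps D3[symmetric] Gsym(1)[symmetric] Gsym(2)[of "?D w" "?D u"]]])
  finally show ?thesis by simp
qed

end

section \<open>Orthonormal bases of planes\<close>

text \<open>Gram-Schmidt for two vectors. The form is only positive definite on the plane \<open>P\<close>, as for a
spacelike plane in a Lorentzian space.\<close>

lemma plane_orthonormal_basis:
  fixes G :: "'a::real_vector \<Rightarrow> 'a \<Rightarrow> real"
  assumes G: "bilinear G" "\<And>v w. G v w = G w v"
    and pos: "\<And>v. v \<in> P \<Longrightarrow> v \<noteq> 0 \<Longrightarrow> 0 < G v v"
    and P: "P = {\<alpha> *\<^sub>R a + \<beta> *\<^sub>R b | \<alpha> \<beta>. True}" and ind: "\<And>\<alpha> \<beta>. \<alpha> *\<^sub>R a + \<beta> *\<^sub>R b = 0 \<Longrightarrow> \<alpha> = 0 \<and> \<beta> = 0"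
  obtains x y where "x \<in> P" "y \<in> P" "G x x = 1" "G y y = 1" "G x y = 0"
    "\<And>v. v \<in> P \<Longrightarrow> v = G v x *\<^sub>R x + G v y *\<^sub>R y"
proof -
  note G_simps = bilinear_ladd[OF G(1)] bilinear_radd[OF G(1)] bilinear_lmul[OF G(1)] bilinear_rmul[OF G(1)]
    bilinear_lsub[OF G(1)] bilinear_rsub[OF G(1)]
  have inP: "\<alpha> *\<^sub>R a + \<beta> *\<^sub>R b \<in> P" for \<alpha> \<beta> unfolding P by blast
  have "a \<noteq> 0" using ind[of 1 0] by auto
  then have Ga: "0 < G a a" using pos[of a] inP[of 1 0] by simp
  define k where "k = sqrt (G a a)"
  have k: "k > 0" "G a a = k * k" using Ga by (simp_all add: k_def)
  define x where "x = (1 / k) *\<^sub>R a"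
  have x: "x \<in> P" "G x x = 1" using inP[of "1 / k" 0] k by (simp_all add: x_def G_simps)
  define b' where "b' = b - G b x *\<^sub>R x"
  have b'_eq: "b' = (- (G b x / k)) *\<^sub>R a + 1 *\<^sub>R b" by (simp add: b'_def x_def)
  have "b' \<noteq> 0" using ind[of "- (G b x / k)" 1] b'_eq by auto
  moreover have "b' \<in> P" using inP b'_eq by metis
  ultimately have Gb: "0 < G b' b'" by (intro pos)
  define l where "l = sqrt (G b' b')"
  have l: "l > 0" "G b' b' = l * l" using Gb by (simp_all add: l_def)
  define y where "y = (1 / l) *\<^sub>R b'"
  have "y = (- (G b x / k) / l) *\<^sub>R a + (1 / l) *\<^sub>R b"
    by (simp add: y_def b'_eq scaleR_diff_right)
  then have "y \<in> P" using inP by metis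
  moreover have "G y y = 1" using l by (simp add: y_def bilinear_lmul[OF G(1)] bilinear_rmul[OF G(1)])
  ultimately have y: "y \<in> P" "G y y = 1" by blast+
  have "G x b' = 0" using x by (simp add: b'_def G_simps G(2)[of x b])
  then have xy: "G x y = 0" by (simp add: y_def G_simps)
  have "v = G v x *\<^sub>R x + G v y *\<^sub>R y" if vP: "v \<in> P" for v
  proof -
    obtain \<alpha> \<beta> where v: "v = \<alpha> *\<^sub>R a + \<beta> *\<^sub>R b" using vP P by blast
    have a: "a = k *\<^sub>R x" using k by (simp add: x_def)
    have b: "b = l *\<^sub>R y + G b x *\<^sub>R x" using l by (simp add: y_def b'_def)
    have "v = (\<alpha> * k + \<beta> * G b x) *\<^sub>R x + (\<beta> * l) *\<^sub>R y"
      unfolding v by (subst b, subst a) (simp add: algebra_simps)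
    then obtain c d where v: "v = c *\<^sub>R x + d *\<^sub>R y" by blast
    show ?thesis using x y xy by (simp add: v G_simps G(2)[of y x])
  qed
  with x y xy show ?thesis by (intro that) auto
qed

text \<open>The hypotheses say that the matrix with rows \<open>(a, b)\<close> and \<open>(c, d)\<close> is orthogonal; the proof passes
to the orthogonality of its columns.\<close>

lemma trace_frame_invariant:
  fixes B :: "'a::real_vector \<Rightarrow> 'a \<Rightarrow> 'b::real_vector"
  assumes B: "bilinear B" "B x y = B y x"
    and "a\<^sup>2 + b\<^sup>2 = 1" "c\<^sup>2 + d\<^sup>2 = 1" "a * c + b * d = 0"
  shows "B (a *\<^sub>R x + b *\<^sub>R y) (a *\<^sub>R x + b *\<^sub>R y) + B (c *\<^sub>R x + d *\<^sub>R y) (c *\<^sub>R x + d *\<^sub>R y) = B x x + B y y"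
proof -
  have det: "(a * d - b * c)\<^sup>2 = 1"
  proof -
    have "(a * d - b * c)\<^sup>2 = (a\<^sup>2 + b\<^sup>2) * (c\<^sup>2 + d\<^sup>2) - (a * c + b * d)\<^sup>2"
      by (simp add: power2_eq_square algebra_simps)
    then show ?thesis using assms(3-5) by simp
  qed
  have c: "c = - b * (a * d - b * c)" "d = a * (a * d - b * c)"
    using assms(3-5) by (simp_all add: power2_eq_square) algebra+
  have 1: "a * a + c * c = 1" "b * b + d * d = 1" "a * b + c * d = 0"
    using c det assms(3) by (simp_all add: power2_eq_square) algebra+
  note B_simps = bilinear_ladd[OF B(1)] bilinear_radd[OF B(1)] bilinear_lmul[OF B(1)] bilinear_rmul[OF B(1)]
  have "B (a *\<^sub>R x + b *\<^sub>R y) (a *\<^sub>R x + b *\<^sub>R y) + B (c *\<^sub>R x + d *\<^sub>R y) (c *\<^sub>R x + d *\<^sub>R y) =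
     (a * a + c * c) *\<^sub>R B x x + (b * b + d * d) *\<^sub>R B y y + ((a * b + c * d) *\<^sub>R B x y + (a * b + c * d) *\<^sub>R B x y)"
    by (simp add: B_simps B(2) algebra_simps)
  then show ?thesis by (simp add: 1)
qed

lemma orthogonal_plane_basis:
  fixes y :: "real^3"
  assumes "y \<noteq> 0"
  obtains a b where "{v. v \<bullet> y = 0} = {\<alpha> *\<^sub>R a + \<beta> *\<^sub>R b | \<alpha> \<beta>. True}"
    "\<And>\<alpha> \<beta>. \<alpha> *\<^sub>R a + \<beta> *\<^sub>R b = 0 \<Longrightarrow> \<alpha> = 0 \<and> \<beta> = 0"
proof -
  have S: "subspace {v. y \<bullet> v = 0}" by (rule subspace_hyperplane)
  obtain B where B: "independent B" "card B = dim {v. y \<bullet> v = 0}" "span B = {v. y \<bullet> v = 0}"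
    using orthonormal_basis_subspace[OF S] by metis
  have "card B = 2" using B(2) dim_hyperplane[OF assms] by simp
  then obtain a b where ab: "B = {a, b}" "a \<noteq> b" by (auto simp: card_2_iff)
  have "span {a, b} = {\<alpha> *\<^sub>R a + \<beta> *\<^sub>R b | \<alpha> \<beta>. True}"
  proof
    show "span {a, b} \<subseteq> {\<alpha> *\<^sub>R a + \<beta> *\<^sub>R b | \<alpha> \<beta>. True}"
    proof
      fix x assume "x \<in> span {a, b}"
      then obtain \<alpha> \<beta> where "x - \<alpha> *\<^sub>R a - \<beta> *\<^sub>R b = 0" by (auto simp: span_breakdown_eq)
      then have "x = \<alpha> *\<^sub>R a + \<beta> *\<^sub>R b" by (simp add: algebra_simps)
      then show "x \<in> {\<alpha> *\<^sub>R a + \<beta> *\<^sub>R b | \<alpha> \<beta>. True}" by blast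
    qed
    show "{\<alpha> *\<^sub>R a + \<beta> *\<^sub>R b | \<alpha> \<beta>. True} \<subseteq> span {a, b}"
      by (clarsimp, intro span_add span_scale) (simp_all add: span_base)
  qed
  moreover have "\<alpha> = 0 \<and> \<beta> = 0" if "\<alpha> *\<^sub>R a + \<beta> *\<^sub>R b = 0" for \<alpha> \<beta>
  proof -
    have "(\<Sum>v\<in>{a, b}. (if v = a then \<alpha> else \<beta>) *\<^sub>R v) = 0" using that ab(2) by simp
    then have "\<forall>v\<in>{a, b}. (if v = a then \<alpha> else \<beta>) = 0"
      using B(1) unfolding ab(1) by (intro ballI independentD[of "{a, b}" "{a, b}"]) auto
    then show ?thesis using ab(2) by auto
  qed
  ultimately show ?thesis using B(3) ab(1) by (intro that[of a b]) (auto simp: inner_commute)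
qed

section \<open>Tangent spaces of coordinate spheres and time slices\<close>

lemma open_exterior: "open exterior"
  unfolding exterior_def by (intro open_Times) auto

lemma exterior_iff: "q \<in> exterior \<longleftrightarrow> 1 < norm (fst q)"
  by (cases q) (auto simp: exterior_def)

lemma tangent_spaceI:
  assumes "0 < \<epsilon>" "smooth_on {-\<epsilon><..<\<epsilon>} \<gamma>" "\<And>s. \<bar>s\<bar> < \<epsilon> \<Longrightarrow> \<gamma> s \<in> S" "\<gamma> 0 = p"
    "(\<gamma> has_vector_derivative v) (at 0)"
  shows "v \<in> tangent_space S p"
proof -
  have "\<gamma> ` {-\<epsilon><..<\<epsilon>} \<subseteq> S" using assms(3) by (auto simp: abs_less_iff)
  with assms show ?thesis unfolding tangent_space_def by blast
qed

lemma tangent_spaceE: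
  assumes "v \<in> tangent_space S p"
  obtains \<epsilon> \<gamma> where "0 < \<epsilon>" "smooth_on {-\<epsilon><..<\<epsilon>} \<gamma>" "\<forall>s. \<bar>s\<bar> < \<epsilon> \<longrightarrow> \<gamma> s \<in> S" "\<gamma> 0 = p"
    "(\<gamma> has_vector_derivative v) (at 0)"
proof -
  obtain \<gamma> \<epsilon> where *: "0 < \<epsilon>" "smooth_on {-\<epsilon><..<\<epsilon>} \<gamma>" "\<gamma> ` {-\<epsilon><..<\<epsilon>} \<subseteq> S" "\<gamma> 0 = p"
    "(\<gamma> has_vector_derivative v) (at (0::real))"
    using assms unfolding tangent_space_def by blast
  show ?thesis
  proof (rule that[OF *(1,2) _ *(4,5)])
    show "\<forall>s. \<bar>s\<bar> < \<epsilon> \<longrightarrow> \<gamma> s \<in> S"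
      using *(3) by (force simp: abs_less_iff)
  qed
qed

lemma has_vector_derivative_chain:
  assumes "(\<gamma> has_vector_derivative v) (at s)" "(f has_derivative f') (at (\<gamma> s))"
  shows "((\<lambda>s. f (\<gamma> s)) has_vector_derivative f' v) (at s)"
  using has_derivative_compose[OF assms(1)[unfolded has_vector_derivative_def] assms(2)]
    linear_cmul[OF has_derivative_linear[OF assms(2)]]
  unfolding has_vector_derivative_def by simp

lemma has_vector_derivative_unique_on:
  fixes s :: real
  assumes "(f has_vector_derivative a) (at s)" "(g has_vector_derivative b) (at s)" "open T" "s \<in> T"
    "\<And>x. x \<in> T \<Longrightarrow> f x = g x"
  shows "a = b"
  using fun_cong[OF has_derivative_unique_on_open[OF assms(1,2)[unfolded has_vector_derivative_def] assms(3,4,5)], of 1]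
  by simp

lemma tangent_space_sphere:
  fixes y :: "real^3" and t :: real
  assumes "y \<noteq> 0"
  shows "tangent_space (sphere 0 (norm y) \<times> {t}) (y, t) = {(v, 0) | v. v \<bullet> y = 0}"
proof (intro Set.set_eqI iffI)
  fix w assume "w \<in> tangent_space (sphere 0 (norm y) \<times> {t}) (y, t)"
  then obtain \<epsilon> \<gamma> where \<gamma>: "0 < \<epsilon>" "smooth_on {-\<epsilon><..<\<epsilon>} \<gamma>" "\<forall>s. \<bar>s\<bar> < \<epsilon> \<longrightarrow> \<gamma> s \<in> sphere 0 (norm y) \<times> {t}" "\<gamma> 0 = (y, t)"
    "(\<gamma> has_vector_derivative w) (at 0)" by (rule tangent_spaceE)
  let ?I = "{-\<epsilon><..<\<epsilon>}"
  have 1: "((\<lambda>s. fst (\<gamma> s)) has_vector_derivative fst w) (at 0)" "((\<lambda>s. snd (\<gamma> s)) has_vector_derivative snd w) (at 0)"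
    using \<gamma>(5) unfolding has_vector_derivative_def by (auto dest: has_derivative_fst has_derivative_snd)
  have in_S: "norm (fst (\<gamma> s)) = norm y" "snd (\<gamma> s) = t" if "s \<in> ?I" for s
    using \<gamma>(3)[rule_format, of s] that by (auto simp: mem_Times_iff)
  have "snd w = 0"
    by (rule has_vector_derivative_unique_on[OF 1(2) has_vector_derivative_const, of ?I t]) (use \<gamma>(1) in_S in auto)
  moreover have "y \<bullet> fst w + fst w \<bullet> y = 0"
  proof (rule has_vector_derivative_unique_on[where T = ?I and s = 0])
    show "((\<lambda>s. fst (\<gamma> s) \<bullet> fst (\<gamma> s)) has_vector_derivative (y \<bullet> fst w + fst w \<bullet> y)) (at 0)"
      using bounded_bilinear.has_vector_derivative[OF bounded_bilinear_inner 1(1) 1(1)] \<gamma>(4) by simp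
    show "((\<lambda>s. y \<bullet> y) has_vector_derivative 0) (at 0)" by (rule has_vector_derivative_const)
    show "fst (\<gamma> s) \<bullet> fst (\<gamma> s) = y \<bullet> y" if "s \<in> ?I" for s
      using in_S(1)[OF that] by (simp add: dot_square_norm)
  qed (use \<gamma>(1) in auto)
  ultimately show "w \<in> {(v, 0) | v. v \<bullet> y = 0}" by (cases w) (simp add: inner_commute)
next
  fix w :: event assume "w \<in> {(v, 0) | v. v \<bullet> y = 0}"
  then obtain v where w: "w = (v, 0)" and v: "v \<bullet> y = 0" by blast
  show "w \<in> tangent_space (sphere 0 (norm y) \<times> {t}) (y, t)"
  proof (cases "v = 0")
    case True
    then show ?thesis
      by (intro tangent_spaceI[of 1 "\<lambda>s. (y, t)"])
        (auto simp: w smooth_on_const zero_prod_def[symmetric])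
  next
    case False
    define k where "k = norm v / norm y"
    have k: "k \<noteq> 0" "norm v = k * norm y" using False assms by (simp_all add: k_def)
    define \<gamma> where "\<gamma> = (\<lambda>s::real. (cos (k * s) *\<^sub>R y + (sin (k * s) / k) *\<^sub>R v, t))"
    show ?thesis
    proof (rule tangent_spaceI[of 1 \<gamma>])
      have "open {-1<..<1::real}" by simp
      moreover have "smooth_on {-1<..<1::real} (\<lambda>s. cos (k * s) *\<^sub>R y + ((1 / k) * sin (k * s)) *\<^sub>R v)"
        by (intro smooth_on_intros open_greaterThanLessThan)
      ultimately show "smooth_on {-1<..<1} \<gamma>" unfolding \<gamma>_def by (intro smooth_on_Pair smooth_on_const) auto
      show "\<gamma> 0 = (y, t)" by (simp add: \<gamma>_def)
      show "(\<gamma> has_vector_derivative w) (at 0)"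
        unfolding \<gamma>_def w has_vector_derivative_def
        by (rule has_derivative_eq_rhs, (rule derivative_intros)+) (use k in \<open>auto intro!: derivative_eq_intros simp: fun_eq_iff\<close>)
      fix s
      have "(norm (fst (\<gamma> s)))\<^sup>2 = (cos (k * s))\<^sup>2 * (norm y)\<^sup>2 + (sin (k * s) / k)\<^sup>2 * (norm v)\<^sup>2"
        unfolding power2_norm_eq_inner \<gamma>_def using v
        by (simp add: inner_add_left inner_add_right inner_commute[of y v] power2_eq_square)
      also have "\<dots> = ((cos (k * s))\<^sup>2 + (sin (k * s))\<^sup>2) * (norm y)\<^sup>2"
        using k(1) unfolding k(2) by (simp add: power_mult_distrib power_divide distrib_right del: sin_cos_squared_add sin_cos_squared_add2)
      finally have "(norm (fst (\<gamma> s)))\<^sup>2 = (norm y)\<^sup>2" by simp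
      then show "\<gamma> s \<in> sphere 0 (norm y) \<times> {t}" by (simp add: \<gamma>_def)
    qed simp
  qed
qed

lemma tangent_space_slice:
  fixes y :: "real^3" and t :: real
  assumes "1 < norm y"
  shows "tangent_space ((- cball 0 1) \<times> {t}) (y, t) = {(v, 0) | v. True}"
proof (intro Set.set_eqI iffI)
  fix w assume "w \<in> tangent_space ((- cball 0 1) \<times> {t}) (y, t)"
  then obtain \<epsilon> \<gamma> where \<gamma>: "0 < \<epsilon>" "smooth_on {-\<epsilon><..<\<epsilon>} \<gamma>" "\<forall>s. \<bar>s\<bar> < \<epsilon> \<longrightarrow> \<gamma> s \<in> (- cball 0 1) \<times> {t}" "\<gamma> 0 = (y, t)"
    "(\<gamma> has_vector_derivative w) (at 0)" by (rule tangent_spaceE)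
  have 1: "((\<lambda>s. snd (\<gamma> s)) has_vector_derivative snd w) (at 0)"
    using \<gamma>(5) unfolding has_vector_derivative_def by (auto dest: has_derivative_snd)
  have "snd w = 0"
    by (rule has_vector_derivative_unique_on[OF 1 has_vector_derivative_const, of "{-\<epsilon><..<\<epsilon>}" t])
      (use \<gamma>(1,3) in \<open>auto simp: mem_Times_iff\<close>)
  then show "w \<in> {(v, 0) | v. True}" by (cases w) simp
next
  fix w :: event assume "w \<in> {(v, 0) | v. True}"
  then obtain v where w: "w = (v, 0)" by blast
  define \<epsilon> where "\<epsilon> = (norm y - 1) / (norm v + 1)"
  have pos: "norm v + 1 > 0" by (simp add: add_nonneg_pos)
  have \<epsilon>: "0 < \<epsilon>" using assms pos by (simp add: \<epsilon>_def)
  show "w \<in> tangent_space ((- cball 0 1) \<times> {t}) (y, t)"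
  proof (rule tangent_spaceI[OF \<epsilon>, of "\<lambda>s. (y + s *\<^sub>R v, t)"])
    show "smooth_on {-\<epsilon><..<\<epsilon>} (\<lambda>s. (y + s *\<^sub>R v, t))"
      by (intro smooth_on_intros open_greaterThanLessThan)
    show "((\<lambda>s. (y + s *\<^sub>R v, t)) has_vector_derivative w) (at 0)"
      unfolding w has_vector_derivative_def by (auto intro!: derivative_eq_intros simp: fun_eq_iff)
    fix s assume s: "\<bar>s\<bar> < \<epsilon>"
    have "norm y \<le> norm (y + s *\<^sub>R v) + \<bar>s\<bar> * norm v"
      using norm_triangle_ineq4[of "y + s *\<^sub>R v" "s *\<^sub>R v"] by simp
    moreover have "\<bar>s\<bar> * norm v \<le> \<epsilon> * norm v" using s by (intro mult_right_mono) auto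
    moreover have "\<epsilon> * norm v < \<epsilon> * (norm v + 1)" using \<epsilon> by simp
    moreover have "\<epsilon> * (norm v + 1) = norm y - 1" using pos by (simp add: \<epsilon>_def)
    ultimately have "1 < norm (y + s *\<^sub>R v)" by linarith
    then show "(y + s *\<^sub>R v, t) \<in> (- cball 0 1) \<times> {t}" by simp
  qed simp
qed

text \<open>The chart as a map between regions; the conditions on the metric coefficients and on the mean
curvature enter later.\<close>

locale exterior_chart = lorentzian_manifold exterior g for g +
  fixes \<Phi> :: "event \<Rightarrow> event"
  assumes chart: "diffeo_on exterior exterior \<Phi>"
begin

abbreviation "\<Psi> \<equiv> inv_into exterior \<Phi>"
abbreviation "D \<equiv> \<lambda>q. frechet_derivative \<Phi> (at q)"

lemma smooth_chart: "smooth_on exterior \<Phi>" "smooth_on exterior \<Psi>"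
  using chart unfolding diffeo_on_def by blast+

lemma bij_chart: "bij_betw \<Phi> exterior exterior"
  using chart unfolding diffeo_on_def by blast

lemma chart_in: "q \<in> exterior \<Longrightarrow> \<Phi> q \<in> exterior" "p \<in> exterior \<Longrightarrow> \<Psi> p \<in> exterior"
  using bij_chart bij_betw_inv_into[OF bij_chart] by (auto dest: bij_betwE)

lemma chart_inv: "q \<in> exterior \<Longrightarrow> \<Psi> (\<Phi> q) = q" "p \<in> exterior \<Longrightarrow> \<Phi> (\<Psi> p) = p"
  using bij_betw_inv_into_left[OF bij_chart] bij_betw_inv_into_right[OF bij_chart] by blast+

lemma chart_has_derivative: "q \<in> exterior \<Longrightarrow> (\<Phi> has_derivative D q) (at q)"
  by (rule smooth_on_has_derivative[OF smooth_chart(1)])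

lemma D_inv:
  assumes "q \<in> exterior"
  shows "frechet_derivative \<Psi> (at (\<Phi> q)) (D q v) = v" "D q (frechet_derivative \<Psi> (at (\<Phi> q)) v) = v"
proof -
  have 1: "((\<lambda>q. \<Psi> (\<Phi> q)) has_derivative (\<lambda>v. frechet_derivative \<Psi> (at (\<Phi> q)) (D q v))) (at q)"
    by (rule has_derivative_compose[OF chart_has_derivative[OF assms] smooth_on_has_derivative[OF smooth_chart(2) chart_in(1)[OF assms]]])
  from has_derivative_unique_on_open[OF this has_derivative_ident open_exterior assms chart_inv(1)]
  show "frechet_derivative \<Psi> (at (\<Phi> q)) (D q v) = v" by (rule fun_cong)
  have 2: "((\<lambda>q. \<Phi> (\<Psi> q)) has_derivative (\<lambda>v. D q (frechet_derivative \<Psi> (at (\<Phi> q)) v))) (at (\<Phi> q))"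
    by (rule has_derivative_compose[OF smooth_on_has_derivative[OF smooth_chart(2) chart_in(1)[OF assms]]])
      (simp add: chart_inv(1)[OF assms] chart_has_derivative[OF assms])
  from has_derivative_unique_on_open[OF this has_derivative_ident open_exterior chart_in(1)[OF assms] chart_inv(2)]
  show "D q (frechet_derivative \<Psi> (at (\<Phi> q)) v) = v" by (rule fun_cong)
qed

lemma linear_D: "q \<in> exterior \<Longrightarrow> linear (D q)"
  by (rule has_derivative_linear[OF chart_has_derivative])

lemma D_eq_0: "q \<in> exterior \<Longrightarrow> D q v = 0 \<longleftrightarrow> v = 0"
  using D_inv(1)[of q v] D_inv(1)[of q 0] linear_0[OF linear_D] by metis

text \<open>Tangent vectors are velocities of curves, and curves are carried back and forth by the chart and
its inverse.\<close>

lemma tangent_space_image: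
  assumes "A \<subseteq> exterior" "q \<in> A"
  shows "tangent_space (\<Phi> ` A) (\<Phi> q) = D q ` tangent_space A q"
proof (intro Set.set_eqI iffI)
  have q: "q \<in> exterior" using assms by blast
  fix w assume "w \<in> tangent_space (\<Phi> ` A) (\<Phi> q)"
  then obtain \<epsilon> \<gamma> where \<gamma>: "0 < \<epsilon>" "smooth_on {-\<epsilon><..<\<epsilon>} \<gamma>" "\<forall>s. \<bar>s\<bar> < \<epsilon> \<longrightarrow> \<gamma> s \<in> \<Phi> ` A" "\<gamma> 0 = \<Phi> q"
    "(\<gamma> has_vector_derivative w) (at 0)" by (rule tangent_spaceE)
  have in_ext: "\<gamma> s \<in> exterior" if s: "\<bar>s\<bar> < \<epsilon>" for s
  proof -
    obtain a where "\<gamma> s = \<Phi> a" "a \<in> A" using \<gamma>(3)[rule_format, OF s] by (rule imageE)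
    then show ?thesis using chart_in(1)[of a] assms(1) by auto
  qed
  have "frechet_derivative \<Psi> (at (\<Phi> q)) w \<in> tangent_space A q"
  proof (rule tangent_spaceI[OF \<gamma>(1), of "\<lambda>s. \<Psi> (\<gamma> s)"])
    show "smooth_on {-\<epsilon><..<\<epsilon>} (\<lambda>s. \<Psi> (\<gamma> s))"
      by (rule smooth_on_compose[OF open_greaterThanLessThan smooth_chart(2) \<gamma>(2)]) (use in_ext in \<open>auto simp: abs_less_iff\<close>)
    show "\<Psi> (\<gamma> 0) = q" using \<gamma>(4) chart_inv(1)[OF q] by simp
    show "((\<lambda>s. \<Psi> (\<gamma> s)) has_vector_derivative frechet_derivative \<Psi> (at (\<Phi> q)) w) (at 0)"
      by (rule has_vector_derivative_chain[OF \<gamma>(5)])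
        (simp add: \<gamma>(4) smooth_on_has_derivative[OF smooth_chart(2) chart_in(1)[OF q]])
    fix s assume "\<bar>s\<bar> < \<epsilon>"
    then obtain a where "\<gamma> s = \<Phi> a" "a \<in> A" by (rule imageE[OF \<gamma>(3)[rule_format]])
    then show "\<Psi> (\<gamma> s) \<in> A" using chart_inv(1)[of a] assms(1) by auto
  qed
  then show "w \<in> D q ` tangent_space A q" using D_inv(2)[OF q, of w] by (metis imageI)
next
  have q: "q \<in> exterior" using assms by blast
  fix w assume "w \<in> D q ` tangent_space A q"
  then obtain v where w: "w = D q v" and v: "v \<in> tangent_space A q" by blast
  from v obtain \<epsilon> \<gamma> where \<gamma>: "0 < \<epsilon>" "smooth_on {-\<epsilon><..<\<epsilon>} \<gamma>" "\<forall>s. \<bar>s\<bar> < \<epsilon> \<longrightarrow> \<gamma> s \<in> A" "\<gamma> 0 = q"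
    "(\<gamma> has_vector_derivative v) (at 0)" by (rule tangent_spaceE)
  show "w \<in> tangent_space (\<Phi> ` A) (\<Phi> q)"
  proof (rule tangent_spaceI[OF \<gamma>(1), of "\<lambda>s. \<Phi> (\<gamma> s)"])
    show "smooth_on {-\<epsilon><..<\<epsilon>} (\<lambda>s. \<Phi> (\<gamma> s))"
      by (rule smooth_on_compose[OF open_greaterThanLessThan smooth_chart(1) \<gamma>(2)])
        (use \<gamma>(3) assms(1) in \<open>force simp: abs_less_iff\<close>)
    show "((\<lambda>s. \<Phi> (\<gamma> s)) has_vector_derivative w) (at 0)"
      unfolding w by (rule has_vector_derivative_chain[OF \<gamma>(5)]) (simp add: \<gamma>(4) chart_has_derivative[OF q])
  qed (use \<gamma>(3,4) in auto)
qed

lemma coordinate_sphere_eq: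
  assumes "0 < r" shows "coordinate_sphere \<Phi> t r = \<Phi> ` (sphere 0 r \<times> {t})"
proof -
  have "(\<lambda>x::real^3. r *\<^sub>R x) ` sphere 0 1 = sphere 0 r"
    using sphere_scale[of r "0::real^3" 1] assms by simp
  then have "sphere 0 r \<times> {t} = (\<lambda>x. (r *\<^sub>R x, t)) ` sphere (0::real^3) 1" by force
  then show ?thesis unfolding coordinate_sphere_def chart_point_def by (simp add: image_image)
qed

lemma time_slice_eq: "time_slice \<Phi> t = \<Phi> ` ((- cball 0 1) \<times> {t})"
proof -
  have "(\<Union>r\<in>{1<..}. sphere 0 r \<times> {t}) = (- cball (0::real^3) 1) \<times> {t}" by auto
  moreover have "time_slice \<Phi> t = (\<Union>r\<in>{1<..}. \<Phi> ` (sphere 0 r \<times> {t}))"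
    unfolding time_slice_def by (intro SUP_cong refl coordinate_sphere_eq) simp
  ultimately show ?thesis by (metis image_UN)
qed

lemma tangent_space_coordinate_sphere:
  assumes "1 < norm y"
  shows "tangent_space (coordinate_sphere \<Phi> t (norm y)) (\<Phi> (y, t)) = {D (y, t) (v, 0) | v. v \<bullet> y = 0}"
proof -
  have "y \<noteq> 0" using assms by auto
  have "tangent_space (\<Phi> ` (sphere 0 (norm y) \<times> {t})) (\<Phi> (y, t)) = D (y, t) ` tangent_space (sphere 0 (norm y) \<times> {t}) (y, t)"
    by (rule tangent_space_image) (use assms in \<open>auto simp: exterior_def\<close>)
  also have "\<dots> = {D (y, t) (v, 0) | v. v \<bullet> y = 0}" unfolding tangent_space_sphere[OF \<open>y \<noteq> 0\<close>] by blast
  finally show ?thesis using coordinate_sphere_eq[of "norm y" t] \<open>y \<noteq> 0\<close> by simp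
qed

lemma tangent_space_time_slice:
  assumes "1 < norm y"
  shows "tangent_space (time_slice \<Phi> t) (\<Phi> (y, t)) = {D (y, t) (v, 0) | v. True}"
proof -
  have "tangent_space (\<Phi> ` ((- cball 0 1) \<times> {t})) (\<Phi> (y, t)) = D (y, t) ` tangent_space ((- cball 0 1) \<times> {t}) (y, t)"
    by (rule tangent_space_image) (use assms in \<open>auto simp: exterior_def\<close>)
  also have "\<dots> = {D (y, t) (v, 0) | v. True}" unfolding tangent_space_slice[OF assms] by blast
  finally show ?thesis unfolding time_slice_eq .
qed

end

section \<open>Second fundamental form and mean curvature vector\<close>

text \<open>Every vector tangent to a sphere about the origin is the value at \<open>y\<close> of an infinitesimal rotation.
Rotation fields are tangent to all spheres at once and linear in the point, so they are the
preferred extensions of tangent vectors in what follows.\<close>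

lemma cross_representation:
  assumes "y \<noteq> 0" "v \<bullet> y = 0"
  shows "cross3 ((1 / (y \<bullet> y)) *\<^sub>R cross3 y v) y = v"
proof -
  have "cross3 (cross3 y v) y = (y \<bullet> y) *\<^sub>R v - (v \<bullet> y) *\<^sub>R y"
    unfolding cross_skew[of "cross3 y v" y] Lagrange by (simp add: inner_commute)
  then show ?thesis using assms unfolding cross_mult_left by simp
qed

text \<open>The metric is positive definite on the plane spanned by \<open>x\<close> and \<open>y\<close>, so a decomposition into a
normal and a tangential vector is unique.\<close>

lemma (in lorentzian_manifold) normal_part_eq:
  assumes p: "p \<in> M" and W: "tangent_space S p = W" and x: "x \<in> W" "y \<in> W"
    and on: "g p x x = 1" "g p y y = 1" "g p x y = 0"
    and ex: "\<And>v. v \<in> W \<Longrightarrow> v = g p v x *\<^sub>R x + g p v y *\<^sub>R y"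
    and sub: "\<And>a b. a *\<^sub>R x + b *\<^sub>R y \<in> W"
  shows "normal_part g S p w = w - g p w x *\<^sub>R x - g p w y *\<^sub>R y"
  unfolding normal_part_def W
proof (rule the_equality)
  let ?n = "w - g p w x *\<^sub>R x - g p w y *\<^sub>R y"
  have yx: "g p y x = 0" using on(3) sym_g[OF p, of y x] by simp
  have nx: "g p ?n x = 0" "g p ?n y = 0" by (simp_all add: g_simps[OF p] on yx)
  have orth: "g p n v = 0" if "g p n x = 0" "g p n y = 0" "v \<in> W" for n v
    using ex[OF that(3)] that(1,2) g_simps[OF p]
    by (metis (no_types, lifting) add.right_neutral scaleR_zero_right)
  have "w - ?n \<in> W" using sub[of "g p w x" "g p w y"] by (simp add: add.commute)
  then show "(\<forall>v\<in>W. g p ?n v = 0) \<and> w - ?n \<in> W" using orth[OF nx] by blast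
  fix n assume n: "(\<forall>v\<in>W. g p n v = 0) \<and> w - n \<in> W"
  have "w - n = g p (w - n) x *\<^sub>R x + g p (w - n) y *\<^sub>R y" using n by (intro ex) blast
  also have "\<dots> = g p w x *\<^sub>R x + g p w y *\<^sub>R y" using n x by (simp add: g_simps[OF p])
  finally show "n = ?n" by (simp add: algebra_simps)
qed

context exterior_chart begin

definition tangent_plane where
  "tangent_plane y t = {D (y, t) (v, 0) | v. v \<bullet> y = 0}"

lemma tangent_plane: "1 < norm y \<Longrightarrow> tangent_space (coordinate_sphere \<Phi> t (norm y)) (\<Phi> (y, t)) = tangent_plane y t"
  unfolding tangent_plane_def by (rule tangent_space_coordinate_sphere)

lemma on_coordinate_sphere:
  assumes "1 < norm y" "p \<in> coordinate_sphere \<Phi> t (norm y)"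
  obtains z where "norm z = norm y" "p = \<Phi> (z, t)"
proof -
  have "0 < norm y" using assms(1) by linarith
  from assms(2)[unfolded coordinate_sphere_eq[OF this]] show ?thesis by (auto intro: that)
qed

lemma in_coordinate_sphere: "1 < norm y \<Longrightarrow> \<Phi> (y, t) \<in> coordinate_sphere \<Phi> t (norm y)"
  by (subst coordinate_sphere_eq) (linarith, simp)

lemma tangent_plane_combination:
  assumes "1 < norm y" "a \<in> tangent_plane y t" "b \<in> tangent_plane y t"
  shows "\<alpha> *\<^sub>R a + \<beta> *\<^sub>R b \<in> tangent_plane y t"
proof -
  have q: "(y, t) \<in> exterior" using assms by (simp add: exterior_iff)
  obtain v w where v: "a = D (y, t) (v, 0)" "v \<bullet> y = 0" "b = D (y, t) (w, 0)" "w \<bullet> y = 0"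
    using assms(2,3) unfolding tangent_plane_def by blast
  have "\<alpha> *\<^sub>R a + \<beta> *\<^sub>R b = D (y, t) (\<alpha> *\<^sub>R v + \<beta> *\<^sub>R w, 0)"
    using linear_add[OF linear_D[OF q], of "\<alpha> *\<^sub>R (v, 0)" "\<beta> *\<^sub>R (w, 0)"]
    by (simp add: v linear_cmul[OF linear_D[OF q]] linear_cmul[OF linear_D[OF q], symmetric])
  then show ?thesis using v by (auto simp: tangent_plane_def inner_add_left)
qed

text \<open>Modulo tangent vectors, the derivative of a tangent field does not depend on the field beyond its
value at the point. The reason: in the chart the field along a curve \<open>\<delta>\<close> in the sphere is
some \<open>K\<close> with \<open>K \<bullet> \<delta> = 0\<close>, and differentiating this relation determines the radial component of the
derivative of \<open>K\<close>.\<close>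

lemma derivative_of_tangent_field:
  assumes y: "1 < norm y" and w: "w \<bullet> y = 0"
    and V: "open V" "\<Phi> (y, t) \<in> V" "(Y has_derivative Y') (at (\<Phi> (y, t)))"
    and Y: "\<And>z. z \<in> coordinate_sphere \<Phi> t (norm y) \<inter> V \<Longrightarrow> Y z \<in> tangent_space (coordinate_sphere \<Phi> t (norm y)) z"
    and v: "Y (\<Phi> (y, t)) = D (y, t) (v, 0)" "v \<bullet> y = 0"
  shows "Y' (D (y, t) (w, 0)) - (D2 \<Phi> (y, t) (w, 0) (v, 0) - (w \<bullet> v / (y \<bullet> y)) *\<^sub>R D (y, t) (y, 0)) \<in> tangent_plane y t"
proof -
  let ?q = "(y, t)" and ?S = "coordinate_sphere \<Phi> t (norm y)"
  have q: "?q \<in> exterior" using y by (simp add: exterior_iff)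
  have y0: "y \<noteq> 0" using y by auto
  have "(w, 0) \<in> tangent_space (sphere 0 (norm y) \<times> {t}) (y, t)"
    using w unfolding tangent_space_sphere[OF y0] by blast
  then obtain \<epsilon> \<delta> where \<delta>: "0 < \<epsilon>" "smooth_on {-\<epsilon><..<\<epsilon>} \<delta>" "\<forall>s. \<bar>s\<bar> < \<epsilon> \<longrightarrow> \<delta> s \<in> sphere 0 (norm y) \<times> {t}" "\<delta> 0 = ?q"
    "(\<delta> has_vector_derivative (w, 0)) (at 0)" by (rule tangent_spaceE)
  let ?I = "{-\<epsilon><..<\<epsilon>}"
  have \<delta>_ext: "\<delta> s \<in> exterior" "norm (fst (\<delta> s)) = norm y" "snd (\<delta> s) = t" if "s \<in> ?I" for s
    using \<delta>(3)[rule_format, of s] that y by (auto simp: mem_Times_iff exterior_iff)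
  define \<gamma> where "\<gamma> = (\<lambda>s. \<Phi> (\<delta> s))"
  have \<gamma>0: "\<gamma> 0 = \<Phi> ?q" by (simp add: \<gamma>_def \<delta>(4))
  have \<gamma>': "(\<gamma> has_vector_derivative D ?q (w, 0)) (at 0)"
    unfolding \<gamma>_def by (rule has_vector_derivative_chain[OF \<delta>(5)]) (simp add: \<delta>(4) chart_has_derivative[OF q])
  have "continuous_on ?I \<gamma>"
    unfolding \<gamma>_def using \<delta>_ext(1)
    by (intro continuous_on_compose2[OF smooth_on_continuous[OF smooth_chart(1)] smooth_on_continuous[OF \<delta>(2)]]) auto
  \<comment> \<open>the times at which the curve is in the domain of \<open>Y\<close>\<close>
  then have J: "open (?I \<inter> \<gamma> -` V)" by (rule continuous_open_preimage[OF _ open_greaterThanLessThan V(1)])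
  let ?J = "?I \<inter> \<gamma> -` V"
  have J0: "0 \<in> ?J" using \<delta>(1) V(2) \<gamma>0 by simp
  define K where "K = (\<lambda>s. frechet_derivative \<Psi> (at (\<gamma> s)) (Y (\<gamma> s)))"
  have \<gamma>_ext: "\<gamma> s \<in> exterior" if "s \<in> ?I" for s unfolding \<gamma>_def by (rule chart_in(1)[OF \<delta>_ext(1)[OF that]])
  have Kin: "D (\<delta> s) (K s) = Y (\<gamma> s)" "snd (K s) = 0" "fst (K s) \<bullet> fst (\<delta> s) = 0" if "s \<in> ?J" for s
  proof -
    have s: "s \<in> ?I" "\<gamma> s \<in> V" using that by auto
    have ds: "\<delta> s = (fst (\<delta> s), t)" using \<delta>_ext(3)[OF s(1)] by (metis prod.collapse)
    have ns: "1 < norm (fst (\<delta> s))" using \<delta>_ext(2)[OF s(1)] y by simp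
    have "\<gamma> s \<in> ?S" using in_coordinate_sphere[OF ns, of t] ds \<delta>_ext(2)[OF s(1)] unfolding \<gamma>_def by simp
    then have "Y (\<gamma> s) \<in> tangent_space ?S (\<gamma> s)" using s(2) by (intro Y) blast
    also have "tangent_space ?S (\<gamma> s) = tangent_plane (fst (\<delta> s)) t"
      using tangent_plane[OF ns, of t] ds \<delta>_ext(2)[OF s(1)] unfolding \<gamma>_def by simp
    finally obtain k where k: "Y (\<gamma> s) = D (\<delta> s) (k, 0)" "k \<bullet> fst (\<delta> s) = 0"
      using ds unfolding tangent_plane_def by auto
    have "K s = (k, 0)" unfolding K_def k(1) unfolding \<gamma>_def by (rule D_inv(1)[OF \<delta>_ext(1)[OF s(1)]])
    then show "D (\<delta> s) (K s) = Y (\<gamma> s)" "snd (K s) = 0" "fst (K s) \<bullet> fst (\<delta> s) = 0" using k by simp_all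
  qed
  have Y\<gamma>: "((\<lambda>s. Y (\<gamma> s)) has_vector_derivative Y' (D ?q (w, 0))) (at 0)"
    by (rule has_vector_derivative_chain[OF \<gamma>']) (simp add: \<gamma>0 V(3))
  obtain k' where K': "(K has_vector_derivative k') (at 0)"
  proof -
    have "((\<lambda>s. frechet_derivative \<Psi> (at (\<gamma> s)) (Y (\<gamma> s))) has_derivative
      (\<lambda>u. D2 \<Psi> (\<gamma> 0) (u *\<^sub>R D ?q (w, 0)) (Y (\<gamma> 0)) + frechet_derivative \<Psi> (at (\<gamma> 0)) (u *\<^sub>R Y' (D ?q (w, 0))))) (at 0)"
    proof (rule linear_family_derivative[where T = exterior and \<phi> = \<gamma> and L = "\<lambda>p. frechet_derivative \<Psi> (at p)"
        and V = "\<lambda>s. Y (\<gamma> s)" and x = 0 and L' = "\<lambda>v u. D2 \<Psi> (\<gamma> 0) u v", OF open_exterior])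
      show "\<gamma> 0 \<in> exterior" using \<gamma>0 chart_in(1)[OF q] by simp
      show "linear (frechet_derivative \<Psi> (at p))" if "p \<in> exterior" for p
        by (rule has_derivative_linear[OF smooth_on_has_derivative[OF smooth_chart(2) that]])
      show "((\<lambda>p. frechet_derivative \<Psi> (at p) v) has_derivative (\<lambda>u. D2 \<Psi> (\<gamma> 0) u v)) (at (\<gamma> 0))" for v
        by (rule smooth_on_has_derivative[OF smooth_on_derivative[OF smooth_chart(2)]]) (simp add: \<gamma>0 chart_in(1)[OF q])
    qed (use \<gamma>' Y\<gamma> in \<open>simp_all add: has_vector_derivative_def\<close>)
    then have "K differentiable (at 0)" unfolding K_def differentiable_def by blast
    then show ?thesis using that unfolding vector_derivative_works by blast
  qed
  have K0: "K 0 = (v, 0)" unfolding K_def \<gamma>0 v(1) by (rule D_inv(1)[OF q])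
  have fK: "((\<lambda>s. fst (K s)) has_vector_derivative fst k') (at 0)" "((\<lambda>s. snd (K s)) has_vector_derivative snd k') (at 0)"
    using K' unfolding has_vector_derivative_def by (auto dest: has_derivative_fst has_derivative_snd)
  have f\<delta>: "((\<lambda>s. fst (\<delta> s)) has_vector_derivative w) (at 0)"
    using has_derivative_fst[OF \<delta>(5)[unfolded has_vector_derivative_def]] unfolding has_vector_derivative_def by simp
  have k1: "snd k' = 0"
    by (rule has_vector_derivative_unique_on[OF fK(2) has_vector_derivative_const J J0 Kin(2)])
  have k2: "v \<bullet> w + fst k' \<bullet> y = 0"
    using has_vector_derivative_unique_on[OF bounded_bilinear.has_vector_derivative[OF bounded_bilinear_inner fK(1) f\<delta>]
        has_vector_derivative_const J J0 Kin(3)] by (simp add: K0 \<delta>(4))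
  have "((\<lambda>s. D (\<delta> s) (K s)) has_derivative (\<lambda>u. D2 \<Phi> (\<delta> 0) (u *\<^sub>R (w, 0)) (K 0) + D (\<delta> 0) (u *\<^sub>R k'))) (at 0)"
  proof (rule linear_family_derivative[where T = exterior and \<phi> = \<delta> and L = D
      and V = K and x = 0 and L' = "\<lambda>v u. D2 \<Phi> (\<delta> 0) u v", OF open_exterior])
    show "\<delta> 0 \<in> exterior" using \<delta>(4) q by simp
    show "linear (D p)" if "p \<in> exterior" for p by (rule linear_D[OF that])
    show "((\<lambda>p. D p v) has_derivative (\<lambda>u. D2 \<Phi> (\<delta> 0) u v)) (at (\<delta> 0))" for v
      by (rule smooth_on_has_derivative[OF smooth_on_derivative[OF smooth_chart(1)]]) (simp add: \<delta>(4) q)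
  qed (use \<delta>(5) K' in \<open>simp_all add: has_vector_derivative_def\<close>)
  from fun_cong[OF has_derivative_unique_on_open[OF this Y\<gamma>[unfolded has_vector_derivative_def] J J0 Kin(1)], of 1]
  have Y'_eq: "Y' (D ?q (w, 0)) = D2 \<Phi> ?q (w, 0) (v, 0) + D ?q k'" by (simp add: \<delta>(4) K0)
  \<comment> \<open>the tangential part of the derivative of \<open>K\<close>, and its radial part fixed by the orthogonality relation\<close>
  have k'_eq: "k' = (fst k' + (w \<bullet> v / (y \<bullet> y)) *\<^sub>R y, 0) - (w \<bullet> v / (y \<bullet> y)) *\<^sub>R (y, 0)"
    using k1 by (cases k') simp
  have "D ?q k' = D ?q (fst k' + (w \<bullet> v / (y \<bullet> y)) *\<^sub>R y, 0) - (w \<bullet> v / (y \<bullet> y)) *\<^sub>R D ?q (y, 0)"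
    using arg_cong[OF k'_eq, of "D ?q"] unfolding linear_diff[OF linear_D[OF q]] linear_cmul[OF linear_D[OF q]] .
  moreover have "(fst k' + (w \<bullet> v / (y \<bullet> y)) *\<^sub>R y) \<bullet> y = 0"
    using k2 y0 by (simp add: inner_add_left inner_commute[of v w])
  ultimately show ?thesis unfolding Y'_eq tangent_plane_def by (auto intro!: exI)
qed

text \<open>The field is the image under the chart of the infinitesimal rotation of \<open>cross_representation\<close>.\<close>

lemma tangent_extension_exists:
  assumes y: "1 < norm y" and v: "v \<bullet> y = 0"
  obtains Y where "smooth_on exterior Y" "Y (\<Phi> (y, t)) = D (y, t) (v, 0)"
    "\<forall>z\<in>coordinate_sphere \<Phi> t (norm y). Y z \<in> tangent_space (coordinate_sphere \<Phi> t (norm y)) z"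
proof -
  have y0: "y \<noteq> 0" using y by auto
  have q: "(y, t) \<in> exterior" using y by (simp add: exterior_iff)
  \<comment> \<open>the angular velocity of the rotation\<close>
  define a where "a = (1 / (y \<bullet> y)) *\<^sub>R cross3 y v"
  have av: "cross3 a y = v" unfolding a_def by (rule cross_representation[OF y0 v])
  define A where "A = (\<lambda>q::event. (cross3 a (fst q), 0::real))"
  define Y where "Y = (\<lambda>p. D (\<Psi> p) (A (\<Psi> p)))"
  have blA: "bounded_linear A"
  proof -
    have "linear A" unfolding A_def
      by (rule linearI) (simp_all add: cross_add_right cross_mult_right)
    then show ?thesis by (simp add: linear_conv_bounded_linear)
  qed
  have "smooth_on exterior (\<lambda>q. \<Sum>b\<in>Basis. (A q \<bullet> b) *\<^sub>R D q b)"
    using smooth_on_linear[OF open_exterior blA smooth_on_ident[OF open_exterior]]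
    by (intro smooth_on_sum smooth_on_scaleR smooth_on_inner smooth_on_const smooth_on_derivative smooth_chart open_exterior)
  then have "smooth_on exterior (\<lambda>q. D q (A q))"
    by (rule smooth_on_cong[OF open_exterior, rotated]) (simp add: linear_expand_Basis[OF linear_D, symmetric])
  then have 1: "smooth_on exterior Y" unfolding Y_def
    by (rule smooth_on_compose[OF open_exterior _ smooth_chart(2)]) (use chart_in in auto)
  have 2: "Y (\<Phi> (y, t)) = D (y, t) (v, 0)" unfolding Y_def chart_inv(1)[OF q] by (simp add: A_def av)
  have "Y z \<in> tangent_space (coordinate_sphere \<Phi> t (norm y)) z" if z: "z \<in> coordinate_sphere \<Phi> t (norm y)" for z
  proof -
    obtain x where x: "norm x = norm y" "z = \<Phi> (x, t)" using on_coordinate_sphere[OF y z] by blast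
    have xe: "(x, t) \<in> exterior" using x(1) y by (simp add: exterior_iff)
    have "Y z = D (x, t) (cross3 a x, 0)" unfolding Y_def x(2) chart_inv(1)[OF xe] by (simp add: A_def)
    moreover have "tangent_space (coordinate_sphere \<Phi> t (norm y)) z = tangent_plane x t"
      using tangent_plane[of x t] x y by simp
    ultimately show ?thesis using dot_cross_self(3)[of a x] dot_cross_self(2)[of x a] by (auto simp: tangent_plane_def inner_commute)
  qed
  then have "\<forall>z\<in>coordinate_sphere \<Phi> t (norm y). Y z \<in> tangent_space (coordinate_sphere \<Phi> t (norm y)) z" by blast
  with 1 2 show ?thesis by (rule that)
qed

end

text \<open>A point on a coordinate sphere whose tangent plane at this point is spacelike. The abbreviations
below suppress the point: \<open>E\<close> is the differential of the chart on spatial vectors, and \<open>h\<close> the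
pulled-back metric.\<close>

locale spacelike_sphere = exterior_chart +
  fixes y :: "real^3" and t :: real
  assumes y: "1 < norm y"
    and spacelike: "\<And>v. v \<bullet> y = 0 \<Longrightarrow> v \<noteq> 0 \<Longrightarrow> 0 < g (\<Phi> (y, t)) (D (y, t) (v, 0)) (D (y, t) (v, 0))"
begin

abbreviation "p \<equiv> \<Phi> (y, t)"
abbreviation "S \<equiv> coordinate_sphere \<Phi> t (norm y)"
abbreviation "E v \<equiv> D (y, t) (v, 0)"
abbreviation "h v w \<equiv> g p (E v) (E w)"

lemma y_nonzero: "y \<noteq> 0" using y by auto
lemma q_ext: "(y, t) \<in> exterior" using y by (simp add: exterior_iff)
lemma p_ext: "p \<in> exterior" by (rule chart_in(1)[OF q_ext])

lemma linear_E: "linear E"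
  using linear_add[OF linear_D[OF q_ext], of "(_, 0)" "(_, 0)"] linear_cmul[OF linear_D[OF q_ext], of _ "(_, 0)"]
  by (intro linearI) simp_all

lemmas E_simps = linear_add[OF linear_E] linear_diff[OF linear_E] linear_cmul[OF linear_E] linear_0[OF linear_E]

definition orthonormal_pair where
  "orthonormal_pair v w \<longleftrightarrow> v \<bullet> y = 0 \<and> w \<bullet> y = 0 \<and> h v v = 1 \<and> h w w = 1 \<and> h v w = 0"

lemma orthonormal_pair_exists:
  obtains v w where "orthonormal_pair v w"
    "\<forall>u. u \<bullet> y = 0 \<longrightarrow> u = h u v *\<^sub>R v + h u w *\<^sub>R w"
proof -
  obtain a b where ab: "{v. v \<bullet> y = 0} = {\<alpha> *\<^sub>R a + \<beta> *\<^sub>R b | \<alpha> \<beta>. True}"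
    "\<And>\<alpha> \<beta>. \<alpha> *\<^sub>R a + \<beta> *\<^sub>R b = 0 \<Longrightarrow> \<alpha> = 0 \<and> \<beta> = 0" using orthogonal_plane_basis[OF y_nonzero] by blast
  have "bilinear h" unfolding bilinear_def
    by (auto intro!: linearI simp: E_simps g_simps[OF p_ext])
  then obtain v w where "v \<in> {v. v \<bullet> y = 0}" "w \<in> {v. v \<bullet> y = 0}" "h v v = 1" "h w w = 1" "h v w = 0"
    "\<And>u. u \<in> {v. v \<bullet> y = 0} \<Longrightarrow> u = h u v *\<^sub>R v + h u w *\<^sub>R w"
    by (rule plane_orthonormal_basis[OF _ sym_g[OF p_ext] _ ab]) (use spacelike in auto)
  then have "orthonormal_pair v w" "\<forall>u. u \<bullet> y = 0 \<longrightarrow> u = h u v *\<^sub>R v + h u w *\<^sub>R w"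
    unfolding orthonormal_pair_def by simp_all
  then show ?thesis by (rule that)
qed

lemma orthonormal_pair_spans:
  assumes "orthonormal_pair v w" "u \<bullet> y = 0"
  shows "u = h u v *\<^sub>R v + h u w *\<^sub>R w"
proof -
  obtain a b where ab: "orthonormal_pair a b" "\<forall>u. u \<bullet> y = 0 \<longrightarrow> u = h u a *\<^sub>R a + h u b *\<^sub>R b"
    by (rule orthonormal_pair_exists)
  define d where "d = u - h u v *\<^sub>R v - h u w *\<^sub>R w"
  note on = assms(1)[unfolded orthonormal_pair_def] ab(1)[unfolded orthonormal_pair_def]
  have wv: "h w v = 0" "h b a = 0" using on sym_g[OF p_ext, of "E w" "E v"] sym_g[OF p_ext, of "E b" "E a"] by simp_all
  have d: "d \<bullet> y = 0" "h d v = 0" "h d w = 0"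
    using on assms(2) wv by (simp_all add: d_def inner_diff_left E_simps g_simps[OF p_ext])
  obtain v1 v2 where v: "v = v1 *\<^sub>R a + v2 *\<^sub>R b" using ab(2)[rule_format, of v] on by blast
  obtain w1 w2 where w: "w = w1 *\<^sub>R a + w2 *\<^sub>R b" using ab(2)[rule_format, of w] on by blast
  obtain d1 d2 where dd: "d = d1 *\<^sub>R a + d2 *\<^sub>R b" using ab(2)[rule_format, of d] d by blast
  have eqs: "v1 * v1 + v2 * v2 = 1" "w1 * w1 + w2 * w2 = 1" "v1 * w1 + v2 * w2 = 0" "d1 * v1 + d2 * v2 = 0" "d1 * w1 + d2 * w2 = 0"
    using on d wv unfolding v w dd by (simp_all add: E_simps g_simps[OF p_ext] mult.commute)
  have "d1 = 0" "d2 = 0" using eqs by algebra+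
  then have "d = 0" by (simp add: dd)
  then show ?thesis by (simp add: d_def algebra_simps)
qed

lemma normal_part_pair:
  assumes "orthonormal_pair v w"
  shows "normal_part g S p u = u - g p u (E v) *\<^sub>R E v - g p u (E w) *\<^sub>R E w"
proof (rule normal_part_eq[OF p_ext tangent_plane[OF y]])
  note on = assms[unfolded orthonormal_pair_def]
  show v: "E v \<in> tangent_plane y t" "E w \<in> tangent_plane y t" unfolding tangent_plane_def using on by blast+
  show "h v v = 1" "h w w = 1" "h v w = 0" using on by blast+
  show "\<alpha> *\<^sub>R E v + \<beta> *\<^sub>R E w \<in> tangent_plane y t" for \<alpha> \<beta> by (rule tangent_plane_combination[OF y v])
  fix x assume "x \<in> tangent_plane y t"
  then obtain u where u: "x = E u" "u \<bullet> y = 0" unfolding tangent_plane_def by blast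
  show "x = g p x (E v) *\<^sub>R E v + g p x (E w) *\<^sub>R E w"
    using arg_cong[OF orthonormal_pair_spans[OF assms u(2)], of E] unfolding u(1) E_simps .
qed

lemma linear_normal_part: "linear (normal_part g S p)"
proof -
  obtain v w where vw: "orthonormal_pair v w" by (rule orthonormal_pair_exists)
  show ?thesis unfolding normal_part_pair[OF vw, abs_def]
    by (rule linearI) (simp_all add: g_simps[OF p_ext] algebra_simps)
qed

lemma normal_part_tangent: "u \<in> tangent_plane y t \<Longrightarrow> normal_part g S p u = 0"
proof -
  obtain v w where vw: "orthonormal_pair v w" by (rule orthonormal_pair_exists)
  assume "u \<in> tangent_plane y t"
  then obtain x where x: "u = E x" "x \<bullet> y = 0" unfolding tangent_plane_def by blast
  have "E x = h x v *\<^sub>R E v + h x w *\<^sub>R E w"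
    using arg_cong[OF orthonormal_pair_spans[OF vw x(2)], of E] unfolding E_simps .
  then show ?thesis unfolding normal_part_pair[OF vw] x(1) by (simp add: algebra_simps)
qed

text \<open>The second fundamental form in the chart. The second term is the Euclidean second fundamental
form of the round sphere, mapped by the chart.\<close>

definition II where
  "II v w = normal_part g S p (hess \<Phi> (y, t) (v, 0) (w, 0) - (v \<bullet> w / (y \<bullet> y)) *\<^sub>R E y)"

text \<open>The description in the definition of the second fundamental form applies to exactly one vector:
all admissible extensions give \<open>II w v\<close> by \<open>derivative_of_tangent_field\<close>, and one exists.\<close>

lemma second_fundamental_form_eq:
  assumes w: "w \<bullet> y = 0" and v: "v \<bullet> y = 0"
  shows "second_fundamental_form g S p (E w) (E v) = II w v"
proof -
  have *: "normal_part g S p (covariant_derivative g p (E w) Y) = II w v"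
    if "open V" "p \<in> V" "smooth_on V Y" "\<forall>z\<in>S \<inter> V. Y z \<in> tangent_space S z" "Y p = E v" for V Y
  proof -
    have "frechet_derivative Y (at p) (E w) - (D2 \<Phi> (y, t) (w, 0) (v, 0) - (w \<bullet> v / (y \<bullet> y)) *\<^sub>R E y) \<in> tangent_plane y t"
      by (rule derivative_of_tangent_field[OF y w that(1,2) smooth_on_has_derivative[OF that(3,2)] _ that(5) v])
        (use that(4) in blast)
    from normal_part_tangent[OF this]
    have "normal_part g S p (covariant_derivative g p (E w) Y -
        (hess \<Phi> (y, t) (w, 0) (v, 0) - (w \<bullet> v / (y \<bullet> y)) *\<^sub>R E y)) = 0"
      unfolding covariant_derivative_def hess_def that(5) by (simp add: algebra_simps)
    then show ?thesis unfolding II_def by (simp add: linear_diff[OF linear_normal_part])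
  qed
  obtain Y where Y: "smooth_on exterior Y" "Y p = E v" "\<forall>z\<in>S. Y z \<in> tangent_space S z"
    by (rule tangent_extension_exists[OF y v])
  show ?thesis
    unfolding second_fundamental_form_def
  proof (rule the_equality)
    show "\<exists>V Y. open V \<and> p \<in> V \<and> smooth_on V Y \<and> (\<forall>q\<in>S \<inter> V. Y q \<in> tangent_space S q) \<and>
      Y p = E v \<and> II w v = normal_part g S p (covariant_derivative g p (E w) Y)"
      using open_exterior p_ext Y(1,2) Y(3) *[OF open_exterior p_ext Y(1) _ Y(2)]
      by (intro exI[of _ exterior] exI[of _ Y]) auto
  qed (use * in blast)
qed

lemma II_bilinear: "bilinear II"
proof -
  note b = D2_bilinear[OF open_exterior q_ext smooth_chart(1)]
  note c = christoffel_bilinear[OF p_ext]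
  have pr: "(a + b, 0 :: real) = (a, 0) + (b, 0)" "(r *\<^sub>R a, 0 :: real) = r *\<^sub>R (a, 0)" for a b :: "real^3" and r
    by simp_all
  note lp = linear_add[OF linear_normal_part, symmetric] linear_cmul[OF linear_normal_part, symmetric]
  note bl = bilinear_ladd[OF b] bilinear_radd[OF b] bilinear_lmul[OF b] bilinear_rmul[OF b]
    bilinear_ladd[OF c] bilinear_radd[OF c] bilinear_lmul[OF c] bilinear_rmul[OF c]
    linear_add[OF linear_D[OF q_ext]] linear_cmul[OF linear_D[OF q_ext]]
  show ?thesis unfolding bilinear_def II_def hess_def
    by (intro conjI allI linearI; unfold lp; rule arg_cong[of _ _ "normal_part g S p"];
        simp only: pr bl inner_add_left inner_add_right inner_scaleR_left inner_scaleR_right; simp add: algebra_simps add_divide_distrib)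
qed

lemma II_sym: "II v w = II w v"
  unfolding II_def using hess_sym[OF open_exterior smooth_chart(1) q_ext p_ext, of "(v, 0)" "(w, 0)"] by (simp add: inner_commute)

lemma mean_curvature_vector_eq:
  assumes "orthonormal_pair v w"
  shows "mean_curvature_vector g S p = II v v + II w w"
  unfolding mean_curvature_vector_def tangent_plane[OF y]
proof (rule the_equality)
  note on = assms[unfolded orthonormal_pair_def]
  have "E v \<in> tangent_plane y t" "E w \<in> tangent_plane y t" unfolding tangent_plane_def using on by blast+
  then show "\<exists>x\<in>tangent_plane y t. \<exists>z\<in>tangent_plane y t. g p x x = 1 \<and> g p z z = 1 \<and> g p x z = 0 \<and>
      II v v + II w w = second_fundamental_form g S p x x + second_fundamental_form g S p z z"
    using on second_fundamental_form_eq by (intro bexI[of _ "E v"] bexI[of _ "E w"]) simp_all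
  fix H assume "\<exists>x\<in>tangent_plane y t. \<exists>z\<in>tangent_plane y t. g p x x = 1 \<and> g p z z = 1 \<and> g p x z = 0 \<and>
      H = second_fundamental_form g S p x x + second_fundamental_form g S p z z"
  then obtain a b where ab: "a \<bullet> y = 0" "b \<bullet> y = 0" "h a a = 1" "h b b = 1" "h a b = 0" and
    H: "H = second_fundamental_form g S p (E a) (E a) + second_fundamental_form g S p (E b) (E b)"
    unfolding tangent_plane_def by blast
  obtain a1 a2 where a: "a = a1 *\<^sub>R v + a2 *\<^sub>R w" using orthonormal_pair_spans[OF assms ab(1)] by blast
  obtain b1 b2 where b: "b = b1 *\<^sub>R v + b2 *\<^sub>R w" using orthonormal_pair_spans[OF assms ab(2)] by blast
  have wv: "h w v = 0" using on sym_g[OF p_ext, of "E w" "E v"] by simp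
  have eqs: "a1\<^sup>2 + a2\<^sup>2 = 1" "b1\<^sup>2 + b2\<^sup>2 = 1" "a1 * b1 + a2 * b2 = 0"
    using ab(3-5) on wv unfolding a b by (simp_all add: E_simps g_simps[OF p_ext] power2_eq_square mult.commute)
  have "H = II a a + II b b" unfolding H using ab(1,2) by (simp add: second_fundamental_form_eq)
  also have "\<dots> = II v v + II w w" unfolding a b by (rule trace_frame_invariant[OF II_bilinear II_sym eqs])
  finally show "H = II v v + II w w" .
qed

end

section \<open>Spherical coordinates and the metric in the chart\<close>

lemma spherical_axes:
  "spherical \<theta> \<phi> = (sin \<theta> * cos \<phi>) *\<^sub>R axis 1 1 + (sin \<theta> * sin \<phi>) *\<^sub>R axis 2 1 + cos \<theta> *\<^sub>R axis 3 1"
  unfolding spherical_def by (simp add: vec_eq_iff forall_3 axis_def)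

text \<open>The derivatives of \<open>spherical\<close> with respect to the two angles.\<close>

definition d_polar :: "real \<Rightarrow> real \<Rightarrow> real^3" where
  "d_polar \<theta> \<phi> = (cos \<theta> * cos \<phi>) *\<^sub>R axis 1 1 + (cos \<theta> * sin \<phi>) *\<^sub>R axis 2 1 - sin \<theta> *\<^sub>R axis 3 1"

definition d_azimuth :: "real \<Rightarrow> real \<Rightarrow> real^3" where
  "d_azimuth \<theta> \<phi> = (- sin \<theta> * sin \<phi>) *\<^sub>R axis 1 1 + (sin \<theta> * cos \<phi>) *\<^sub>R axis 2 1"

lemma spherical_frame:
  fixes \<theta> \<phi> :: real
  shows "spherical \<theta> \<phi> \<bullet> spherical \<theta> \<phi> = 1" "d_polar \<theta> \<phi> \<bullet> d_polar \<theta> \<phi> = 1"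
    "d_azimuth \<theta> \<phi> \<bullet> d_azimuth \<theta> \<phi> = (sin \<theta>)\<^sup>2"
    "spherical \<theta> \<phi> \<bullet> d_polar \<theta> \<phi> = 0" "spherical \<theta> \<phi> \<bullet> d_azimuth \<theta> \<phi> = 0" "d_polar \<theta> \<phi> \<bullet> d_azimuth \<theta> \<phi> = 0"
proof -
  have t: "sin \<theta> * sin \<theta> = 1 - cos \<theta> * cos \<theta>" "sin \<phi> * sin \<phi> = 1 - cos \<phi> * cos \<phi>"
    using sin_cos_squared_add[of \<theta>] sin_cos_squared_add[of \<phi>] by (simp_all add: power2_eq_square)
  note d = spherical_axes d_polar_def d_azimuth_def inner_vec_def sum_3 axis_def
  show "spherical \<theta> \<phi> \<bullet> spherical \<theta> \<phi> = 1" using t unfolding d by simp algebra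
  show "d_polar \<theta> \<phi> \<bullet> d_polar \<theta> \<phi> = 1" using t unfolding d by simp algebra
  show "d_azimuth \<theta> \<phi> \<bullet> d_azimuth \<theta> \<phi> = (sin \<theta>)\<^sup>2" using t unfolding d power2_eq_square by simp algebra
  show "spherical \<theta> \<phi> \<bullet> d_polar \<theta> \<phi> = 0" using t unfolding d by simp algebra
  show "spherical \<theta> \<phi> \<bullet> d_azimuth \<theta> \<phi> = 0" unfolding d by (simp add: algebra_simps)
  show "d_polar \<theta> \<phi> \<bullet> d_azimuth \<theta> \<phi> = 0" unfolding d by (simp add: algebra_simps)
qed

lemma spherical_frame_spans:
  assumes "sin \<theta> \<noteq> 0" "v \<bullet> spherical \<theta> \<phi> = 0"
  shows "v = (v \<bullet> d_polar \<theta> \<phi>) *\<^sub>R d_polar \<theta> \<phi> + (v \<bullet> d_azimuth \<theta> \<phi> / (sin \<theta>)\<^sup>2) *\<^sub>R d_azimuth \<theta> \<phi>"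
proof -
  define e where "e = (1 / sin \<theta>) *\<^sub>R d_azimuth \<theta> \<phi>"
  have e: "e = (- sin \<phi>) *\<^sub>R axis 1 1 + cos \<phi> *\<^sub>R axis 2 1"
    using assms(1) by (simp add: e_def d_azimuth_def scaleR_diff_right)
  have t: "sin \<theta> * sin \<theta> = 1 - cos \<theta> * cos \<theta>" "sin \<phi> * sin \<phi> = 1 - cos \<phi> * cos \<phi>"
    using sin_cos_squared_add[of \<theta>] sin_cos_squared_add[of \<phi>] by (simp_all add: power2_eq_square)
  have s: "v $ 1 * (sin \<theta> * cos \<phi>) + v $ 2 * (sin \<theta> * sin \<phi>) + v $ 3 * cos \<theta> = 0"
    using assms(2) unfolding spherical_axes inner_vec_def by (simp add: sum_3 axis_def)
  have "v = (v \<bullet> d_polar \<theta> \<phi>) *\<^sub>R d_polar \<theta> \<phi> + (v \<bullet> e) *\<^sub>R e"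
    unfolding vec_eq_iff forall_3 e d_polar_def inner_vec_def
    by (simp add: sum_3 axis_def, intro conjI; use s t in algebra)
  moreover have "(v \<bullet> e) *\<^sub>R e = (v \<bullet> d_azimuth \<theta> \<phi> / (sin \<theta>)\<^sup>2) *\<^sub>R d_azimuth \<theta> \<phi>"
    by (simp add: e_def power2_eq_square)
  ultimately show ?thesis by simp
qed

text \<open>The points not on the half-plane \<open>\<phi> = 0\<close>, which includes the axis; these are the points that
spherical coordinates reach.\<close>

definition off_meridian :: "event \<Rightarrow> bool" where
  "off_meridian q \<longleftrightarrow> fst q $ 2 \<noteq> 0 \<or> fst q $ 1 < 0"

text \<open>The azimuth is the argument of \<open>y\<^sub>1 + i y\<^sub>2\<close> with values between \<open>0\<close> and \<open>2 \<pi>\<close>; it is not \<open>0\<close> off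
the half-plane.\<close>

lemma spherical_coordinates_exist:
  assumes "1 < norm y" "off_meridian (y, t)"
  obtains r \<theta> \<phi> where "(t, r, \<theta>, \<phi>) \<in> coord_domain" "y = r *\<^sub>R spherical \<theta> \<phi>"
proof -
  define r where "r = norm y"
  have r: "1 < r" using assms by (simp add: r_def)
  have rr: "r * r = y $ 1 * y $ 1 + y $ 2 * y $ 2 + y $ 3 * y $ 3"
    unfolding r_def using dot_square_norm[of y] by (simp add: inner_vec_def sum_3 power2_eq_square)
  define z where "z = Complex (y $ 1) (y $ 2)"
  have z0: "z \<noteq> 0" and zR: "z \<notin> \<real>\<^sub>\<ge>\<^sub>0"
    using assms(2) by (auto simp: z_def off_meridian_def complex_nonneg_Reals_iff complex_eq_iff)
  have nz: "cmod z * cmod z = y $ 1 * y $ 1 + y $ 2 * y $ 2"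
    by (simp add: z_def cmod_def power2_eq_square)
  have y3: "\<bar>y $ 3 / r\<bar> < 1"
  proof -
    have "y $ 3 * y $ 3 < r * r" using rr nz z0 zero_less_mult_iff[of "cmod z" "cmod z"] by simp
    then have "\<bar>y $ 3\<bar> < r" using r by (intro power2_less_imp_less[of "\<bar>y $ 3\<bar>" r]) (simp_all add: power2_eq_square)
    then show ?thesis using r by simp
  qed
  define \<theta> where "\<theta> = arccos (y $ 3 / r)"
  define \<phi> where "\<phi> = Arg2pi z"
  have \<theta>: "0 < \<theta>" "\<theta> < pi" "cos \<theta> = y $ 3 / r"
  proof -
    have "-1 < y $ 3 / r" "y $ 3 / r < 1" using y3 unfolding abs_less_iff by linarith+
    then show "0 < \<theta>" "\<theta> < pi" "cos \<theta> = y $ 3 / r"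
      unfolding \<theta>_def using arccos_lt_bounded[of "y $ 3 / r"] cos_arccos[of "y $ 3 / r"] by linarith+
  qed
  have \<phi>: "0 < \<phi>" "\<phi> < 2 * pi"
    using Arg2pi_lt_2pi[of z] Arg2pi_ge_0[of z] zR Arg2pi_eq_0[of z] z0
    by (auto simp: \<phi>_def less_le complex_nonneg_Reals_iff complex_is_Real_iff)
  have ze: "z = of_real (cmod z) * exp (\<i> * of_real \<phi>)" unfolding \<phi>_def by (rule Arg2pi_eq)
  have sin: "r * sin \<theta> = cmod z"
  proof (rule power2_eq_imp_eq)
    have "(r * sin \<theta>)\<^sup>2 = r * r * (1 - (cos \<theta>)\<^sup>2)"
      unfolding power_mult_distrib sin_squared_eq by (simp add: power2_eq_square)
    also have "\<dots> = r * r - y $ 3 * y $ 3" using r unfolding \<theta>(3) by (simp add: field_simps power2_eq_square)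
    finally show "(r * sin \<theta>)\<^sup>2 = (cmod z)\<^sup>2" using rr nz by (simp add: power2_eq_square)
    show "0 \<le> r * sin \<theta>" using r \<theta> by (simp add: sin_ge_zero)
  qed simp
  have y12: "y $ 1 = cmod z * cos \<phi>" "y $ 2 = cmod z * sin \<phi>"
    using arg_cong[OF ze, of Re] arg_cong[OF ze, of Im] by (simp_all add: z_def Re_exp Im_exp)
  have "y = r *\<^sub>R spherical \<theta> \<phi>"
    unfolding vec_eq_iff forall_3 spherical_axes y12 sin[symmetric] using \<theta>(3) r by (simp add: axis_def y12 sin[symmetric])
  moreover have "(t, r, \<theta>, \<phi>) \<in> coord_domain" using r \<theta> \<phi> by (simp add: coord_domain_def)
  ultimately show ?thesis by (rule that[rotated])
qed

text \<open>A point of the half-plane is the limit of points moved in the second coordinate direction. Such a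
shift is orthogonal to the half-plane, so it does not leave the exterior.\<close>

lemma vanishes_by_density:
  fixes F :: "event \<Rightarrow> real"
  assumes cont: "\<And>q. q \<in> exterior \<Longrightarrow> isCont F q"
    and zero: "\<And>q. q \<in> exterior \<Longrightarrow> off_meridian q \<Longrightarrow> F q = 0"
    and q: "(y, t) \<in> exterior"
  shows "F (y, t) = 0"
proof (cases "off_meridian (y, t)")
  case False
  then have y2: "y $ 2 = 0" by (simp add: off_meridian_def)
  define X where "X = (\<lambda>n::nat. (y + inverse (real (Suc n)) *\<^sub>R axis 2 1, t))"
  have "X \<longlonglongrightarrow> (y + 0 *\<^sub>R axis 2 1, t)" unfolding X_def
    by (intro tendsto_Pair tendsto_add tendsto_scaleR tendsto_const LIMSEQ_inverse_real_of_nat)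
  then have "(\<lambda>n. F (X n)) \<longlonglongrightarrow> F (y, t)" using isCont_tendsto_compose[OF cont[OF q]] by simp
  moreover have "F (X n) = 0" for n
  proof (rule zero)
    let ?e = "inverse (real (Suc n))"
    have "norm y \<le> norm (y + ?e *\<^sub>R axis 2 1)"
    proof (rule power2_le_imp_le)
      have "(norm (y + ?e *\<^sub>R axis 2 1))\<^sup>2 = (norm y)\<^sup>2 + ?e * ?e"
        unfolding power2_norm_eq_inner by (simp add: inner_add_left inner_add_right inner_axis inner_axis' y2)
      then show "(norm y)\<^sup>2 \<le> (norm (y + ?e *\<^sub>R axis 2 1))\<^sup>2" by simp
    qed simp
    then show "X n \<in> exterior" using q by (simp add: X_def exterior_iff)
    show "off_meridian (X n)" using y2 by (simp add: X_def off_meridian_def axis_def)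
  qed
  ultimately show ?thesis using LIMSEQ_unique[of "\<lambda>n. F (X n)" "F (y, t)" 0] by simp
qed (use zero q in blast)

context exterior_chart begin

definition chart_metric where "chart_metric q v w = g (\<Phi> q) (D q v) (D q w)"

lemma chart_metric_bilinear: "q \<in> exterior \<Longrightarrow> bilinear (chart_metric q)"
  unfolding chart_metric_def bilinear_def
  by (intro conjI allI linearI) (simp_all add: linear_add[OF linear_D] linear_cmul[OF linear_D] g_simps[OF chart_in(1)])

lemma chart_metric_sym: "q \<in> exterior \<Longrightarrow> chart_metric q v w = chart_metric q w v"
  unfolding chart_metric_def by (rule sym_g[OF chart_in(1)])

definition d_chart_metric where
  "d_chart_metric q u v w = frechet_derivative (\<lambda>x. chart_metric x v w) (at q) u"

lemma d_chart_metric: "q \<in> exterior \<Longrightarrow> ((\<lambda>x. chart_metric x v w) has_derivative (\<lambda>u. d_chart_metric q u v w)) (at q)"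
  using pullback_derivative[OF open_exterior smooth_chart(1) _ chart_in(1), of q v w]
  unfolding chart_metric_def d_chart_metric_def by (simp add: frechet_derivative_eqI)

lemma chart_metric_field_derivative:
  assumes "q \<in> exterior" "(A has_derivative A') (at q)" "(B has_derivative B') (at q)"
  shows "((\<lambda>x. chart_metric x (A x) (B x)) has_derivative
     (\<lambda>u. d_chart_metric q u (A q) (B q) + chart_metric q (A' u) (B q) + chart_metric q (A q) (B' u))) (at q)"
  by (rule bilinear_family_derivative[where T = exterior and \<phi> = "\<lambda>x. x" and B = chart_metric and V = A and W = B,
      OF open_exterior assms(1) chart_metric_bilinear d_chart_metric[OF assms(1)] has_derivative_ident assms(2,3)])

text \<open>The coordinate map is the chart after polar coordinates, so the coordinate fields are the images of
the radial vector and of the two angular vectors scaled by \<open>r\<close>.\<close>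

lemma coord_map_derivative:
  assumes "(t, r, \<theta>, \<phi>) \<in> coord_domain"
  shows "(r *\<^sub>R spherical \<theta> \<phi>, t) \<in> exterior"
    "coord_map \<Phi> (t, r, \<theta>, \<phi>) = \<Phi> (r *\<^sub>R spherical \<theta> \<phi>, t)"
    "frechet_derivative (coord_map \<Phi>) (at (t, r, \<theta>, \<phi>)) (dt, dr, d\<theta>, d\<phi>) =
      D (r *\<^sub>R spherical \<theta> \<phi>, t) (dr *\<^sub>R spherical \<theta> \<phi> + r *\<^sub>R (d\<theta> *\<^sub>R d_polar \<theta> \<phi> + d\<phi> *\<^sub>R d_azimuth \<theta> \<phi>), dt)"
proof -
  have r: "1 < r" using assms by (simp add: coord_domain_def)
  have "norm (spherical \<theta> \<phi>) = 1" using spherical_frame(1)[of \<theta> \<phi>] by (simp add: norm_eq_sqrt_inner)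
  then show ext: "(r *\<^sub>R spherical \<theta> \<phi>, t) \<in> exterior" using r by (simp add: exterior_iff)
  show "coord_map \<Phi> (t, r, \<theta>, \<phi>) = \<Phi> (r *\<^sub>R spherical \<theta> \<phi>, t)" by (simp add: coord_map_def chart_point_def)
  define P :: "coords \<Rightarrow> event" where
    "P = (\<lambda>q. (fst (snd q) *\<^sub>R spherical (fst (snd (snd q))) (snd (snd (snd q))), fst q))"
  have P: "(P has_derivative (\<lambda>u. (fst (snd u) *\<^sub>R spherical \<theta> \<phi> +
      r *\<^sub>R (fst (snd (snd u)) *\<^sub>R d_polar \<theta> \<phi> + snd (snd (snd u)) *\<^sub>R d_azimuth \<theta> \<phi>), fst u))) (at (t, r, \<theta>, \<phi>))"
    unfolding P_def spherical_axes
    by (rule has_derivative_eq_rhs, (rule derivative_intros | rule has_derivative_sin has_derivative_cos)+)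
      (auto simp: fun_eq_iff d_polar_def d_azimuth_def algebra_simps)
  have "coord_map \<Phi> = (\<lambda>q. \<Phi> (P q))" by (auto simp: coord_map_def chart_point_def P_def)
  then have "(coord_map \<Phi> has_derivative (\<lambda>u. D (r *\<^sub>R spherical \<theta> \<phi>, t) (fst (snd u) *\<^sub>R spherical \<theta> \<phi> +
      r *\<^sub>R (fst (snd (snd u)) *\<^sub>R d_polar \<theta> \<phi> + snd (snd (snd u)) *\<^sub>R d_azimuth \<theta> \<phi>), fst u))) (at (t, r, \<theta>, \<phi>))"
    using has_derivative_compose[OF P, of \<Phi> "D (r *\<^sub>R spherical \<theta> \<phi>, t)"] chart_has_derivative[OF ext] by (simp add: P_def)
  from frechet_derivative_eqI[OF this]
  show "frechet_derivative (coord_map \<Phi>) (at (t, r, \<theta>, \<phi>)) (dt, dr, d\<theta>, d\<phi>) =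
      D (r *\<^sub>R spherical \<theta> \<phi>, t) (dr *\<^sub>R spherical \<theta> \<phi> + r *\<^sub>R (d\<theta> *\<^sub>R d_polar \<theta> \<phi> + d\<phi> *\<^sub>R d_azimuth \<theta> \<phi>), dt)"
    by simp
qed

lemma metric_coeff_chart_metric:
  assumes "(t, r, \<theta>, \<phi>) \<in> coord_domain"
  defines "q \<equiv> (r *\<^sub>R spherical \<theta> \<phi>, t)"
  shows "metric_coeff g \<Phi> (0, 1, 0, 0) (0, 0, 1, 0) (t, r, \<theta>, \<phi>) = chart_metric q (spherical \<theta> \<phi>, 0) (r *\<^sub>R d_polar \<theta> \<phi>, 0)"
    "metric_coeff g \<Phi> (0, 1, 0, 0) (0, 0, 0, 1) (t, r, \<theta>, \<phi>) = chart_metric q (spherical \<theta> \<phi>, 0) (r *\<^sub>R d_azimuth \<theta> \<phi>, 0)"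
    "metric_coeff g \<Phi> (0, 0, 1, 0) (0, 0, 1, 0) (t, r, \<theta>, \<phi>) = chart_metric q (r *\<^sub>R d_polar \<theta> \<phi>, 0) (r *\<^sub>R d_polar \<theta> \<phi>, 0)"
    "metric_coeff g \<Phi> (0, 0, 1, 0) (0, 0, 0, 1) (t, r, \<theta>, \<phi>) = chart_metric q (r *\<^sub>R d_polar \<theta> \<phi>, 0) (r *\<^sub>R d_azimuth \<theta> \<phi>, 0)"
    "metric_coeff g \<Phi> (0, 0, 0, 1) (0, 0, 0, 1) (t, r, \<theta>, \<phi>) = chart_metric q (r *\<^sub>R d_azimuth \<theta> \<phi>, 0) (r *\<^sub>R d_azimuth \<theta> \<phi>, 0)"
  unfolding metric_coeff_def coord_map_derivative(2,3)[OF assms(1)] chart_metric_def q_def by simp_all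

end

locale imcvf_exterior = exterior_chart +
  assumes imcvf: "imcvf_chart g \<Phi>"
begin

lemma spacelike_slice:
  assumes "1 < norm y" "v \<noteq> 0"
  shows "0 < chart_metric (y, t) (v, 0) (v, 0)"
proof -
  have q: "(y, t) \<in> exterior" using assms by (simp add: exterior_iff)
  have "spacelike g (time_slice \<Phi> t)" using imcvf unfolding imcvf_chart_def by blast
  moreover have "\<Phi> (y, t) \<in> time_slice \<Phi> t" using assms unfolding time_slice_eq by auto
  moreover have "D (y, t) (v, 0) \<in> tangent_space (time_slice \<Phi> t) (\<Phi> (y, t))"
    unfolding tangent_space_time_slice[OF assms(1)] by blast
  moreover have "D (y, t) (v, 0) \<noteq> 0" using assms(2) D_eq_0[OF q, of "(v, 0)"] by (simp add: zero_prod_def)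
  ultimately show ?thesis unfolding spacelike_def chart_metric_def by blast
qed

text \<open>The vectors orthogonal to \<open>y\<close> are spanned by the two angular vectors, to which the chart conditions
on the metric coefficients apply.\<close>

lemma radial_orthogonal_off_meridian:
  assumes "1 < norm y" "off_meridian (y, t)" "v \<bullet> y = 0"
  shows "chart_metric (y, t) (y, 0) (v, 0) = 0"
proof -
  obtain r \<theta> \<phi> where c: "(t, r, \<theta>, \<phi>) \<in> coord_domain" "y = r *\<^sub>R spherical \<theta> \<phi>"
    by (rule spherical_coordinates_exist[OF assms(1,2)])
  let ?q = "(y, t)"
  have q: "?q \<in> exterior" using assms(1) by (simp add: exterior_iff)
  have r: "1 < r" "sin \<theta> \<noteq> 0" using c(1) sin_gt_zero[of \<theta>] by (auto simp: coord_domain_def)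
  have "metric_coeff g \<Phi> (0, 1, 0, 0) (0, 0, 1, 0) (t, r, \<theta>, \<phi>) = 0 \<and> metric_coeff g \<Phi> (0, 1, 0, 0) (0, 0, 0, 1) (t, r, \<theta>, \<phi>) = 0"
    using imcvf c(1) unfolding imcvf_chart_def Let_def by blast
  then have z: "chart_metric ?q (spherical \<theta> \<phi>, 0) (r *\<^sub>R d_polar \<theta> \<phi>, 0) = 0" "chart_metric ?q (spherical \<theta> \<phi>, 0) (r *\<^sub>R d_azimuth \<theta> \<phi>, 0) = 0"
    unfolding metric_coeff_chart_metric[OF c(1)] c(2) by blast+
  have "v \<bullet> spherical \<theta> \<phi> = 0" using assms(3) r unfolding c(2) by simp
  from spherical_frame_spans[OF r(2) this] obtain \<alpha> \<beta> where "v = \<alpha> *\<^sub>R d_polar \<theta> \<phi> + \<beta> *\<^sub>R d_azimuth \<theta> \<phi>" by blast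
  then have v: "(v, 0::real) = (\<alpha> / r) *\<^sub>R (r *\<^sub>R d_polar \<theta> \<phi>, 0) + (\<beta> / r) *\<^sub>R (r *\<^sub>R d_azimuth \<theta> \<phi>, 0)" using r by simp
  have yy: "(y, 0::real) = r *\<^sub>R (spherical \<theta> \<phi>, 0)" by (simp add: c(2))
  show ?thesis unfolding v yy
    by (simp only: bilinear_radd[OF chart_metric_bilinear[OF q]] bilinear_rmul[OF chart_metric_bilinear[OF q]] bilinear_lmul[OF chart_metric_bilinear[OF q]] z) simp
qed

text \<open>Under a change of basis of the plane orthogonal to \<open>y\<close>, the Gram determinants of \<open>h\<close> and of the
Euclidean metric are multiplied by the same factor, and for the angular vectors they agree by the
area condition. Note that the square root of a negative real number is negative here, so that the
positivity of \<open>r\<^sup>2 sin \<theta>\<close> is needed to remove it.\<close>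

lemma area_off_meridian:
  assumes "1 < norm y" "off_meridian (y, t)" "v \<bullet> y = 0" "w \<bullet> y = 0"
  shows "chart_metric (y, t) (v, 0) (v, 0) * chart_metric (y, t) (w, 0) (w, 0) - (chart_metric (y, t) (v, 0) (w, 0))\<^sup>2 = (v \<bullet> v) * (w \<bullet> w) - (v \<bullet> w)\<^sup>2"
proof -
  obtain r \<theta> \<phi> where c: "(t, r, \<theta>, \<phi>) \<in> coord_domain" "y = r *\<^sub>R spherical \<theta> \<phi>"
    by (rule spherical_coordinates_exist[OF assms(1,2)])
  let ?q = "(y, t)"
  have q: "?q \<in> exterior" using assms(1) by (simp add: exterior_iff)
  have r: "1 < r" "0 < sin \<theta>" using c(1) sin_gt_zero[of \<theta>] by (auto simp: coord_domain_def)
  define x where "x = (d_polar \<theta> \<phi>, 0::real)"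
  define z where "z = (d_azimuth \<theta> \<phi>, 0::real)"
  let ?h = "chart_metric ?q"
  note b = bilinear_ladd[OF chart_metric_bilinear[OF q]] bilinear_radd[OF chart_metric_bilinear[OF q]]
    bilinear_rmul[OF chart_metric_bilinear[OF q]] bilinear_lmul[OF chart_metric_bilinear[OF q]]
  obtain A B C where "metric_coeff g \<Phi> (0, 0, 1, 0) (0, 0, 1, 0) (t, r, \<theta>, \<phi>) = A"
    "metric_coeff g \<Phi> (0, 0, 1, 0) (0, 0, 0, 1) (t, r, \<theta>, \<phi>) = C"
    "metric_coeff g \<Phi> (0, 0, 0, 1) (0, 0, 0, 1) (t, r, \<theta>, \<phi>) = B"
    and ABC: "sqrt (A * B - C\<^sup>2) = r\<^sup>2 * sin \<theta>"
  proof -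
    obtain a b c' :: "coords \<Rightarrow> real" where
      *: "\<forall>q\<in>coord_domain. metric_coeff g \<Phi> (0, 0, 1, 0) (0, 0, 1, 0) q = a q \<and>
        metric_coeff g \<Phi> (0, 0, 1, 0) (0, 0, 0, 1) q = c' q \<and> metric_coeff g \<Phi> (0, 0, 0, 1) (0, 0, 0, 1) q = b q"
      "\<forall>(t, r, \<theta>, \<phi>)\<in>coord_domain. sqrt (a (t, r, \<theta>, \<phi>) * b (t, r, \<theta>, \<phi>) - (c' (t, r, \<theta>, \<phi>))\<^sup>2) = r\<^sup>2 * sin \<theta>"
      using imcvf unfolding imcvf_chart_def Let_def by blast
    show ?thesis using *(1)[rule_format, OF c(1)] bspec[OF *(2) c(1)] by (intro that) auto
  qed
  moreover have "(r *\<^sub>R d_polar \<theta> \<phi>, 0::real) = r *\<^sub>R x" "(r *\<^sub>R d_azimuth \<theta> \<phi>, 0::real) = r *\<^sub>R z"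
    by (simp_all add: x_def z_def)
  ultimately have abc: "A = r\<^sup>2 * ?h x x" "B = r\<^sup>2 * ?h z z" "C = r\<^sup>2 * ?h x z"
    unfolding metric_coeff_chart_metric[OF c(1)] c(2)[symmetric] by (simp_all add: b(3,4) power2_eq_square)
  have "A * B - C\<^sup>2 = (r\<^sup>2 * sin \<theta>)\<^sup>2"
  proof -
    have "0 < r\<^sup>2 * sin \<theta>" using r by simp
    then have "0 < A * B - C\<^sup>2" using ABC by (metis real_sqrt_gt_0_iff)
    then show ?thesis using ABC by (metis less_imp_le real_sqrt_pow2)
  qed
  then have "(r\<^sup>2)\<^sup>2 * (?h x x * ?h z z - (?h x z)\<^sup>2) = (r\<^sup>2)\<^sup>2 * (sin \<theta>)\<^sup>2"
    unfolding abc by (simp add: power_mult_distrib power2_eq_square algebra_simps)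
  then have det: "?h x x * ?h z z - (?h x z)\<^sup>2 = (sin \<theta>)\<^sup>2" using r by simp
  have zx: "?h z x = ?h x z" by (rule chart_metric_sym[OF q])
  have "v \<bullet> spherical \<theta> \<phi> = 0" "w \<bullet> spherical \<theta> \<phi> = 0" using assms(3,4) r unfolding c(2) by simp_all
  from this[THEN spherical_frame_spans[rotated]] r(2) obtain \<alpha> \<beta> \<gamma> \<delta> where
    v: "v = \<alpha> *\<^sub>R d_polar \<theta> \<phi> + \<beta> *\<^sub>R d_azimuth \<theta> \<phi>" and w: "w = \<gamma> *\<^sub>R d_polar \<theta> \<phi> + \<delta> *\<^sub>R d_azimuth \<theta> \<phi>"
    by (metis less_irrefl)
  have v': "(v, 0::real) = \<alpha> *\<^sub>R x + \<beta> *\<^sub>R z" and w': "(w, 0::real) = \<gamma> *\<^sub>R x + \<delta> *\<^sub>R z" by (simp_all add: v w x_def z_def)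
  have "?h (v, 0) (v, 0) * ?h (w, 0) (w, 0) - (?h (v, 0) (w, 0))\<^sup>2 = (\<alpha> * \<delta> - \<beta> * \<gamma>)\<^sup>2 * (?h x x * ?h z z - (?h x z)\<^sup>2)"
    unfolding v' w' by (simp add: b zx power2_eq_square algebra_simps)
  also have "\<dots> = (v \<bullet> v) * (w \<bullet> w) - (v \<bullet> w)\<^sup>2"
    unfolding det v w using spherical_frame(2,3,6)[of \<theta> \<phi>]
    by (simp add: inner_add_left inner_add_right inner_commute[of "d_azimuth \<theta> \<phi>" "d_polar \<theta> \<phi>"] power2_eq_square algebra_simps)
  finally show ?thesis .
qed

lemma cross_field: "((\<lambda>q::event. (cross3 a (fst q), 0::real)) has_derivative (\<lambda>u. (cross3 a (fst u), 0))) (at q)"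
  and radial_field: "((\<lambda>q::event. (fst q, 0::real)) has_derivative (\<lambda>u. (fst u, 0))) (at q)"
proof -
  have "linear (\<lambda>q::event. (cross3 a (fst q), 0::real))"
    by (rule linearI) (simp_all add: cross_add_right cross_mult_right)
  then show "((\<lambda>q::event. (cross3 a (fst q), 0::real)) has_derivative (\<lambda>u. (cross3 a (fst u), 0))) (at q)"
    by (rule linear_imp_has_derivative)
  have "linear (\<lambda>q::event. (fst q, 0::real))" by (rule linearI) simp_all
  then show "((\<lambda>q::event. (fst q, 0::real)) has_derivative (\<lambda>u. (fst u, 0))) (at q)"
    by (rule linear_imp_has_derivative)
qed

lemma isCont_chart_metric:
  assumes "q \<in> exterior" "(A has_derivative A') (at q)" "(B has_derivative B') (at q)"
  shows "isCont (\<lambda>x. chart_metric x (A x) (B x)) q"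
  by (rule has_derivative_continuous[OF chart_metric_field_derivative[OF assms]])

text \<open>As vectors orthogonal to \<open>y\<close> depend on \<open>y\<close>, they are written as values of rotation fields before
passing to the limit.\<close>

lemma radial_orthogonal:
  assumes "1 < norm y" "v \<bullet> y = 0"
  shows "chart_metric (y, t) (y, 0) (v, 0) = 0"
proof -
  have y0: "y \<noteq> 0" using assms by auto
  define a where "a = (1 / (y \<bullet> y)) *\<^sub>R cross3 y v"
  have av: "cross3 a y = v" unfolding a_def by (rule cross_representation[OF y0 assms(2)])
  have "chart_metric (y, t) (fst (y, t), 0) (cross3 a (fst (y, t)), 0) = 0"
  proof (rule vanishes_by_density[where F = "\<lambda>q. chart_metric q (fst q, 0) (cross3 a (fst q), 0)"])
    show "isCont (\<lambda>q. chart_metric q (fst q, 0) (cross3 a (fst q), 0)) q" if "q \<in> exterior" for q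
      by (rule isCont_chart_metric[OF that radial_field cross_field])
    show "chart_metric q (fst q, 0) (cross3 a (fst q), 0) = 0" if "q \<in> exterior" "off_meridian q" for q
      using radial_orthogonal_off_meridian[of "fst q" "snd q" "cross3 a (fst q)"] that
      by (simp add: exterior_iff dot_cross_self inner_commute)
  qed (use assms in \<open>simp add: exterior_iff\<close>)
  then show ?thesis by (simp add: av)
qed

lemma area_element:
  assumes "1 < norm y" "v \<bullet> y = 0" "w \<bullet> y = 0"
  shows "chart_metric (y, t) (v, 0) (v, 0) * chart_metric (y, t) (w, 0) (w, 0) - (chart_metric (y, t) (v, 0) (w, 0))\<^sup>2 = (v \<bullet> v) * (w \<bullet> w) - (v \<bullet> w)\<^sup>2"
proof -
  have y0: "y \<noteq> 0" using assms by auto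
  define a where "a = (1 / (y \<bullet> y)) *\<^sub>R cross3 y v"
  have av: "cross3 a y = v" unfolding a_def by (rule cross_representation[OF y0 assms(2)])
  define b where "b = (1 / (y \<bullet> y)) *\<^sub>R cross3 y w"
  have bw: "cross3 b y = w" unfolding b_def by (rule cross_representation[OF y0 assms(3)])
  define A where "A = (\<lambda>q::event. cross3 a (fst q))"
  define B where "B = (\<lambda>q::event. cross3 b (fst q))"
  have dA: "((\<lambda>q. (A q, 0::real)) has_derivative (\<lambda>u. (A u, 0))) (at q)"
    and dB: "((\<lambda>q. (B q, 0::real)) has_derivative (\<lambda>u. (B u, 0))) (at q)" for q
    unfolding A_def B_def by (rule cross_field)+
  define F where "F = (\<lambda>q. chart_metric q (A q, 0) (A q, 0) * chart_metric q (B q, 0) (B q, 0) - (chart_metric q (A q, 0) (B q, 0))\<^sup>2 - ((A q \<bullet> A q) * (B q \<bullet> B q) - (A q \<bullet> B q)\<^sup>2))"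
  have "F (y, t) = 0"
  proof (rule vanishes_by_density)
    show "isCont F q" if q: "q \<in> exterior" for q
    proof -
      have "isCont A q" "isCont B q"
        using has_derivative_continuous[OF has_derivative_fst[OF dA[of q]]] has_derivative_continuous[OF has_derivative_fst[OF dB[of q]]]
        by simp_all
      then show ?thesis unfolding F_def
        by (intro isCont_diff isCont_mult isCont_power isCont_chart_metric[OF q dA dB] isCont_chart_metric[OF q dA dA] isCont_chart_metric[OF q dB dB] continuous_inner)
    qed
    show "F q = 0" if "q \<in> exterior" "off_meridian q" for q
      using area_off_meridian[of "fst q" "snd q" "A q" "B q"] that
      by (simp add: F_def A_def B_def exterior_iff dot_cross_self inner_commute)
  qed (use assms in \<open>simp add: exterior_iff\<close>)
  then show ?thesis by (simp add: F_def A_def B_def av bw)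
qed

end

section \<open>The flow by inverse mean curvature vectors\<close>

context imcvf_exterior begin

lemma spacelike_sphere:
  assumes "1 < norm y"
  shows "spacelike_sphere g \<Phi> y t"
  by unfold_locales (use assms spacelike_slice[OF assms, of _ t] in \<open>simp_all add: chart_metric_def\<close>)

text \<open>Differentiate the orthogonality of the radial field and a rotation field \<open>z \<mapsto> a \<times> z\<close> with
\<open>a \<times> y = v\<close>, in direction \<open>v\<close>; here \<open>a \<times> v\<close> is the multiple of \<open>y\<close> with factor \<open>- |v|\<^sup>2 / |y|\<^sup>2\<close>.\<close>

lemma radial_derivative:
  assumes "1 < norm y" "v \<bullet> y = 0"
  shows "d_chart_metric (y, t) (v, 0) (v, 0) (y, 0) = (v \<bullet> v / (y \<bullet> y)) * chart_metric (y, t) (y, 0) (y, 0) - chart_metric (y, t) (v, 0) (v, 0)"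
proof -
  have y0: "y \<noteq> 0" using assms by auto
  have q: "(y, t) \<in> exterior" using assms by (simp add: exterior_iff)
  define a where "a = (1 / (y \<bullet> y)) *\<^sub>R cross3 y v"
  have av: "cross3 a y = v" unfolding a_def by (rule cross_representation[OF y0 assms(2)])
  have avv: "(cross3 a v, 0::real) = (- (v \<bullet> v / (y \<bullet> y))) *\<^sub>R (y, 0)"
    unfolding a_def cross_mult_left cross_skew[of "cross3 y v" v] Lagrange using assms(2) by simp
  have "((\<lambda>q. chart_metric q (cross3 a (fst q), 0) (fst q, 0)) has_derivative
    (\<lambda>u. d_chart_metric (y, t) u (v, 0) (y, 0) + chart_metric (y, t) (cross3 a (fst u), 0) (y, 0) + chart_metric (y, t) (v, 0) (fst u, 0))) (at (y, t))"
    using chart_metric_field_derivative[OF q cross_field[of a] radial_field] by (simp add: av)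
  moreover have "((\<lambda>q. 0) has_derivative (\<lambda>u. 0)) (at (y, t))" by simp
  moreover have "chart_metric q (cross3 a (fst q), 0) (fst q, 0) = 0" if "q \<in> exterior" for q
    using radial_orthogonal[of "fst q" "cross3 a (fst q)" "snd q"] chart_metric_sym[OF that] that
    by (simp add: exterior_iff dot_cross_self inner_commute)
  ultimately have "(\<lambda>u. d_chart_metric (y, t) u (v, 0) (y, 0) + chart_metric (y, t) (cross3 a (fst u), 0) (y, 0) + chart_metric (y, t) (v, 0) (fst u, 0)) = (\<lambda>u. 0)"
    by (intro has_derivative_unique_on_open[OF _ _ open_exterior q])
  from fun_cong[OF this, of "(v, 0)"]
  have "d_chart_metric (y, t) (v, 0) (v, 0) (y, 0) + chart_metric (y, t) (cross3 a v, 0) (y, 0) + chart_metric (y, t) (v, 0) (v, 0) = 0" by simp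
  then show ?thesis unfolding avv bilinear_lmul[OF chart_metric_bilinear[OF q]] by simp
qed

text \<open>Along the ray through \<open>y\<close> the vectors \<open>v\<close> and \<open>w\<close> stay tangent to the spheres, so their Gram
determinant is constant by \<open>area_element\<close>. At an orthonormal pair the derivative of the determinant is
the trace of the derivative of the metric.\<close>

lemma area_derivative:
  assumes "1 < norm y" "v \<bullet> y = 0" "w \<bullet> y = 0"
    and "chart_metric (y, t) (v, 0) (v, 0) = 1" "chart_metric (y, t) (w, 0) (w, 0) = 1" "chart_metric (y, t) (v, 0) (w, 0) = 0"
  shows "d_chart_metric (y, t) (y, 0) (v, 0) (v, 0) + d_chart_metric (y, t) (y, 0) (w, 0) (w, 0) = 0"
proof -
  have q: "(y, t) \<in> exterior" using assms by (simp add: exterior_iff)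
  define \<gamma> where "\<gamma> = (\<lambda>s::real. ((1 + s) *\<^sub>R y, t))"
  have \<gamma>: "(\<gamma> has_derivative (\<lambda>s. s *\<^sub>R (y, 0))) (at 0)"
    unfolding \<gamma>_def by (auto intro!: derivative_eq_intros simp: fun_eq_iff)
  have d: "((\<lambda>s. chart_metric (\<gamma> s) a b) has_derivative (\<lambda>s. s * d_chart_metric (y, t) (y, 0) a b)) (at 0)" for a b
  proof -
    have "((\<lambda>x. chart_metric x a b) has_derivative (\<lambda>u. d_chart_metric (y, t) u a b)) (at (\<gamma> 0))" using d_chart_metric[OF q] by (simp add: \<gamma>_def)
    from has_derivative_compose[OF \<gamma> this] show ?thesis
      by (rule has_derivative_eq_rhs) (simp only: linear_cmul[OF has_derivative_linear[OF d_chart_metric[OF q]]] real_scaleR_def)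
  qed
  have g0: "\<gamma> 0 = (y, t)" by (simp add: \<gamma>_def)
  have dF: "((\<lambda>s. chart_metric (\<gamma> s) (v, 0) (v, 0) * chart_metric (\<gamma> s) (w, 0) (w, 0) - chart_metric (\<gamma> s) (v, 0) (w, 0) * chart_metric (\<gamma> s) (v, 0) (w, 0)) has_derivative
     (\<lambda>s. (1 * (s * d_chart_metric (y, t) (y, 0) (w, 0) (w, 0)) + (s * d_chart_metric (y, t) (y, 0) (v, 0) (v, 0)) * 1) -
       (0 * (s * d_chart_metric (y, t) (y, 0) (v, 0) (w, 0)) + (s * d_chart_metric (y, t) (y, 0) (v, 0) (w, 0)) * 0))) (at 0)"
    using has_derivative_diff[OF has_derivative_mult[OF d d] has_derivative_mult[OF d d], of "(v, 0)" "(v, 0)" "(w, 0)" "(w, 0)" "(v, 0)" "(w, 0)" "(v, 0)" "(w, 0)"]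
    unfolding g0 assms(4-6) .
  have dC: "((\<lambda>s::real. (v \<bullet> v) * (w \<bullet> w) - (v \<bullet> w)\<^sup>2) has_derivative (\<lambda>s. 0)) (at 0)" by simp
  \<comment> \<open>the ray \<open>(1 + s) y\<close> is in the exterior for \<open>s > 1 / |y| - 1\<close>\<close>
  have lt: "1 / norm y < 1"
  proof -
    have "0 < norm y" using assms(1) by linarith
    then show ?thesis using assms(1) by (simp only: divide_less_eq_1_pos)
  qed
  have in0: "0 \<in> {1 / norm y - 1<..}" unfolding greaterThan_iff using lt by linarith
  have eq: "chart_metric (\<gamma> s) (v, 0) (v, 0) * chart_metric (\<gamma> s) (w, 0) (w, 0) - chart_metric (\<gamma> s) (v, 0) (w, 0) * chart_metric (\<gamma> s) (v, 0) (w, 0) = (v \<bullet> v) * (w \<bullet> w) - (v \<bullet> w)\<^sup>2"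
    if "s \<in> {1 / norm y - 1<..}" for s
  proof -
    have s: "1 < (1 + s) * norm y" using that assms(1) by (simp add: divide_less_eq algebra_simps split: if_splits)
    then have "0 < (1 + s) * norm y" by linarith
    then have "0 < 1 + s" by (simp add: zero_less_mult_iff)
    then have "1 < norm ((1 + s) *\<^sub>R y)" using s by simp
    from area_element[OF this, of v w t] assms(2,3) show ?thesis unfolding \<gamma>_def by (simp add: power2_eq_square)
  qed
  have "(\<lambda>s. (1 * (s * d_chart_metric (y, t) (y, 0) (w, 0) (w, 0)) + (s * d_chart_metric (y, t) (y, 0) (v, 0) (v, 0)) * 1) -
       (0 * (s * d_chart_metric (y, t) (y, 0) (v, 0) (w, 0)) + (s * d_chart_metric (y, t) (y, 0) (v, 0) (w, 0)) * 0)) = (\<lambda>s. 0)"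
    by (rule has_derivative_unique_on_open[OF dF dC open_greaterThan in0 eq])
  from fun_cong[OF this, of 1] show ?thesis by simp
qed

text \<open>The inverse mean curvature vector is half the image of the position vector. The Koszul formula
and the two derivative lemmas give \<open>\<langle>H, y\<rangle> = - 2\<close>, and the position of \<open>H\<close> (normal to the sphere,
tangent to the slice) makes it a multiple \<open>k y\<close>, so that \<open>k \<langle>y, y\<rangle> = - 2\<close>.\<close>

lemma inverse_mean_curvature_vector_chart:
  fixes y :: "real^3" and t :: real
  assumes y: "1 < norm y"
  defines "H \<equiv> mean_curvature_vector g (coordinate_sphere \<Phi> t (norm y)) (\<Phi> (y, t))"
  shows "g (\<Phi> (y, t)) H H \<noteq> 0"
    and "inverse_mean_curvature_vector g (coordinate_sphere \<Phi> t (norm y)) (\<Phi> (y, t)) = (1 / 2) *\<^sub>R D (y, t) (y, 0)"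
proof -
  interpret S: spacelike_sphere g \<Phi> y t by (rule spacelike_sphere[OF y])
  let ?p = "\<Phi> (y, t)" and ?E = "\<lambda>v. D (y, t) (v, 0)"
  have h: "chart_metric (y, t) (v, 0) (w, 0) = g ?p (?E v) (?E w)" for v w by (simp add: chart_metric_def)
  have y0: "y \<noteq> 0" using y by auto
  note p = S.p_ext and q = S.q_ext
  obtain v w where vw: "S.orthonormal_pair v w" by (rule S.orthonormal_pair_exists)
  note on = vw[unfolded S.orthonormal_pair_def]
  have rad: "g ?p (?E y) (?E x) = 0" "g ?p (?E x) (?E y) = 0" if "x \<bullet> y = 0" for x
    using radial_orthogonal[OF y that, of t] sym_g[OF p] unfolding h by metis+
  have np: "g ?p (normal_part g S.S ?p u) (?E y) = g ?p u (?E y)" for u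
    unfolding S.normal_part_pair[OF vw] using on rad by (simp add: g_simps[OF p])
  have II: "g ?p (S.II x x) (?E y) = - chart_metric (y, t) (x, 0) (x, 0) - d_chart_metric (y, t) (y, 0) (x, 0) (x, 0) / 2" if "x \<bullet> y = 0" for x
  proof -
    have "2 * g ?p (hess \<Phi> (y, t) (x, 0) (x, 0)) (?E y) =
      d_chart_metric (y, t) (x, 0) (x, 0) (y, 0) + d_chart_metric (y, t) (x, 0) (x, 0) (y, 0) - d_chart_metric (y, t) (y, 0) (x, 0) (x, 0)"
      using koszul_pullback[OF open_exterior smooth_chart(1) q p] unfolding d_chart_metric_def chart_metric_def .
    then show ?thesis unfolding S.II_def np
      by (simp add: g_simps[OF p] radial_derivative[OF y that] h)
  qed
  have H: "H = S.II v v + S.II w w" unfolding H_def by (rule S.mean_curvature_vector_eq[OF vw])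
  have "g ?p H (?E y) = - 2 - (d_chart_metric (y, t) (y, 0) (v, 0) (v, 0) + d_chart_metric (y, t) (y, 0) (w, 0) (w, 0)) / 2"
    using on unfolding H by (simp add: g_simps[OF p] II h add_divide_distrib)
  also have "\<dots> = - 2" using area_derivative[OF y, of v w t] on by (simp add: h)
  finally have Hy: "g ?p H (?E y) = - 2" .
  have normal: "g ?p H (?E x) = 0" if "x \<bullet> y = 0" for x
  proof -
    have 1: "g ?p (normal_part g S.S ?p u) (?E v) = 0" "g ?p (normal_part g S.S ?p u) (?E w) = 0" for u
      unfolding S.normal_part_pair[OF vw] using on sym_g[OF p, of "?E w" "?E v"] by (simp_all add: g_simps[OF p])
    have "?E x = g ?p (?E x) (?E v) *\<^sub>R ?E v + g ?p (?E x) (?E w) *\<^sub>R ?E w"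
      using arg_cong[OF S.orthonormal_pair_spans[OF vw that], of ?E] unfolding S.E_simps .
    then have "g ?p H (?E x) = g ?p H (g ?p (?E x) (?E v) *\<^sub>R ?E v + g ?p (?E x) (?E w) *\<^sub>R ?E w)" by (rule arg_cong)
    also have "\<dots> = 0" unfolding H S.II_def by (simp add: g_simps[OF p] 1)
    finally show ?thesis .
  qed
  have "H \<in> tangent_space (time_slice \<Phi> t) ?p"
    using imcvf y in_coordinate_sphere[OF y, of t] unfolding imcvf_chart_def H_def by blast
  then obtain z where z: "H = ?E z" unfolding tangent_space_time_slice[OF y] by blast
  \<comment> \<open>split \<open>H\<close> into a radial part and a part tangent to the sphere; the latter is null, hence zero\<close>
  define k where "k = z \<bullet> y / (y \<bullet> y)"
  define z' where "z' = z - k *\<^sub>R y"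
  have z'y: "z' \<bullet> y = 0" using y0 by (simp add: z'_def k_def inner_diff_left)
  have Hz: "H = k *\<^sub>R ?E y + ?E z'" unfolding z z'_def S.E_simps by simp
  have "g ?p (?E z') (?E z') = 0" using normal[OF z'y] rad[OF z'y] unfolding Hz by (simp add: g_simps[OF p])
  then have "z' = 0" using spacelike_slice[OF y, of z' t] unfolding h by fastforce
  then have Hk: "H = k *\<^sub>R ?E y" using Hz by (simp add: S.E_simps)
  define n where "n = g ?p (?E y) (?E y)"
  have n: "n \<noteq> 0" using spacelike_slice[OF y y0, of t] unfolding h n_def by simp
  have kn: "k * n = - 2" using Hy unfolding Hk n_def by (simp add: g_simps[OF p])
  have HH: "g ?p H H = k * (k * n)" unfolding Hk n_def by (simp add: g_simps[OF p])
  then show "g ?p H H \<noteq> 0" using kn n by auto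
  have "inverse_mean_curvature_vector g (coordinate_sphere \<Phi> t (norm y)) ?p = - (1 / (k * (k * n))) *\<^sub>R (k *\<^sub>R ?E y)"
    unfolding inverse_mean_curvature_vector_def Let_def H_def[symmetric] HH unfolding Hk ..
  also have "\<dots> = (1 / 2) *\<^sub>R ?E y"
  proof -
    have "k \<noteq> 0" using kn by auto
    then show ?thesis by (simp add: kn)
  qed
  finally show "inverse_mean_curvature_vector g (coordinate_sphere \<Phi> t (norm y)) ?p = (1 / 2) *\<^sub>R ?E y" .
qed

theorem coordinate_spheres_flow:
  "smooth_imcv_flow exterior g {0<..} (\<lambda>x s. chart_point \<Phi> t (exp (s / 2)) x)"
  unfolding smooth_imcv_flow_def
proof (intro conjI ballI exI)
  let ?N = "{xs :: (real^3) \<times> real. 1 < norm (fst xs) * exp (snd xs / 2)}"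
  show "open ?N" by (intro open_Collect_less continuous_intros) auto
  show "sphere 0 1 \<times> {0<..} \<subseteq> ?N" by auto
  have "smooth_on ?N (\<lambda>xs. \<Phi> (exp ((1/2) * snd xs) *\<^sub>R fst xs, t))"
  proof (rule smooth_on_compose[OF \<open>open ?N\<close> smooth_chart(1)])
    show "smooth_on ?N (\<lambda>xs. (exp ((1/2) * snd xs) *\<^sub>R fst xs, t))"
      by (intro smooth_on_Pair smooth_on_scaleR smooth_on_exp smooth_on_mult smooth_on_const
          smooth_on_linear[OF _ bounded_linear_fst smooth_on_ident] smooth_on_linear[OF _ bounded_linear_snd smooth_on_ident] \<open>open ?N\<close>)
    show "(\<lambda>xs. (exp ((1/2) * snd xs) *\<^sub>R fst xs, t)) ` ?N \<subseteq> exterior"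
      by (auto simp: exterior_iff mult.commute)
  qed
  then show "smooth_on ?N (\<lambda>(x, s). chart_point \<Phi> t (exp (s / 2)) x)"
    by (simp add: chart_point_def case_prod_unfold)
next
  fix s :: real assume "s \<in> {0<..}"
  then have r: "1 < exp (s / 2)" by simp
  let ?r = "exp (s / 2)" and ?S = "coordinate_sphere \<Phi> t (exp (s / 2))"
  have S: "(\<lambda>x. chart_point \<Phi> t ?r x) ` sphere 0 1 = ?S" by (simp add: coordinate_sphere_def)
  have pt: "\<exists>y. norm y = ?r \<and> p = \<Phi> (y, t)" if "p \<in> ?S" for p
    using that coordinate_sphere_eq[of ?r t] by auto
  have "sphere_embedding exterior (chart_point \<Phi> t ?r)"
    using imcvf r unfolding imcvf_chart_def by blast
  moreover have "spacelike g ?S"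
    unfolding spacelike_def
  proof (intro ballI impI)
    fix p v assume p: "p \<in> ?S" and v: "v \<in> tangent_space ?S p" "v \<noteq> 0"
    obtain y where y: "norm y = ?r" "p = \<Phi> (y, t)" using pt[OF p] by blast
    have y1: "1 < norm y" using y r by simp
    obtain u where u: "v = D (y, t) (u, 0)"
      using v(1) tangent_plane[OF y1, of t] unfolding y tangent_plane_def by auto
    have "u \<noteq> 0"
    proof
      assume "u = 0"
      then have "v = D (y, t) 0" by (simp add: u zero_prod_def)
      then show False using v(2) D_eq_0[of "(y, t)" 0] y1 by (simp add: exterior_iff)
    qed
    then show "0 < g p v v" using spacelike_slice[OF y1, of u t] unfolding u y(2) chart_metric_def by simp
  qed
  moreover have "g p (mean_curvature_vector g ?S p) (mean_curvature_vector g ?S p) \<noteq> 0" if "p \<in> ?S" for p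
  proof -
    obtain y where y: "norm y = ?r" "p = \<Phi> (y, t)" using pt[OF \<open>p \<in> ?S\<close>] by blast
    show ?thesis using inverse_mean_curvature_vector_chart(1)[of y t] r unfolding y by simp
  qed
  moreover have "((\<lambda>\<sigma>. chart_point \<Phi> t (exp (\<sigma> / 2)) x) has_vector_derivative
      inverse_mean_curvature_vector g ?S (chart_point \<Phi> t ?r x)) (at s)" if "x \<in> sphere 0 1" for x
  proof -
    define y where "y = ?r *\<^sub>R x"
    have y: "norm y = ?r" "1 < norm y" using that r by (simp_all add: y_def)
    have q: "(y, t) \<in> exterior" using y by (simp add: exterior_iff)
    have "((\<lambda>\<sigma>. (exp (\<sigma> / 2) *\<^sub>R x, t)) has_vector_derivative (1 / 2) *\<^sub>R (y, 0)) (at s)"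
      unfolding has_vector_derivative_def y_def
      by (auto intro!: derivative_eq_intros simp: fun_eq_iff)
    then have "((\<lambda>\<sigma>. \<Phi> (exp (\<sigma> / 2) *\<^sub>R x, t)) has_vector_derivative D (y, t) ((1 / 2) *\<^sub>R (y, 0))) (at s)"
      by (rule has_vector_derivative_chain) (use chart_has_derivative[OF q] in \<open>simp add: y_def\<close>)
    moreover have "inverse_mean_curvature_vector g ?S (chart_point \<Phi> t ?r x) = D (y, t) ((1 / 2) *\<^sub>R (y, 0))"
      using inverse_mean_curvature_vector_chart(2)[OF y(2), of t]
      unfolding y(1) linear_cmul[OF linear_D[OF q]] chart_point_def y_def[symmetric] .
    ultimately show ?thesis unfolding chart_point_def by simp
  qed
  ultimately show "let S = (\<lambda>x. chart_point \<Phi> t ?r x) ` sphere 0 1 in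
        sphere_embedding exterior (\<lambda>x. chart_point \<Phi> t ?r x) \<and> spacelike g S \<and>
        (\<forall>p\<in>S. let H = mean_curvature_vector g S p in g p H H \<noteq> 0) \<and>
        (\<forall>x\<in>sphere 0 1.
           ((\<lambda>\<sigma>. chart_point \<Phi> t (exp (\<sigma> / 2)) x) has_vector_derivative inverse_mean_curvature_vector g S (chart_point \<Phi> t ?r x)) (at s))"
    unfolding S Let_def by blast
qed

end

section \<open>A family of examples\<close>

text \<open>Any point outside the closed unit ball would do.\<close>

definition center :: "real^3" where "center = 2 *\<^sub>R axis 1 1"

definition dist_sq :: "event \<Rightarrow> real" where
  "dist_sq q = (fst q - center) \<bullet> (fst q - center)"

text \<open>Chosen so that its spatial Hessian is positive definite except at the event \<open>(center, 0)\<close>, where it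
vanishes; the time dependence is what excludes timelike Killing fields. It is even in \<open>y - center\<close>.\<close>

definition lapse :: "real \<Rightarrow> event \<Rightarrow> real" where
  "lapse k q = k + (dist_sq q)\<^sup>2 + (snd q)\<^sup>2 * dist_sq q"

definition lapse_metric :: "real \<Rightarrow> tensor2" where
  "lapse_metric k = (\<lambda>q\<in>exterior. \<lambda>v w. - (lapse k q)\<^sup>2 * (snd v * snd w) + fst v \<bullet> fst w)"

text \<open>The spatial gradient of the lapse.\<close>

definition grad :: "event \<Rightarrow> real^3" where
  "grad q = (4 * dist_sq q + 2 * (snd q)\<^sup>2) *\<^sub>R (fst q - center)"

definition lapse_dt :: "event \<Rightarrow> real" where
  "lapse_dt q = 2 * snd q * dist_sq q"

lemma dist_sq_derivative: "(dist_sq has_derivative (\<lambda>u. 2 * ((fst q - center) \<bullet> fst u))) (at q)"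
  unfolding dist_sq_def
  by (rule has_derivative_eq_rhs, (rule derivative_intros)+) (simp add: fun_eq_iff inner_commute)

lemma lapse_derivative: "(lapse k has_derivative (\<lambda>u. grad q \<bullet> fst u + lapse_dt q * snd u)) (at q)"
proof -
  have "((\<lambda>q. k + (dist_sq q)\<^sup>2 + (snd q)\<^sup>2 * dist_sq q) has_derivative (\<lambda>u. grad q \<bullet> fst u + lapse_dt q * snd u)) (at q)"
    by (rule has_derivative_eq_rhs, (rule derivative_intros dist_sq_derivative)+)
      (simp add: fun_eq_iff grad_def lapse_dt_def power2_eq_square algebra_simps)
  then show ?thesis unfolding lapse_def[abs_def] .
qed

lemma smooth_dist_sq: "open S \<Longrightarrow> smooth_on S dist_sq"
  unfolding dist_sq_def
  by (intro smooth_on_inner smooth_on_diff smooth_on_const smooth_on_linear[OF _ bounded_linear_fst smooth_on_ident])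

lemma smooth_lapse: "open S \<Longrightarrow> smooth_on S (lapse k)"
  unfolding lapse_def
  by (intro smooth_on_add smooth_on_mult smooth_on_power smooth_on_const smooth_dist_sq smooth_on_linear[OF _ bounded_linear_snd smooth_on_ident])

lemma lapse_pos: "0 < k \<Longrightarrow> 0 < lapse k q"
  unfolding lapse_def dist_sq_def by (intro add_pos_nonneg) auto

lemma lapse_metric: "q \<in> exterior \<Longrightarrow> lapse_metric k q v w = - (lapse k q)\<^sup>2 * (snd v * snd w) + fst v \<bullet> fst w"
  by (simp add: lapse_metric_def)

lemma center_in_exterior: "(center, t) \<in> exterior"
  by (simp add: exterior_iff center_def norm_axis_1)

lemma lorentz_lapse_metric:
  assumes "0 < k" shows "lorentz_metric exterior (lapse_metric k)"
  unfolding lorentz_metric_def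
proof (intro conjI ballI allI)
  fix q assume q: "q \<in> exterior"
  note m = lapse_metric[OF q, of k]
  show "bilinear (lapse_metric k q)" unfolding bilinear_def
    by (intro conjI allI linearI) (simp_all add: m algebra_simps inner_add_left inner_add_right)
  show "lapse_metric k q v w = lapse_metric k q w v" for v w by (simp add: m inner_commute)
  define e :: "nat \<Rightarrow> event" where
    "e = (\<lambda>i. if i = 0 then (0, 1 / lapse k q) else if i = 1 then (axis 1 1, 0) else if i = 2 then (axis 2 1, 0) else (axis 3 1, 0))"
  have lt4: "i = 0 \<or> i = 1 \<or> i = 2 \<or> i = 3" if "i < 4" for i :: nat using that by auto
  have "lapse k q \<noteq> 0" using lapse_pos[OF assms, of q] by simp
  then have "lapse_metric k q (e i) (e j) = (if i \<noteq> j then 0 else if i = 0 then - 1 else 1)" if "i < 4" "j < 4" for i j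
    using lt4[OF that(1)] lt4[OF that(2)]
    by (elim disjE) (simp_all add: m e_def inner_axis_axis power2_eq_square)
  then show "\<exists>e :: nat \<Rightarrow> event. \<forall>i<4. \<forall>j<4. lapse_metric k q (e i) (e j) = (if i \<noteq> j then 0 else if i = 0 then - 1 else 1)" by blast
next
  fix v w :: event
  have "smooth_on exterior (\<lambda>q. (- 1 * (snd v * snd w)) * (lapse k q)\<^sup>2 + fst v \<bullet> fst w)"
    by (intro smooth_on_add smooth_on_mult smooth_on_power smooth_on_const smooth_lapse open_exterior)
  then show "smooth_on exterior (\<lambda>q. lapse_metric k q v w)"
    by (rule smooth_on_cong[OF open_exterior, rotated]) (simp add: lapse_metric)
qed

lemma spacetime_lapse_metric:
  assumes "0 < k" shows "spacetime exterior (lapse_metric k)"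
  unfolding spacetime_def
proof (intro conjI exI)
  have "connected (- cball (0::real^3) 1)"
    by (rule connected_complement_bounded_convex) auto
  then show "connected exterior" unfolding exterior_def by (intro connected_Times connected_UNIV)
  show "timelike_field exterior (lapse_metric k) (\<lambda>q. (0, 1))"
    unfolding timelike_field_def using lapse_pos[OF assms] by (auto simp: smooth_on_const lapse_metric less_imp_neq[symmetric])
qed (use open_exterior lorentz_lapse_metric[OF assms] in auto)

locale example_metric =
  fixes k :: real
  assumes k: "0 < k"
begin

abbreviation "G \<equiv> lapse_metric k"
abbreviation "V \<equiv> lapse k"

lemma lapse_positive: "0 < V q" by (rule lapse_pos[OF k])

end

sublocale example_metric \<subseteq> lorentzian_manifold exterior "lapse_metric k"
  by unfold_locales (rule open_exterior, rule lorentz_lapse_metric[OF k])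

context example_metric begin

lemma d_lapse_metric:
  assumes "q \<in> exterior"
  shows "dg q x v w = - 2 * V q * (grad q \<bullet> fst x + lapse_dt q * snd x) * (snd v * snd w)"
proof -
  have "((\<lambda>q. - (V q)\<^sup>2 * (snd v * snd w) + fst v \<bullet> fst w) has_derivative
    (\<lambda>x. - 2 * V q * (grad q \<bullet> fst x + lapse_dt q * snd x) * (snd v * snd w))) (at q)"
    by (rule has_derivative_eq_rhs, (rule derivative_intros lapse_derivative)+) (simp add: fun_eq_iff)
  then have "((\<lambda>q. G q v w) has_derivative (\<lambda>x. - 2 * V q * (grad q \<bullet> fst x + lapse_dt q * snd x) * (snd v * snd w))) (at q)"
    by (rule has_derivative_transform_within_open[OF _ open_exterior assms]) (simp add: lapse_metric)
  from frechet_derivative_eqI[OF this] show ?thesis by simp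
qed

text \<open>The time component of the Christoffel symbols, multiplied by the lapse.\<close>

definition time_part where
  "time_part q x y = lapse_dt q * (snd x * snd y) + snd x * (grad q \<bullet> fst y) + snd y * (grad q \<bullet> fst x)"

text \<open>The Christoffel symbols of \<open>- V\<^sup>2 dt\<^sup>2 + |dy|\<^sup>2\<close>.\<close>

definition \<Gamma> :: "event \<Rightarrow> event \<Rightarrow> event \<Rightarrow> event" where
  "\<Gamma> q x y = ((V q * (snd x * snd y)) *\<^sub>R grad q, time_part q x y / V q)"

lemma christoffel_eq:
  assumes "q \<in> exterior"
  shows "christoffel G q = \<Gamma> q"
proof (rule christoffel_eqI[OF assms])
  have V0: "V q \<noteq> 0" using lapse_positive[of q] by simp
  have "bilinear (\<Gamma> q)" unfolding bilinear_def \<Gamma>_def time_part_def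
    by (intro conjI allI linearI) (simp_all add: algebra_simps inner_add_right add_divide_distrib)
  moreover have "\<Gamma> q x y = \<Gamma> q y x" for x y by (simp add: \<Gamma>_def time_part_def algebra_simps)
  moreover have "dg q x y z = G q (\<Gamma> q x y) z + G q y (\<Gamma> q x z)" for x y z
    unfolding d_lapse_metric[OF assms] lapse_metric[OF assms] \<Gamma>_def time_part_def
    using V0 by (simp add: inner_commute[of _ "grad q"] power2_eq_square field_simps)
  ultimately show "levi_civita_at q (\<Gamma> q)" unfolding levi_civita_at_def by blast
qed

text \<open>In this and the following definitions, \<open>u\<close> is the direction in which the quantity named after
\<open>d\<close> is differentiated at \<open>q\<close>.\<close>

definition dgrad :: "event \<Rightarrow> event \<Rightarrow> real^3" where
  "dgrad q u = (4 * dist_sq q + 2 * (snd q)\<^sup>2) *\<^sub>R fst u + (8 * ((fst q - center) \<bullet> fst u) + 4 * snd q * snd u) *\<^sub>R (fst q - center)"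

definition dlapse_dt :: "event \<Rightarrow> event \<Rightarrow> real" where
  "dlapse_dt q u = 2 * snd u * dist_sq q + 4 * snd q * ((fst q - center) \<bullet> fst u)"

definition dtime_part where
  "dtime_part q x y u = dlapse_dt q u * (snd x * snd y) + snd x * (dgrad q u \<bullet> fst y) + snd y * (dgrad q u \<bullet> fst x)"

lemma grad_derivative: "(grad has_derivative dgrad q) (at q)"
proof -
  have "((\<lambda>q. (4 * dist_sq q + 2 * (snd q)\<^sup>2) *\<^sub>R (fst q - center)) has_derivative dgrad q) (at q)"
    by (rule has_derivative_eq_rhs, (rule derivative_intros dist_sq_derivative)+)
      (simp add: fun_eq_iff dgrad_def algebra_simps)
  then show ?thesis unfolding grad_def[abs_def] .
qed

lemma lapse_dt_derivative: "(lapse_dt has_derivative dlapse_dt q) (at q)"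
proof -
  have "((\<lambda>q. 2 * snd q * dist_sq q) has_derivative dlapse_dt q) (at q)"
    by (rule has_derivative_eq_rhs, (rule derivative_intros dist_sq_derivative)+)
      (simp add: fun_eq_iff dlapse_dt_def algebra_simps)
  then show ?thesis unfolding lapse_dt_def[abs_def] .
qed

definition d\<Gamma> :: "event \<Rightarrow> event \<Rightarrow> event \<Rightarrow> event \<Rightarrow> event" where
  "d\<Gamma> q x y u =
     ((V q * (snd x * snd y)) *\<^sub>R dgrad q u + ((grad q \<bullet> fst u + lapse_dt q * snd u) * (snd x * snd y)) *\<^sub>R grad q,
      (dtime_part q x y u * V q - time_part q x y * (grad q \<bullet> fst u + lapse_dt q * snd u)) / (V q * V q))"

lemma \<Gamma>_derivative:
  "((\<lambda>q. \<Gamma> q x y) has_derivative d\<Gamma> q x y) (at q)"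
proof -
  have V0: "V q \<noteq> 0" using lapse_positive[of q] by simp
  have t: "((\<lambda>q. time_part q x y) has_derivative dtime_part q x y) (at q)"
    unfolding time_part_def
    by (rule has_derivative_eq_rhs, (rule derivative_intros grad_derivative lapse_dt_derivative)+)
      (simp add: fun_eq_iff dtime_part_def algebra_simps)
  show ?thesis unfolding \<Gamma>_def
    by (rule has_derivative_eq_rhs, (rule has_derivative_Pair has_derivative_scaleR has_derivative_mult_left grad_derivative lapse_derivative
        has_derivative_divide'[OF t lapse_derivative V0])+) (simp add: fun_eq_iff d\<Gamma>_def)
qed

lemma christoffel_derivative:
  "q \<in> exterior \<Longrightarrow> ((\<lambda>q. christoffel G q x y) has_derivative d\<Gamma> q x y) (at q)"
  by (rule has_derivative_transform_within_open[OF \<Gamma>_derivative open_exterior]) (simp_all add: christoffel_eq)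

text \<open>At this event the Christoffel symbols vanish to first order, since the first and second derivatives
of the lapse vanish.\<close>

lemma riemann_center: "riemann (center, 0) u v w = 0"
proof -
  have z: "dist_sq (center, 0) = 0" "grad (center, 0) = 0" "lapse_dt (center, 0) = 0" "dgrad (center, 0) u = 0" "dlapse_dt (center, 0) u = 0" for u
    by (simp_all add: dist_sq_def grad_def lapse_dt_def dgrad_def dlapse_dt_def)
  have t: "time_part (center, 0) x y = 0" "dtime_part (center, 0) x y u = 0" for x y u
    by (simp_all add: time_part_def dtime_part_def z)
  have "frechet_derivative (\<lambda>q. christoffel G q x y) (at (center, 0)) u = 0" for x y u
    unfolding frechet_derivative_eqI[OF christoffel_derivative[OF center_in_exterior]] d\<Gamma>_def by (simp add: z t zero_prod_def)
  moreover have "christoffel G (center, 0) x y = 0" for x y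
    unfolding christoffel_eq[OF center_in_exterior] \<Gamma>_def by (simp add: z t zero_prod_def)
  ultimately show ?thesis unfolding riemann_def by simp
qed

text \<open>The component that is used equals \<open>V\<close> times the second spatial derivative of \<open>V\<close> in direction
\<open>axis 2 1\<close>; a unit vector in any other direction would serve as well.\<close>

lemma riemann_nonzero:
  assumes "q \<in> exterior" "q \<noteq> (center, 0)"
  shows "riemann q (axis 2 1, 0) (0, 1) (0, 1) \<noteq> 0"
proof
  let ?e = "axis 2 1 :: real^3"
  assume "riemann q (?e, 0) (0, 1) (0, 1) = 0"
  then have "fst (riemann q (?e, 0) (0, 1) (0, 1)) \<bullet> ?e = 0" by simp
  moreover have "fst (riemann q (?e, 0) (0, 1) (0, 1)) = V q *\<^sub>R dgrad q (?e, 0)"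
    using lapse_positive[of q] unfolding riemann_def frechet_derivative_eqI[OF christoffel_derivative[OF assms(1)]] christoffel_eq[OF assms(1)] \<Gamma>_def d\<Gamma>_def
    by (simp add: time_part_def)
  ultimately have "dgrad q (?e, 0) \<bullet> ?e = 0" using lapse_positive[of q] by simp
  then have "4 * dist_sq q + 2 * (snd q)\<^sup>2 + 8 * ((fst q - center) \<bullet> ?e)\<^sup>2 = 0"
    unfolding dgrad_def by (simp add: inner_add_left inner_axis_axis power2_eq_square)
  moreover have "0 \<le> dist_sq q" by (simp add: dist_sq_def)
  ultimately have "dist_sq q = 0" "(snd q)\<^sup>2 = 0"
    using zero_le_power2[of "snd q"] zero_le_power2[of "(fst q - center) \<bullet> ?e"] by linarith+
  then have "q = (center, 0)" by (simp add: dist_sq_def prod_eq_iff)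
  then show False using assms(2) by simp
qed

lemma isometry_fixes_center:
  assumes "h \<in> isometries exterior G"
  shows "h (center, 0) = (center, 0)"
proof (rule ccontr)
  assume neq: "h (center, 0) \<noteq> (center, 0)"
  let ?p = "(center, 0)" let ?D = "frechet_derivative h (at (center, 0))"
  have h: "isometric_embedding h"
    using assms unfolding isometries_def isometric_embedding_def diffeo_on_def bij_betw_def by blast
  have p: "?p \<in> exterior" by (rule center_in_exterior)
  have hp: "h ?p \<in> exterior" using h p unfolding isometric_embedding_def by blast
  note surj = isometric_embedding_derivative(2)[OF h p]
  obtain u where u: "(axis 2 1, 0) = ?D u" using surjD[OF surj] by blast
  obtain w where w: "(0, 1) = ?D w" using surjD[OF surj] by blast
  have "riemann (h ?p) (?D u) (?D w) (?D w) = ?D (riemann ?p u w w)"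
    by (rule isometry_riemann[OF h p]) (rule differentiableI[OF christoffel_derivative])
  also have "\<dots> = 0"
    unfolding riemann_center by (rule linear_0[OF isometric_embedding_derivative(1)[OF h p]])
  finally show False using riemann_nonzero[OF hp neq] unfolding u w by simp
qed

text \<open>The orbit of the fixed point is a point, but a two-sphere has more than one.\<close>

theorem not_spherically_symmetric: "\<not> spherically_symmetric exterior G"
proof
  assume "spherically_symmetric exterior G"
  then obtain K where K: "subgroup K (isometry_group exterior G)"
    and round: "\<forall>p\<in>exterior. round_sphere exterior G ((\<lambda>h. h p) ` K)"
    unfolding spherically_symmetric_def by blast
  have "K \<subseteq> isometries exterior G" using subgroup.subset[OF K] by (simp add: isometry_group_def)
  then have orbit: "(\<lambda>h. h (center, 0)) ` K \<subseteq> {(center, 0)}" using isometry_fixes_center by blast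
  obtain \<iota> :: "real^3 \<Rightarrow> event" where \<iota>: "inj_on \<iota> (sphere 0 1)" "(\<lambda>h. h (center, 0)) ` K = \<iota> ` sphere 0 1"
    using bspec[OF round center_in_exterior[of 0]] unfolding round_sphere_def sphere_embedding_def by blast
  have s: "axis 1 1 \<in> sphere (0::real^3) 1" "axis 2 1 \<in> sphere (0::real^3) 1" by (simp_all add: norm_axis_1)
  then have "\<iota> (axis 1 1) = (center, 0)" "\<iota> (axis 2 1) = (center, 0)" using orbit unfolding \<iota>(2) by blast+
  then have "\<iota> (axis 1 1) = \<iota> (axis 2 1)" by simp
  then have "axis 1 1 = (axis 2 1 :: real^3)" using inj_onD[OF \<iota>(1) _ s] by blast
  then show False by (simp add: axis_eq_axis)
qed

text \<open>A timelike Killing field is shown to have vanishing time component at \<open>(center, 1)\<close>. The line is chosen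
perpendicular to the direction of the centre, so that it lies in the exterior as a whole and \<open>s\<close>
ranges over all real numbers.\<close>

theorem not_static: "\<not> static exterior G"
proof
  assume "static exterior G"
  then obtain X where X: "smooth_on exterior X" "\<forall>p\<in>exterior. G p (X p) (X p) < 0"
    and killing: "\<forall>p\<in>exterior. \<forall>v w. lie_derivative_metric G X p v w = 0"
    unfolding static_def killing_field_def timelike_field_def by blast
  define e :: "real^3" where "e = axis 2 1"
  have e: "e \<bullet> e = 1" "center \<bullet> e = 0" "e \<bullet> center = 0" "center \<bullet> center = 4" by (simp_all add: e_def center_def inner_axis_axis)
  define P where "P = (\<lambda>s t. (center + s *\<^sub>R e, t :: real))"
  have P: "P s t \<in> exterior" for s t
  proof -
    have "(norm (center + s *\<^sub>R e))\<^sup>2 = 4 + s\<^sup>2"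
      unfolding power2_norm_eq_inner using e
      by (simp add: inner_add_left inner_add_right power2_eq_square)
    then have "1 < (norm (center + s *\<^sub>R e))\<^sup>2" using zero_le_power2[of s] by linarith
    then have "1 < norm (center + s *\<^sub>R e)" using power2_less_imp_less[of 1 "norm (center + s *\<^sub>R e)"] by simp
    then show ?thesis by (simp add: P_def exterior_iff)
  qed
  have Pdist: "dist_sq (P s t) = s\<^sup>2" "grad (P s t) = ((4 * s\<^sup>2 + 2 * t\<^sup>2) * s) *\<^sub>R e" "lapse_dt (P s t) = 2 * t * s\<^sup>2"
    "V (P s t) = k + (s\<^sup>2)\<^sup>2 + t\<^sup>2 * s\<^sup>2" for s t
    using e by (simp_all add: P_def dist_sq_def grad_def lapse_dt_def lapse_def power2_eq_square)
  let ?DX = "\<lambda>s t. frechet_derivative X (at (P s t))"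
  define \<xi> where "\<xi> = (\<lambda>s t. fst (X (P s t)) \<bullet> e)"
  define T where "T = (\<lambda>s t. snd (X (P s t)))"
  define Xs where "Xs = (\<lambda>s t. ?DX s t (e, 0))"
  define Xt where "Xt = (\<lambda>s t. ?DX s t (0, 1))"
  have dX: "(X has_derivative ?DX s t) (at (P s t))" for s t
    by (rule smooth_on_has_derivative[OF X(1) P])
  have Ps: "((\<lambda>s. P s t) has_vector_derivative (e, 0)) (at s)" and Pt: "((\<lambda>t. P s t) has_vector_derivative (0, 1)) (at t)" for s t
    unfolding P_def has_vector_derivative_def by (auto intro!: derivative_eq_intros simp: fun_eq_iff)
  have "((\<lambda>s. X (P s t)) has_vector_derivative Xs s t) (at s)" "((\<lambda>t. X (P s t)) has_vector_derivative Xt s t) (at t)" for s t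
    unfolding Xs_def Xt_def by (rule has_vector_derivative_chain[OF Ps dX], rule has_vector_derivative_chain[OF Pt dX])
  note dXv = this[unfolded has_vector_derivative_def]
  have \<xi>s: "((\<lambda>s. \<xi> s t) has_real_derivative fst (Xs s t) \<bullet> e) (at s)" for s t
    unfolding \<xi>_def has_field_derivative_def
    by (rule has_derivative_eq_rhs[OF has_derivative_inner_left[OF has_derivative_fst[OF dXv(1)]]]) (simp add: fun_eq_iff mult.commute)
  have \<xi>t: "((\<lambda>t. \<xi> s t) has_real_derivative fst (Xt s t) \<bullet> e) (at t)" for s t
    unfolding \<xi>_def has_field_derivative_def
    by (rule has_derivative_eq_rhs[OF has_derivative_inner_left[OF has_derivative_fst[OF dXv(2)]]]) (simp add: fun_eq_iff mult.commute)
  have Ts: "((\<lambda>s. T s t) has_real_derivative snd (Xs s t)) (at s)" for s t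
    unfolding T_def has_field_derivative_def
    by (rule has_derivative_eq_rhs[OF has_derivative_snd[OF dXv(1)]]) (simp add: fun_eq_iff mult.commute)
  have Tt: "((\<lambda>t. T s t) has_real_derivative snd (Xt s t)) (at t)" for s t
    unfolding T_def has_field_derivative_def
    by (rule has_derivative_eq_rhs[OF has_derivative_snd[OF dXv(2)]]) (simp add: fun_eq_iff mult.commute)
  \<comment> \<open>the Killing equations for the pairs \<open>(e, e)\<close>, \<open>(e, \<partial>\<^sub>t)\<close> and \<open>(\<partial>\<^sub>t, \<partial>\<^sub>t)\<close> of constant fields\<close>
  have k1: "fst (Xs s t) \<bullet> e = 0" for s t
    using killing[rule_format, OF P, of s t "(e, 0)" "(e, 0)"]
    unfolding lie_derivative_metric_def d_lapse_metric[OF P] lapse_metric[OF P] Xs_def by (simp add: inner_commute)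
  have k2: "fst (Xt s t) \<bullet> e = (V (P s t))\<^sup>2 * snd (Xs s t)" for s t
    using killing[rule_format, OF P, of s t "(e, 0)" "(0, 1)"]
    unfolding lie_derivative_metric_def d_lapse_metric[OF P] lapse_metric[OF P] Xs_def Xt_def by (simp add: inner_commute)
  have k3: "V (P s t) * snd (Xt s t) = - ((4 * s\<^sup>2 + 2 * t\<^sup>2) * s * \<xi> s t + 2 * t * s\<^sup>2 * T s t)" for s t
  proof -
    have "- 2 * V (P s t) * (grad (P s t) \<bullet> fst (X (P s t)) + lapse_dt (P s t) * snd (X (P s t)) + V (P s t) * snd (Xt s t)) = 0"
      using killing[rule_format, OF P, of s t "(0, 1)" "(0, 1)"]
      unfolding lie_derivative_metric_def d_lapse_metric[OF P] lapse_metric[OF P] Xt_def by (simp add: power2_eq_square algebra_simps)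
    then have "grad (P s t) \<bullet> fst (X (P s t)) + lapse_dt (P s t) * snd (X (P s t)) + V (P s t) * snd (Xt s t) = 0"
      using lapse_positive[of "P s t"] by simp
    then show ?thesis unfolding Pdist(2,3) \<xi>_def T_def by (simp add: inner_commute)
  qed
  have \<xi>: "\<xi> s t = \<xi> 0 t" for s t
  proof (rule DERIV_isconst_all[of "\<lambda>s. \<xi> s t"], rule allI)
    fix s
    show "((\<lambda>s. \<xi> s t) has_real_derivative 0) (at s)" using \<xi>s[of t s] by (simp only: k1)
  qed
  have \<xi>t_eq: "fst (Xt s t) \<bullet> e = fst (Xt 0 t) \<bullet> e" for s t
  proof (rule DERIV_unique[OF _ \<xi>t[of 0 t]])
    have "(\<lambda>t. \<xi> s t) = (\<lambda>t. \<xi> 0 t)" by (rule ext) (rule \<xi>)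
    with \<xi>t[of s t] show "((\<lambda>t. \<xi> 0 t) has_real_derivative fst (Xt s t) \<bullet> e) (at t)" by simp
  qed
  \<comment> \<open>both values are the common time derivative of \<open>\<xi>\<close> divided by \<open>V\<^sup>2\<close>, which is even in \<open>s\<close>\<close>
  have Ts_even: "snd (Xs (- s) t) = snd (Xs s t)" for s t
  proof -
    have "V (P (- s) t) = V (P s t)" by (simp add: Pdist)
    then have "(V (P s t))\<^sup>2 * snd (Xs (- s) t) = (V (P s t))\<^sup>2 * snd (Xs s t)"
      using k2[of s t] k2[of "- s" t] \<xi>t_eq[of s t] \<xi>t_eq[of "- s" t] by auto
    then show ?thesis using lapse_positive[of "P s t"] by simp
  qed
  have T_even: "T s t + T (- s) t = 2 * T 0 t" for s t
  proof -
    have "((\<lambda>s. T s t + T (- s) t) has_real_derivative 0) (at s)" for s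
    proof -
      have "((\<lambda>s. T (- s) t) has_real_derivative snd (Xs (- s) t) * (- 1)) (at s)"
        by (rule DERIV_chain2[OF Ts]) (auto intro!: derivative_eq_intros)
      from DERIV_add[OF Ts[of t s] this] show ?thesis by (simp add: Ts_even)
    qed
    then have "T s t + T (- s) t = T 0 t + T (- 0) t"
      by (intro DERIV_isconst_all[of "\<lambda>s. T s t + T (- s) t"] allI)
    then show ?thesis by simp
  qed
  have Tt_even: "snd (Xt s t) + snd (Xt (- s) t) = 2 * snd (Xt 0 t)" for s t
    by (rule DERIV_unique[OF DERIV_add[OF Tt[of s t] Tt[of "- s" t]], unfolded T_even]) (rule DERIV_cmult[OF Tt])
  have "V (P 0 1) * snd (Xt 0 1) = 0" using k3[of 0 1] by simp
  then have t0: "snd (Xt 0 1) = 0" using lapse_positive[of "P 0 1"] by simp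
  \<comment> \<open>in this sum the terms with \<open>\<xi>\<close> cancel, being odd in \<open>s\<close>\<close>
  have "V (P 1 1) * (snd (Xt 1 1) + snd (Xt (- 1) 1)) = - 2 * (T 1 1 + T (- 1) 1)"
    using k3[of 1 1] k3[of "- 1" 1] \<xi>[of 1 1] \<xi>[of "- 1" 1] unfolding Pdist by (simp add: distrib_left)
  then have "T 0 1 = 0" unfolding Tt_even T_even t0 by simp
  then have "G (P 0 1) (X (P 0 1)) (X (P 0 1)) = fst (X (P 0 1)) \<bullet> fst (X (P 0 1))"
    unfolding lapse_metric[OF P] T_def by simp
  then show False using X(2)[rule_format, OF P[of 0 1]] inner_ge_zero[of "fst (X (P 0 1))"] by linarith
qed

lemma diffeo_ident: "diffeo_on exterior exterior (\<lambda>q. q)"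
  unfolding diffeo_on_def
proof (intro conjI)
  show "bij_betw (\<lambda>q. q) exterior exterior" by (simp add: bij_betw_def)
  show "smooth_on exterior (\<lambda>q. q)" by (rule smooth_on_ident[OF open_exterior])
  show "smooth_on exterior (inv_into exterior (\<lambda>q. q))"
    by (rule smooth_on_cong[OF open_exterior _ smooth_on_ident[OF open_exterior]])
      (use inv_into_f_f[of "\<lambda>q. q" exterior] in auto)
qed

end

sublocale example_metric \<subseteq> ident: exterior_chart "lapse_metric k" "\<lambda>q. q"
  by unfold_locales (rule diffeo_ident)

context example_metric begin

lemma D_ident: "frechet_derivative (\<lambda>q. q) (at x) v = v"
  using frechet_derivative_eqI[OF has_derivative_ident[of "at x"]] by simp

lemma sphere_embedding_ident:
  assumes "1 < r"
  shows "sphere_embedding exterior (chart_point (\<lambda>q. q) t r)"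
  unfolding sphere_embedding_def
proof (intro conjI exI)
  let ?c = "chart_point (\<lambda>q. q) t r"
  have c: "?c = (\<lambda>x. (r *\<^sub>R x, t))" by (simp add: fun_eq_iff chart_point_def)
  show "open (UNIV :: (real^3) set)" "sphere 0 1 \<subseteq> (UNIV :: (real^3) set)" by auto
  show "smooth_on UNIV ?c" unfolding c
    by (intro smooth_on_Pair smooth_on_scaleR smooth_on_const smooth_on_ident open_UNIV)
  show "?c ` sphere 0 1 \<subseteq> exterior" using assms by (auto simp: c exterior_iff)
  show "inj_on ?c (sphere 0 1)" using assms by (auto simp: c inj_on_def)
  have "(?c has_derivative (\<lambda>v. (r *\<^sub>R v, 0))) (at x)" for x
    unfolding c by (auto intro!: derivative_eq_intros)
  from frechet_derivative_eqI[OF this]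
  show "\<forall>x\<in>sphere 0 1. \<forall>v. v \<bullet> x = 0 \<and> v \<noteq> 0 \<longrightarrow> frechet_derivative ?c (at x) v \<noteq> 0"
    using assms by (simp add: zero_prod_def)
qed

lemma spacelike_slice_ident: "spacelike G (time_slice (\<lambda>q. q) t)"
  unfolding spacelike_def
proof (intro ballI impI)
  fix p v assume p: "p \<in> time_slice (\<lambda>q. q) t" and v: "v \<in> tangent_space (time_slice (\<lambda>q. q) t) p" "v \<noteq> 0"
  obtain y where y: "p = (y, t)" "1 < norm y" using p unfolding ident.time_slice_eq by auto
  obtain u where u: "v = (u, 0)" using v(1) unfolding y(1) ident.tangent_space_time_slice[OF y(2)] D_ident by blast
  have q: "(y, t) \<in> exterior" using y(2) by (simp add: exterior_iff)
  show "0 < G p v v" using v(2) unfolding y(1) lapse_metric[OF q] u by (simp add: zero_prod_def)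
qed

text \<open>The Christoffel symbols vanish on pairs of spatial vectors, so the second fundamental form is the
Euclidean one of a round sphere.\<close>

lemma mean_curvature_vector_ident:
  assumes y: "1 < norm y"
  obtains c where "mean_curvature_vector G (coordinate_sphere (\<lambda>q. q) t (norm y)) (y, t) = (c *\<^sub>R y, 0)"
proof -
  have q: "(y, t) \<in> exterior" using y by (simp add: exterior_iff)
  interpret S: spacelike_sphere "lapse_metric k" "\<lambda>q. q" y t
    by unfold_locales (use y in \<open>simp_all add: D_ident lapse_metric[OF q]\<close>)
  obtain v w where vw: "S.orthonormal_pair v w" by (rule S.orthonormal_pair_exists)
  have vy: "v \<bullet> y = 0" "w \<bullet> y = 0" using vw unfolding S.orthonormal_pair_def by blast+
  have "frechet_derivative (\<lambda>q :: event. frechet_derivative (\<lambda>q. q) (at q) a) (at x) b = 0" for a b x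
    unfolding D_ident using frechet_derivative_eqI[OF has_derivative_const[of a "at x"]] by simp
  then have hess0: "hess (\<lambda>q. q) (y, t) (a, 0) (b, 0) = 0" for a b
    unfolding hess_def D_ident christoffel_eq[OF q] \<Gamma>_def by (simp add: time_part_def zero_prod_def)
  have II: "S.II a a = (- (a \<bullet> a / (y \<bullet> y))) *\<^sub>R (y, 0)" for a
  proof -
    have "S.II a a = normal_part G S.S (y, t) ((- (a \<bullet> a / (y \<bullet> y))) *\<^sub>R (y, 0))"
      unfolding S.II_def hess0 D_ident by simp
    also have "\<dots> = (- (a \<bullet> a / (y \<bullet> y))) *\<^sub>R (y, 0)"
      unfolding S.normal_part_pair[OF vw] D_ident lapse_metric[OF q] using vy by (simp add: inner_commute)
    finally show ?thesis .
  qed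
  have "mean_curvature_vector G S.S (y, t) = ((- (v \<bullet> v / (y \<bullet> y)) - w \<bullet> w / (y \<bullet> y)) *\<^sub>R y, 0)"
    unfolding S.mean_curvature_vector_eq[OF vw] II by (simp add: scaleR_diff_left)
  then show ?thesis by (rule that)
qed

lemma metric_coeff_ident:
  assumes "(t, r, \<theta>, \<phi>) \<in> coord_domain"
  shows "metric_coeff G (\<lambda>q. q) (dt, dr, d\<theta>, d\<phi>) (dt', dr', d\<theta>', d\<phi>') (t, r, \<theta>, \<phi>) =
    - (V (r *\<^sub>R spherical \<theta> \<phi>, t))\<^sup>2 * (dt * dt') + dr * dr' + r\<^sup>2 * (d\<theta> * d\<theta>' + (sin \<theta>)\<^sup>2 * (d\<phi> * d\<phi>'))"
proof -
  note s = spherical_frame[of \<theta> \<phi>] spherical_frame(4-6)[of \<theta> \<phi>, unfolded inner_commute[of "spherical \<theta> \<phi>"] inner_commute[of "d_polar \<theta> \<phi>" "d_azimuth \<theta> \<phi>"]]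
  show ?thesis
    unfolding metric_coeff_def ident.coord_map_derivative(2,3)[OF assms] D_ident lapse_metric[OF ident.coord_map_derivative(1)[OF assms]]
    by (simp add: inner_add_left inner_add_right s power2_eq_square algebra_simps)
qed

theorem imcvf_chart_ident: "imcvf_chart G (\<lambda>q. q)"
proof -
  have open_cd: "open coord_domain" unfolding coord_domain_def by (intro open_Times open_UNIV open_greaterThan open_greaterThanLessThan)
  note id = smooth_on_ident[OF open_cd]
  have proj: "smooth_on coord_domain (\<lambda>q. fst q)" "smooth_on coord_domain (\<lambda>q. fst (snd q))"
    "smooth_on coord_domain (\<lambda>q. fst (snd (snd q)))" "smooth_on coord_domain (\<lambda>q. snd (snd (snd q)))"
    by (intro smooth_on_linear[OF open_cd bounded_linear_fst] smooth_on_linear[OF open_cd bounded_linear_snd] id)+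
  define v where "v = (\<lambda>q::coords. V (fst (snd q) *\<^sub>R spherical (fst (snd (snd q))) (snd (snd (snd q))), fst q))"
  define a where "a = (\<lambda>q::coords. (fst (snd q))\<^sup>2)"
  define b where "b = (\<lambda>q::coords. (fst (snd q))\<^sup>2 * (sin (fst (snd (snd q))))\<^sup>2)"
  have sv: "smooth_on coord_domain v"
    unfolding v_def spherical_axes
    by (rule smooth_on_compose[OF open_cd smooth_lapse[OF open_UNIV]])
      (intro smooth_on_Pair smooth_on_scaleR smooth_on_add smooth_on_mult smooth_on_sin smooth_on_cos smooth_on_const proj open_cd, simp)
  have sa: "smooth_on coord_domain a" unfolding a_def by (intro smooth_on_power proj open_cd)
  have area: "sqrt (r ^ 4 * (sin \<theta>)\<^sup>2) = r\<^sup>2 * sin \<theta>" if "(t, r, \<theta>, \<phi>) \<in> coord_domain" for t r \<theta> \<phi>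
  proof -
    have "0 \<le> r\<^sup>2 * sin \<theta>" using that sin_gt_zero[of \<theta>] by (simp add: coord_domain_def)
    moreover have "r ^ 4 * (sin \<theta>)\<^sup>2 = (r\<^sup>2 * sin \<theta>)\<^sup>2"
      by (simp add: power_mult_distrib)
    ultimately show ?thesis by simp
  qed
  have sb: "smooth_on coord_domain b" unfolding b_def by (intro smooth_on_mult smooth_on_power smooth_on_sin proj open_cd)
  show ?thesis
    unfolding imcvf_chart_def
  proof (intro conjI allI impI ballI)
    show "diffeo_on exterior exterior (\<lambda>q. q)" by (rule diffeo_ident)
    show "sphere_embedding exterior (chart_point (\<lambda>q. q) t r)" if "1 < r" for t r by (rule sphere_embedding_ident[OF that])
    show "spacelike G (time_slice (\<lambda>q. q) t)" for t by (rule spacelike_slice_ident)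
    show "mean_curvature_vector G (coordinate_sphere (\<lambda>q. q) t r) p \<in> tangent_space (time_slice (\<lambda>q. q) t) p"
      if r: "1 < r" and p: "p \<in> coordinate_sphere (\<lambda>q. q) t r" for t r p
    proof -
      obtain y where y: "norm y = r" "p = (y, t)" using p r ident.coordinate_sphere_eq[of r t] by auto
      have y1: "1 < norm y" using y r by simp
      obtain c where "mean_curvature_vector G (coordinate_sphere (\<lambda>q. q) t (norm y)) (y, t) = (c *\<^sub>R y, 0)"
        by (rule mean_curvature_vector_ident[OF y1])
      then show ?thesis using ident.tangent_space_time_slice[OF y1, of t] unfolding y D_ident by auto
    qed
  qed (rule exI[of _ "\<lambda>q. 1"], rule exI[of _ v], rule exI[of _ a], rule exI[of _ b],
      rule exI[of _ "\<lambda>q. 0"], rule exI[of _ "\<lambda>q. 0"], rule exI[of _ "\<lambda>q. 0"], rule exI[of _ "\<lambda>q. 0"],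
      auto simp: sv[unfolded v_def] sa[unfolded a_def] sb[unfolded b_def] smooth_on_const metric_coeff_ident v_def a_def b_def area)
qed

end

theorem theorem1p4:
  shows "infinite {g \<in> extensional exterior.
           spacetime exterior g \<and> \<not> spherically_symmetric exterior g \<and> \<not> static exterior g \<and>
           (\<exists>\<Phi>. imcvf_chart g \<Phi>)} \<and>
         (\<forall>g \<Phi>. spacetime exterior g \<and> \<not> spherically_symmetric exterior g \<and>
                 \<not> static exterior g \<and> imcvf_chart g \<Phi> \<longrightarrow>
            (\<forall>t. smooth_imcv_flow exterior g {0<..} (\<lambda>x s. chart_point \<Phi> t (exp (s / 2)) x)))"
proof (intro conjI allI impI)
  let ?A = "{g \<in> extensional exterior.
           spacetime exterior g \<and> \<not> spherically_symmetric exterior g \<and> \<not> static exterior g \<and>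
           (\<exists>\<Phi>. imcvf_chart g \<Phi>)}"
  let ?g = "\<lambda>n::nat. lapse_metric (real n + 1)"
  have "?g n \<in> ?A" for n
  proof -
    interpret example_metric "real n + 1" by unfold_locales simp
    have "?g n \<in> extensional exterior" unfolding lapse_metric_def by (rule restrict_extensional)
    then show ?thesis
      using spacetime_lapse_metric[OF k] not_spherically_symmetric not_static imcvf_chart_ident by blast
  qed
  moreover have "inj ?g"
  proof (rule injI)
    fix m n assume "?g m = ?g n"
    then have "?g m (center, 0) (0, 1) (0, 1) = ?g n (center, 0) (0, 1) (0, 1)" by simp
    then have "(real m + 1)\<^sup>2 = (real n + 1)\<^sup>2"
      unfolding lapse_metric[OF center_in_exterior] by (simp add: lapse_def dist_sq_def)
    then have "real m + 1 = real n + 1" by (rule power2_eq_imp_eq) simp_all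
    then show "m = n" by simp
  qed
  ultimately show "infinite ?A"
    using infinite_super[of "range ?g" ?A] range_inj_infinite[of ?g] by blast
next
  fix g \<Phi> t
  assume a: "spacetime exterior g \<and> \<not> spherically_symmetric exterior g \<and> \<not> static exterior g \<and> imcvf_chart g \<Phi>"
  interpret imcvf_exterior g \<Phi>
    by unfold_locales (use a in \<open>auto simp: spacetime_def imcvf_chart_def\<close>)
  show "smooth_imcv_flow exterior g {0<..} (\<lambda>x s. chart_point \<Phi> t (exp (s / 2)) x)"
    by (rule coordinate_spheres_flow)
qed

end
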